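(* Let $r\ge3$, $1\le q\le r-2$, and let $d_0,\dots,d_q\ge1$ be integers. Then the variety $\mathscr R(r,d_0,\dots,d_q)$ is rational (i.e. birational to a projective space over $\mathbb C$).
   Context: Everything is over $\mathbb C$; $\mathbb P(V)$ is the space of lines in $V$. Let $R=\sum_{i=0}^r x_i\,\partial/\partial x_i$ and let $i_R$ be contraction with $R$. $H^0(\mathbb P^r,\Omega^q(m))$ is identified with the space of homogeneous polynomial $q$-forms $\omega$ on $\mathbb C^{r+1}$ with coefficients of degree $m-q$ and $i_R\omega=0$. $\mathscr R(r,d_0,\dots,d_q)$ is the closure (with reduced structure) of the image of the rational map $$\rho:\prod_{i=0}^q\mathbb P(H^0(\mathbb P^r,\mathcal O(d_i)))\dashrightarrow\mathbb P\Big(H^0\big(\mathbb P^r,\Omega^q(\textstyle\sum_i d_i)\big)\Big),\quad (F_0,\dots,F_q)\mapsto i_R(dF_0\wedge\cdots\wedge dF_q).$$ *)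

theory Defs
  imports "HOL-Library.Poly_Mapping" "HOL-Library.Function_Algebras"
    "HOL-Analysis.Abstract_Topology"
begin

section \<open>Complex vector spaces\<close>

class complex_vector = ab_group_add +
  fixes scaleC :: "complex \<Rightarrow> 'a \<Rightarrow> 'a"
  assumes scaleC_add_right: "scaleC a (x + y) = scaleC a x + scaleC a y"
    and scaleC_add_left: "scaleC (a + b) x = scaleC a x + scaleC b x"
    and scaleC_scaleC: "scaleC a (scaleC b x) = scaleC (a * b) x"
    and scaleC_one: "scaleC 1 x = x"

interpretation complex_vector: vector_space "scaleC :: complex \<Rightarrow> 'a \<Rightarrow> 'a :: complex_vector"
  by unfold_locales (simp_all add: scaleC_add_right scaleC_add_left scaleC_scaleC scaleC_one)

instantiation complex :: complex_vector
begin
definition scaleC_complex :: "complex \<Rightarrow> complex \<Rightarrow> complex" where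
  "scaleC_complex = (*)"
instance
  by standard (simp_all add: scaleC_complex_def algebra_simps)
end

instantiation "fun" :: (type, complex_vector) complex_vector
begin
definition scaleC_fun :: "complex \<Rightarrow> ('a \<Rightarrow> 'b) \<Rightarrow> 'a \<Rightarrow> 'b" where
  "scaleC_fun c f = (\<lambda>x. scaleC c (f x))"
instance
  by standard (simp_all add: scaleC_fun_def fun_eq_iff
      scaleC_add_right scaleC_add_left scaleC_scaleC scaleC_one)
end

instantiation poly_mapping :: (type, complex_vector) complex_vector
begin
definition scaleC_poly_mapping :: "complex \<Rightarrow> ('a \<Rightarrow>\<^sub>0 'b) \<Rightarrow> 'a \<Rightarrow>\<^sub>0 'b" where
  "scaleC_poly_mapping c p = Poly_Mapping.map (scaleC c) p"

lemma lookup_scaleC: "Poly_Mapping.lookup (scaleC c p) k = scaleC c (Poly_Mapping.lookup p k)"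
  for p :: "'a \<Rightarrow>\<^sub>0 'b"
  by (auto simp: scaleC_poly_mapping_def Poly_Mapping.map.rep_eq when_def)

instance
  by standard (simp_all add: poly_mapping_eq_iff fun_eq_iff lookup_scaleC lookup_add
      scaleC_add_right scaleC_add_left scaleC_scaleC scaleC_one)
end


section \<open>Projective spaces and their Zariski topology\<close>

text \<open>Homogeneous polynomial functions of degree \<open>m\<close>, without a choice of coordinates: the span of
  the products of \<open>m\<close> linear functionals. A linear functional on a subspace extends to the whole
  type, so on a subspace these restrict to the homogeneous polynomial functions of that subspace.\<close>

inductive homogeneous_fun :: "nat \<Rightarrow> ('v :: complex_vector \<Rightarrow> complex) \<Rightarrow> bool" where
  const: "homogeneous_fun 0 (\<lambda>_. c)"
| add: "homogeneous_fun m f \<Longrightarrow> homogeneous_fun m g \<Longrightarrow> homogeneous_fun m (\<lambda>v. f v + g v)"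
| mult: "Vector_Spaces.linear scaleC scaleC l \<Longrightarrow> homogeneous_fun m f \<Longrightarrow>
    homogeneous_fun (Suc m) (\<lambda>v. l v * f v)"

definition homogeneous_map :: "nat \<Rightarrow> ('v :: complex_vector \<Rightarrow> 'w :: complex_vector) \<Rightarrow> bool" where
  "homogeneous_map m F \<longleftrightarrow>
     (\<forall>l. Vector_Spaces.linear scaleC scaleC l \<longrightarrow> homogeneous_fun m (\<lambda>v. l (F v)))"

definition line :: "'v :: complex_vector \<Rightarrow> 'v set" where
  "line v = range (\<lambda>c. scaleC c v)"

text \<open>Below, \<open>V\<close> and \<open>W\<close> always stand for finite-dimensional linear subspaces.\<close>

definition proj_space :: "'v :: complex_vector set \<Rightarrow> 'v set set" where
  "proj_space V = {line v | v. v \<in> V \<and> v \<noteq> 0}"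

text \<open>The locus where not all of the forms in \<open>S\<close> vanish.\<close>

definition nonvanishing_locus ::
    "'v :: complex_vector set \<Rightarrow> ('v \<Rightarrow> complex) set \<Rightarrow> 'v set set" where
  "nonvanishing_locus V S = {line v | v. v \<in> V \<and> v \<noteq> 0 \<and> (\<exists>f\<in>S. f v \<noteq> 0)}"

definition zariski :: "'v :: complex_vector set \<Rightarrow> 'v set topology" where
  "zariski V = topology (\<lambda>U. \<exists>S. (\<forall>f\<in>S. \<exists>m. homogeneous_fun m f) \<and> U = nonvanishing_locus V S)"

lemma homogeneous_fun_scale: "homogeneous_fun m f \<Longrightarrow> f (scaleC c v) = c ^ m * f v"
proof (induction rule: homogeneous_fun.induct)
  case (mult l m f)
  then interpret Vector_Spaces.linear scaleC scaleC l by simp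
  show ?case using mult by (simp add: scale scaleC_complex_def)
qed (simp_all add: algebra_simps)

lemma homogeneous_fun_mult:
  "homogeneous_fun m f \<Longrightarrow> homogeneous_fun n g \<Longrightarrow> homogeneous_fun (m + n) (\<lambda>v. f v * g v)"
proof (induction rule: homogeneous_fun.induct)
  case (const c)
  then show ?case
  proof (induction rule: homogeneous_fun.induct)
    case (const c')
    show ?case using homogeneous_fun.const[of "c * c'"] by simp
  next
    case (add m f g)
    then show ?case using homogeneous_fun.add[of m "\<lambda>v. c * f v" "\<lambda>v. c * g v"]
      by (simp add: algebra_simps)
  next
    case (mult l m f)
    then show ?case using homogeneous_fun.mult[of l m "\<lambda>v. c * f v"] by (simp add: mult.left_commute)
  qed
next
  case (add m f f')
  then show ?case
    using homogeneous_fun.add[of "m + n" "\<lambda>v. f v * g v" "\<lambda>v. f' v * g v"]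
    by (simp add: algebra_simps)
next
  case (mult l m f)
  then show ?case using homogeneous_fun.mult[of l "m + n" "\<lambda>v. f v * g v"] by (simp add: mult.assoc)
qed

lemma line_eqD:
  assumes "line v = line w" "w \<noteq> 0"
  obtains c where "c \<noteq> 0" "w = scaleC c v"
proof -
  have "w \<in> line w"
    unfolding line_def by (metis rangeI scaleC_one)
  with assms obtain c where "w = scaleC c v" by (auto simp: line_def)
  with assms that show ?thesis by (metis complex_vector.scale_zero_left)
qed

lemma nonvanishing_locusI:
  "v \<in> V \<Longrightarrow> v \<noteq> 0 \<Longrightarrow> f \<in> S \<Longrightarrow> f v \<noteq> 0 \<Longrightarrow> line v \<in> nonvanishing_locus V S"
  unfolding nonvanishing_locus_def by blast

lemma nonvanishing_locusE:
  assumes "p \<in> nonvanishing_locus V S"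
  obtains v f where "p = line v" "v \<in> V" "v \<noteq> 0" "f \<in> S" "f v \<noteq> 0"
  using assms unfolding nonvanishing_locus_def by blast

lemma openin_zariski:
  "openin (zariski V) U \<longleftrightarrow> (\<exists>S. (\<forall>f\<in>S. \<exists>m. homogeneous_fun m f) \<and> U = nonvanishing_locus V S)"
proof -
  define H where "H = (\<lambda>S :: ('a \<Rightarrow> complex) set. \<forall>f\<in>S. \<exists>m. homogeneous_fun m f)"
  have "istopology (\<lambda>U. \<exists>S. H S \<and> U = nonvanishing_locus V S)"
    unfolding istopology_def
  proof (intro conjI allI impI)
    fix A B :: "'a set set"
    assume "\<exists>S. H S \<and> A = nonvanishing_locus V S" "\<exists>S. H S \<and> B = nonvanishing_locus V S"
    then obtain S T where S: "H S" "A = nonvanishing_locus V S"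
      and T: "H T" "B = nonvanishing_locus V T" by blast
    define P where "P = {\<lambda>v. f v * g v | f g. f \<in> S \<and> g \<in> T}"
    have "H P"
      unfolding H_def
    proof
      fix h assume "h \<in> P"
      then obtain f g where "h = (\<lambda>v. f v * g v)" "f \<in> S" "g \<in> T" unfolding P_def by blast
      with S(1) T(1) show "\<exists>m. homogeneous_fun m h"
        unfolding H_def by (metis homogeneous_fun_mult)
    qed
    moreover have "A \<inter> B = nonvanishing_locus V P"
    proof (intro equalityI subsetI)
      fix p assume "p \<in> A \<inter> B"
      then have "p \<in> nonvanishing_locus V S" "p \<in> nonvanishing_locus V T" using S(2) T(2) by auto
      then obtain v f w g where v: "p = line v" "v \<in> V" "v \<noteq> 0" "f \<in> S" "f v \<noteq> 0"
        and w: "p = line w" "w \<noteq> 0" "g \<in> T" "g w \<noteq> 0"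
        by (elim nonvanishing_locusE)
      obtain c where "w = scaleC c v" using v(1) w(1,2) line_eqD by metis
      moreover obtain m where "homogeneous_fun m g" using w(3) T(1) unfolding H_def by blast
      ultimately have "g w = c ^ m * g v" using homogeneous_fun_scale by metis
      then have "f v * g v \<noteq> 0" using v(5) w(4) by auto
      moreover have "(\<lambda>v. f v * g v) \<in> P" using v(4) w(3) unfolding P_def by blast
      ultimately show "p \<in> nonvanishing_locus V P"
        using nonvanishing_locusI[of v V "\<lambda>v. f v * g v" P] v(1-3) by simp
    next
      fix p assume "p \<in> nonvanishing_locus V P"
      then obtain v h where v: "p = line v" "v \<in> V" "v \<noteq> 0" "h \<in> P" "h v \<noteq> 0"
        by (elim nonvanishing_locusE)
      then obtain f g where fg: "h = (\<lambda>v. f v * g v)" "f \<in> S" "g \<in> T" unfolding P_def by blast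
      then have "f v \<noteq> 0" "g v \<noteq> 0" using v(5) by auto
      then show "p \<in> A \<inter> B"
        using v(1-3) fg(2,3) S(2) T(2) nonvanishing_locusI[of v V] by simp
    qed
    ultimately show "\<exists>S. H S \<and> A \<inter> B = nonvanishing_locus V S" by blast
  next
    fix K :: "'a set set set"
    assume "\<forall>U\<in>K. \<exists>S. H S \<and> U = nonvanishing_locus V S"
    then obtain S where S: "\<And>U. U \<in> K \<Longrightarrow> H (S U)"
      "\<And>U. U \<in> K \<Longrightarrow> U = nonvanishing_locus V (S U)" by metis
    have "H (\<Union>(S ` K))" using S(1) unfolding H_def by (meson UN_E)
    moreover have "\<Union>K = nonvanishing_locus V (\<Union>(S ` K))"
    proof (intro equalityI subsetI)
      fix p assume "p \<in> \<Union>K"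
      then obtain U where U: "U \<in> K" "p \<in> nonvanishing_locus V (S U)" using S(2) by blast
      from U(2) obtain v f where "p = line v" "v \<in> V" "v \<noteq> 0" "f \<in> S U" "f v \<noteq> 0"
        by (rule nonvanishing_locusE)
      then show "p \<in> nonvanishing_locus V (\<Union>(S ` K))"
        using U(1) nonvanishing_locusI[of v V f "\<Union>(S ` K)"] by blast
    next
      fix p assume "p \<in> nonvanishing_locus V (\<Union>(S ` K))"
      then obtain v f where v: "p = line v" "v \<in> V" "v \<noteq> 0" "f \<in> \<Union>(S ` K)" "f v \<noteq> 0"
        by (rule nonvanishing_locusE)
      then obtain U where "U \<in> K" "f \<in> S U" by blast
      then have "p \<in> nonvanishing_locus V (S U)"
        using v nonvanishing_locusI[of v V f "S U"] by simp
      then show "p \<in> \<Union>K" using S(2) \<open>U \<in> K\<close> by blast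
    qed
    ultimately show "\<exists>S. H S \<and> \<Union>K = nonvanishing_locus V S" by blast
  qed
  then show ?thesis by (simp add: zariski_def H_def)
qed

lemma topspace_zariski [simp]: "topspace (zariski V) = proj_space V"
proof
  have "nonvanishing_locus V S \<subseteq> proj_space V" for S
    unfolding nonvanishing_locus_def proj_space_def by blast
  then show "topspace (zariski V) \<subseteq> proj_space V"
    by (metis openin_topspace openin_zariski)
  have "homogeneous_fun 0 (\<lambda>_ :: 'a. 1)" by (rule homogeneous_fun.const)
  then have "openin (zariski V) (nonvanishing_locus V {\<lambda>_. 1})"
    unfolding openin_zariski by blast
  moreover have "nonvanishing_locus V {\<lambda>_. 1} = proj_space V"
    by (simp add: nonvanishing_locus_def proj_space_def)
  ultimately show "proj_space V \<subseteq> topspace (zariski V)" by (metis openin_subset)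
qed


section \<open>Rational maps and rational varieties\<close>

definition regular_map ::
    "'v :: complex_vector set \<Rightarrow> 'v set set \<Rightarrow> 'w :: complex_vector set \<Rightarrow> ('v set \<Rightarrow> 'w set) \<Rightarrow> bool"
  where
  "regular_map V U W \<phi> \<longleftrightarrow> \<phi> ` U \<subseteq> proj_space W \<and>
     (\<forall>p\<in>U. \<exists>N m F. openin (subtopology (zariski V) U) N \<and> p \<in> N \<and> homogeneous_map m F \<and>
        (\<forall>v. v \<noteq> 0 \<and> line v \<in> N \<longrightarrow> F v \<noteq> 0 \<and> \<phi> (line v) = line (F v)))"

definition dense_open :: "'v :: complex_vector set \<Rightarrow> 'v set set \<Rightarrow> 'v set set \<Rightarrow> bool" where
  "dense_open V X U \<longleftrightarrow>
     openin (subtopology (zariski V) X) U \<and> subtopology (zariski V) X closure_of U = X"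

definition rational_map ::
    "'v :: complex_vector set \<Rightarrow> 'v set set \<Rightarrow> 'w :: complex_vector set \<Rightarrow> 'w set set \<Rightarrow>
     'v set set \<Rightarrow> ('v set \<Rightarrow> 'w set) \<Rightarrow> bool" where
  "rational_map V X W Y A \<phi> \<longleftrightarrow> dense_open V X A \<and> regular_map V A W \<phi> \<and> \<phi> ` A \<subseteq> Y"

text \<open>Mutually inverse rational maps between \<open>X \<subseteq> \<P>(V)\<close> and \<open>Y \<subseteq> \<P>(W)\<close>. As domains of definition
  are dense (and not just nonempty), anything birational to an irreducible variety
  is irreducible.\<close>

definition birational ::
    "'v :: complex_vector set \<Rightarrow> 'v set set \<Rightarrow> 'w :: complex_vector set \<Rightarrow> 'w set set \<Rightarrow> bool" where
  "birational V X W Y \<longleftrightarrow> (\<exists>A \<phi> B \<psi>.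
     rational_map V X W Y A \<phi> \<and> rational_map W Y V X B \<psi> \<and>
     dense_open V X {p \<in> A. \<phi> p \<in> B} \<and> (\<forall>p\<in>A. \<phi> p \<in> B \<longrightarrow> \<psi> (\<phi> p) = p) \<and>
     dense_open W Y {p \<in> B. \<psi> p \<in> A} \<and> (\<forall>p\<in>B. \<psi> p \<in> A \<longrightarrow> \<phi> (\<psi> p) = p))"

definition affine_space :: "nat \<Rightarrow> (nat \<Rightarrow> complex) set" where
  "affine_space n = {v. \<forall>i\<ge>n. v i = 0}"

definition rational_variety :: "'v :: complex_vector set \<Rightarrow> 'v set set \<Rightarrow> bool" where
  "rational_variety V X \<longleftrightarrow>
     (\<exists>n. birational V X (affine_space (Suc n)) (proj_space (affine_space (Suc n))))"


section \<open>Polynomials and polynomial differential forms\<close>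

type_synonym polynomial = "(nat \<Rightarrow>\<^sub>0 nat) \<Rightarrow>\<^sub>0 complex"

definition Var :: "nat \<Rightarrow> polynomial" where
  "Var i = Poly_Mapping.single (Poly_Mapping.single i 1) 1"

text \<open>The truncated subtraction is harmless: its coefficient vanishes if \<open>x\<^sub>i\<close> does not divide the
  monomial.\<close>

definition partial_deriv :: "nat \<Rightarrow> polynomial \<Rightarrow> polynomial" where
  "partial_deriv i p = (\<Sum>m\<in>Poly_Mapping.keys p.
     Poly_Mapping.single (m - Poly_Mapping.single i 1)
       (of_nat (Poly_Mapping.lookup m i) * Poly_Mapping.lookup p m))"

text \<open>Homogeneous polynomials of degree \<open>d\<close> in \<open>x\<^sub>0, \<dots>, x\<^sub>r\<close>, i.e. the global sections of \<open>\<O>(d)\<close>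
  on \<open>\<P>\<^sup>r\<close>.\<close>

definition homogeneous_polys :: "nat \<Rightarrow> nat \<Rightarrow> polynomial set" where
  "homogeneous_polys r d = {p. \<forall>m\<in>Poly_Mapping.keys p.
     Poly_Mapping.keys m \<subseteq> {..r} \<and> (\<Sum>i\<le>r. Poly_Mapping.lookup m i) = d}"

text \<open>The value of a form at \<open>I = {i\<^sub>1 < \<dots> < i\<^sub>k}\<close> is its coefficient of
  \<open>dx\<^bsub>i\<^sub>1\<^esub> \<and> \<dots> \<and> dx\<^bsub>i\<^sub>k\<^esub>\<close>.\<close>

type_synonym diff_form = "nat set \<Rightarrow> polynomial"

definition differential :: "polynomial \<Rightarrow> diff_form" where
  "differential p I = (if is_singleton I then partial_deriv (the_elem I) p else 0)"

definition wedge :: "diff_form \<Rightarrow> diff_form \<Rightarrow> diff_form" where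
  "wedge \<alpha> \<beta> K =
     (\<Sum>I\<in>Pow K. (- 1) ^ card {(i, j). i \<in> I \<and> j \<in> K - I \<and> j < i} * \<alpha> I * \<beta> (K - I))"

definition unit_form :: diff_form where
  "unit_form I = (if I = {} then 1 else 0)"

text \<open>Contraction with the radial vector field \<open>\<Sum>\<^sub>i x\<^sub>i \<partial>/\<partial>x\<^sub>i\<close>.\<close>

definition contract_radial :: "nat \<Rightarrow> diff_form \<Rightarrow> diff_form" where
  "contract_radial r \<omega> J =
     (\<Sum>i\<in>{..r} - J. (- 1) ^ card {j \<in> J. j < i} * Var i * \<omega> (insert i J))"

text \<open>The global sections of \<open>\<Omega>\<^sup>q(m)\<close> on \<open>\<P>\<^sup>r\<close>.\<close>

definition twisted_forms :: "nat \<Rightarrow> nat \<Rightarrow> nat \<Rightarrow> diff_form set" where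
  "twisted_forms r q m = {\<omega>.
     (\<forall>I. \<omega> I \<noteq> 0 \<longrightarrow> I \<subseteq> {..r} \<and> card I = q \<and> q \<le> m \<and> \<omega> I \<in> homogeneous_polys r (m - q)) \<and>
     contract_radial r \<omega> = 0}"


section \<open>The varieties of rational forms\<close>

definition rho :: "nat \<Rightarrow> nat \<Rightarrow> (nat \<Rightarrow> polynomial) \<Rightarrow> diff_form" where
  "rho r q F = contract_radial r (foldr (\<lambda>i. wedge (differential (F i))) [0..<Suc q] unit_form)"

definition rho_image :: "nat \<Rightarrow> nat \<Rightarrow> (nat \<Rightarrow> nat) \<Rightarrow> diff_form set set" where
  "rho_image r q d = {line (rho r q F) | F.
     (\<forall>i\<le>q. F i \<in> homogeneous_polys r (d i) \<and> F i \<noteq> 0) \<and> rho r q F \<noteq> 0}"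

definition rational_forms :: "nat \<Rightarrow> nat \<Rightarrow> (nat \<Rightarrow> nat) \<Rightarrow> diff_form set set" where
  "rational_forms r q d = zariski (twisted_forms r q (\<Sum>i\<le>q. d i)) closure_of rho_image r q d"

end

theory Submission
  imports Defs "HOL-Computational_Algebra.Polynomial" "Jordan_Normal_Form.Determinant"
begin

text \<open>The form \<open>\<omega> = i\<^sub>R \<Omega>\<close> with \<open>\<Omega> = dF\<^sub>0 \<and> \<dots> \<and> dF\<^sub>q\<close> determines \<open>\<Omega>\<close>, since \<open>d\<omega> = (\<Sum>d\<^sub>i) \<Omega>\<close> by Euler's
  identity (\<open>ext_deriv_rho\<close>). Therefore \<open>dG \<and> d\<omega> = 0\<close> is a system of linear equations for a
  polynomial \<open>G\<close> whose coefficients are linear in \<open>\<omega>\<close>, and every element of \<open>\<complex>[F\<^sub>0, \<dots>, F\<^sub>q]\<close> is a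
  solution. The idea is to recover from \<open>\<omega>\<close>, by solving this system, a normal form of the
  generators of that algebra.

  The normal form is modelled on the tuple of monomials \<open>p\<^sub>i = x\<^sub>i z\<^bsup>d\<^sub>i - 1\<^esup>\<close> with \<open>z = x\<^bsub>q+1\<^esub>\<close>. Call
  the products of powers of the \<open>p\<^sub>i\<close> pivotal and all other monomials free. For generic \<open>F\<close> the
  elements of degree \<open>d\<^sub>i\<close> of \<open>\<complex>[F\<^sub>0, \<dots>, F\<^sub>q]\<close> are determined by their pivotal coefficients, which
  can be prescribed; so there is one of the form \<open>G\<^sub>i = p\<^sub>i +\<close> (a combination of free monomials).
  Each \<open>dG\<^sub>i\<close> is a combination of the \<open>dF\<^sub>j\<close> with polynomial coefficients, hence
  \<open>dG\<^sub>0 \<and> \<dots> \<and> dG\<^sub>q = h \<Omega>\<close> for a polynomial \<open>h\<close>, which is a constant because both sides have the same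
  degree (\<open>rho_of_gradient_combinations\<close>). Thus a general point of the variety comes from the
  affine space of tuples in normal form.

  Conversely, the coefficients of the \<open>G\<^sub>i\<close> at the free monomials are rational functions of \<open>\<omega>\<close>: as
  many of the equations \<open>dG \<and> d\<omega> = 0\<close> as there are unknowns can be chosen such that the square
  system is invertible at \<open>F = p\<close>, and Cramer's rule applies. At \<open>F = p\<close> everything is monomial:
  for a monomial \<open>m\<close>, the coefficient at a given index set of \<open>dm \<and> dp\<^sub>0 \<and> \<dots> \<and> dp\<^sub>q\<close> is a maximal
  minor of the matrix of exponents, times a monomial, and different \<open>m\<close> give different monomials.
  So the system becomes diagonal, and its diagonal entry at \<open>m\<close> can be made nonzero as soon as the
  exponent of \<open>m\<close> is not in the rational span of the exponents of the \<open>p\<^sub>i\<close>. That is exactly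
  freeness: a natural exponent vector in that span is a combination whose coefficients can be read
  off at \<open>x\<^sub>0, \<dots>, x\<^sub>q\<close>, so they are natural numbers (\<open>off_pivot_part_nonzero\<close>).

  The two maps are given by homogeneous polynomials and are inverse to each other up to scalars,
  on tuples in normal form and on general \<open>F\<close> respectively. What remains is the passage from
  general \<open>F\<close> to the closure of the image, in \<open>rational_variety_if_generically_invertible\<close>: if two
  polynomial functions on a linear space of tuples are both nonzero, then they are nonzero at a
  common tuple, because on a line nonzero polynomials have only finitely many roots.\<close>

section \<open>Linear and homogeneous maps\<close>

abbreviation clinear :: "('a :: complex_vector \<Rightarrow> 'b :: complex_vector) \<Rightarrow> bool" where
  "clinear \<equiv> Vector_Spaces.linear scaleC scaleC"

lemma clinearI:
  assumes "\<And>x y. f (x + y) = f x + f y" "\<And>c x. f (scaleC c x) = scaleC c (f x)"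
  shows "clinear f"
  unfolding Vector_Spaces.linear_iff by (intro conjI allI complex_vector.vector_space_axioms assms)

lemma clinear_add: "clinear f \<Longrightarrow> f (x + y) = f x + f y"
  and clinear_scale: "clinear f \<Longrightarrow> f (scaleC c x) = scaleC c (f x)"
  unfolding Vector_Spaces.linear_iff by auto

lemma clinear_zero: "clinear f \<Longrightarrow> f 0 = 0"
  using clinear_add[of f 0 0] by simp

lemma clinear_diff: "clinear f \<Longrightarrow> f (x - y) = f x - f y"
  using clinear_add[of f "x - y" y] by simp

lemma clinear_sum: "clinear f \<Longrightarrow> f (\<Sum>i\<in>I. g i) = (\<Sum>i\<in>I. f (g i))"
  by (induction I rule: infinite_finite_induct) (auto simp: clinear_zero clinear_add)

lemma clinear_compose: "clinear f \<Longrightarrow> clinear g \<Longrightarrow> clinear (\<lambda>x. f (g x))"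
  by (rule clinearI) (simp_all add: clinear_add clinear_scale)

lemma scaleC_complex [simp]: "scaleC a b = a * b" for a b :: complex
  by (simp add: scaleC_complex_def)

lemma scaleC_fun_apply [simp]: "scaleC c f x = scaleC c (f x)"
  by (simp add: scaleC_fun_def)

lemma clinear_apply: "clinear (\<lambda>f. f x)"
  by (rule clinearI) auto

lemma scaleC_sum_right: "scaleC c (\<Sum>i\<in>I. g i) = (\<Sum>i\<in>I. scaleC c (g i))"
  by (rule complex_vector.scale_sum_right)

lemma exists_functional:
  fixes v :: "'a :: complex_vector"
  assumes "v \<noteq> 0"
  obtains l :: "'a \<Rightarrow> complex" where "clinear l" "l v = 1"
proof -
  interpret vector_space_pair "scaleC :: complex \<Rightarrow> 'a \<Rightarrow> 'a" "scaleC :: complex \<Rightarrow> complex \<Rightarrow> complex"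
    by unfold_locales
  have "complex_vector.independent {v}" using assms by simp
  from linear_independent_extend[OF this, of "\<lambda>_. 1"] show ?thesis using that by blast
qed

text \<open>Being parallel is thus a closed condition, given by the vanishing of the \<open>2 \<times> 2\<close> minors.
  Evaluating on all linear functionals, instead of coordinates, suits the coordinate-free notion
  of a homogeneous map.\<close>

lemma parallel_if_minors_vanish:
  fixes v w :: "'a :: complex_vector"
  assumes "v \<noteq> 0"
    and eq: "\<And>l l' :: 'a \<Rightarrow> complex. clinear l \<Longrightarrow> clinear l' \<Longrightarrow> l w * l' v = l' w * l v"
  obtains c where "w = scaleC c v"
proof -
  obtain l' :: "'a \<Rightarrow> complex" where l': "clinear l'" "l' v = 1" by (rule exists_functional[OF assms(1)])
  have "w = scaleC (l' w) v"
  proof (rule ccontr)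
    assume "w \<noteq> scaleC (l' w) v"
    then obtain l :: "'a \<Rightarrow> complex" where l: "clinear l" "l (w - scaleC (l' w) v) = 1"
      by (metis exists_functional right_minus_eq)
    then show False
      using eq[OF l(1) l'(1)] l'(2) by (simp add: clinear_diff clinear_scale)
  qed
  then show ?thesis by (rule that)
qed

lemma line_scale:
  assumes "c \<noteq> 0" shows "line (scaleC c v) = line v"
proof -
  have "scaleC t v \<in> line (scaleC c v)" for t
    unfolding line_def using assms by (intro range_eqI[of _ _ "t / c"]) (simp add: scaleC_scaleC)
  then show ?thesis unfolding line_def by (auto simp: scaleC_scaleC)
qed

lemma homogeneous_fun_linear: "clinear l \<Longrightarrow> homogeneous_fun 1 l"
  using homogeneous_fun.mult[OF _ homogeneous_fun.const[of 1]] by simp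

lemma homogeneous_fun_cmult: "homogeneous_fun m f \<Longrightarrow> homogeneous_fun m (\<lambda>v. c * f v)"
  using homogeneous_fun_mult[OF homogeneous_fun.const[of c]] by simp

lemma homogeneous_fun_zero: "homogeneous_fun m (\<lambda>_. 0)"
proof (induction m)
  case 0 show ?case by (rule homogeneous_fun.const)
next
  case (Suc m)
  have "clinear (\<lambda>_. 0 :: complex)" by (rule clinearI) simp_all
  from homogeneous_fun.mult[OF this Suc] show ?case by simp
qed

lemma homogeneous_fun_sum:
  "(\<And>i. i \<in> I \<Longrightarrow> homogeneous_fun m (f i)) \<Longrightarrow> homogeneous_fun m (\<lambda>v. \<Sum>i\<in>I. f i v)"
  by (induction I rule: infinite_finite_induct) (auto intro: homogeneous_fun_zero homogeneous_fun.add)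

lemma homogeneous_fun_prod:
  "finite I \<Longrightarrow> (\<And>i. i \<in> I \<Longrightarrow> homogeneous_fun (m i) (f i)) \<Longrightarrow>
    homogeneous_fun (\<Sum>i\<in>I. m i) (\<lambda>v. \<Prod>i\<in>I. f i v)"
  by (induction I rule: finite_induct) (auto intro: homogeneous_fun.const homogeneous_fun_mult)

lemma homogeneous_fun_diff:
  "homogeneous_fun m f \<Longrightarrow> homogeneous_fun m g \<Longrightarrow> homogeneous_fun m (\<lambda>v. f v - g v)"
  using homogeneous_fun.add[of m f "\<lambda>v. -1 * g v"] homogeneous_fun_cmult[of m g "-1"] by simp

lemma homogeneous_fun_compose:
  assumes "homogeneous_fun n f" "homogeneous_map m F"
  shows "homogeneous_fun (n * m) (\<lambda>v. f (F v))"
  using assms(1)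
proof (induction rule: homogeneous_fun.induct)
  case (mult l n f)
  then show ?case
    using homogeneous_fun_mult[of m "\<lambda>v. l (F v)"] assms(2) unfolding homogeneous_map_def by simp
qed (auto intro: homogeneous_fun.const homogeneous_fun.add)

lemma homogeneous_map_compose:
  "homogeneous_map n G \<Longrightarrow> homogeneous_map m F \<Longrightarrow> homogeneous_map (n * m) (\<lambda>v. G (F v))"
  unfolding homogeneous_map_def[of _ "\<lambda>v. G (F v)"] homogeneous_map_def[of _ G]
  using homogeneous_fun_compose[of n _ m F] by blast

lemma homogeneous_map_scale:
  assumes "homogeneous_map m F" shows "F (scaleC c v) = scaleC (c ^ m) (F v)"
proof (rule ccontr)
  assume "F (scaleC c v) \<noteq> scaleC (c ^ m) (F v)"
  then obtain l :: "'b \<Rightarrow> complex" where l: "clinear l" "l (F (scaleC c v) - scaleC (c ^ m) (F v)) = 1"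
    by (metis exists_functional right_minus_eq)
  moreover have "l (F (scaleC c v)) = c ^ m * l (F v)"
    using assms l(1) unfolding homogeneous_map_def using homogeneous_fun_scale by blast
  ultimately show False by (simp add: clinear_diff clinear_scale)
qed

text \<open>A homogeneous map on an infinite-dimensional space, such as the identity, need not be a
  finite combination of vectors with homogeneous functions as coefficients. Those which are form a
  class that is closed under bilinear operations, which cannot be seen by composing with one
  linear functional at a time.\<close>

inductive form_map :: "nat \<Rightarrow> ('v :: complex_vector \<Rightarrow> 'w :: complex_vector) \<Rightarrow> bool" where
  const: "form_map 0 (\<lambda>_. w)"
| add: "form_map m F \<Longrightarrow> form_map m G \<Longrightarrow> form_map m (\<lambda>v. F v + G v)"
| mult: "clinear l \<Longrightarrow> form_map m F \<Longrightarrow> form_map (Suc m) (\<lambda>v. scaleC (l v) (F v))"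

lemma form_map_linear: "form_map m F \<Longrightarrow> clinear l \<Longrightarrow> form_map m (\<lambda>v. l (F v))"
proof (induction rule: form_map.induct)
  case (mult k m F)
  then show ?case using form_map.mult[of k m "\<lambda>v. l (F v)"] by (simp add: clinear_scale)
qed (auto simp: clinear_add intro: form_map.intros)

lemma form_map_imp_homogeneous_fun: "form_map m f \<Longrightarrow> homogeneous_fun m f"
  for f :: "'v :: complex_vector \<Rightarrow> complex"
  by (induction rule: form_map.induct) (auto intro: homogeneous_fun.intros)

lemma form_map_imp_homogeneous_map: "form_map m F \<Longrightarrow> homogeneous_map m F"
  unfolding homogeneous_map_def using form_map_linear form_map_imp_homogeneous_fun by blast

lemma form_map_bilinear:
  assumes "form_map m F" "form_map n G"
    and B: "\<And>a. clinear (B a)" "\<And>b. clinear (\<lambda>a. B a b)"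
  shows "form_map (m + n) (\<lambda>v. B (F v) (G v))"
  using assms(1)
proof (induction rule: form_map.induct)
  case (const w)
  show ?case using form_map_linear[OF assms(2) B(1)] by simp
next
  case (add m F F')
  then show ?case using form_map.add[OF add.IH] by (simp add: clinear_add[OF B(2)])
next
  case (mult l m F)
  then show ?case using form_map.mult[OF mult.hyps(1) mult.IH] by (simp add: clinear_scale[OF B(2)])
qed

lemma form_map_zero: "form_map m (\<lambda>_. 0)"
proof (induction m)
  case 0 show ?case by (rule form_map.const)
next
  case (Suc m)
  have "clinear (\<lambda>_. 0 :: complex)" by (rule clinearI) simp_all
  from form_map.mult[OF this Suc] show ?case by simp
qed

lemma form_map_sum:
  "(\<And>i. i \<in> I \<Longrightarrow> form_map m (F i)) \<Longrightarrow> form_map m (\<lambda>v. \<Sum>i\<in>I. F i v)"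
  by (induction I rule: infinite_finite_induct) (auto intro: form_map_zero form_map.add)

text \<open>Restricting to lines reduces questions of nonvanishing to polynomials in one variable.\<close>

lemma homogeneous_fun_on_line:
  assumes "homogeneous_fun m f"
  obtains p where "\<And>t. f (v + scaleC t w) = poly p t"
proof -
  have "\<exists>p. \<forall>t. f (v + scaleC t w) = poly p t"
    using assms
  proof (induction rule: homogeneous_fun.induct)
    case (const c)
    show ?case by (rule exI[of _ "[:c:]"]) simp
  next
    case (add m f g)
    then show ?case by (metis poly_add)
  next
    case (mult l m f)
    then obtain p where "\<forall>t. f (v + scaleC t w) = poly p t" by blast
    then have "\<forall>t. l (v + scaleC t w) * f (v + scaleC t w) = poly ([:l v, l w:] * p) t"
      using mult(1) by (simp add: clinear_add clinear_scale algebra_simps)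
    then show ?case by blast
  qed
  then show ?thesis using that by blast
qed

section \<open>Images of linear parameter spaces\<close>

text \<open>For functions on an infinite-dimensional space of parameters this replaces polynomiality.\<close>

definition poly_on_lines :: "'p :: complex_vector set \<Rightarrow> ('p \<Rightarrow> complex) \<Rightarrow> bool" where
  "poly_on_lines P f \<longleftrightarrow> (\<forall>F\<in>P. \<forall>G\<in>P. \<exists>p. \<forall>t. f (F + scaleC t G) = poly p t)"

lemma poly_on_lines_mult:
  assumes "poly_on_lines P f" "poly_on_lines P g"
  shows "poly_on_lines P (\<lambda>F. f F * g F)"
  unfolding poly_on_lines_def
proof (intro ballI)
  fix F G assume "F \<in> P" "G \<in> P"
  then obtain p q where "\<forall>t. f (F + scaleC t G) = poly p t" "\<forall>t. g (F + scaleC t G) = poly q t"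
    using assms unfolding poly_on_lines_def by metis
  then show "\<exists>p. \<forall>t. f (F + scaleC t G) * g (F + scaleC t G) = poly p t"
    by (intro exI[of _ "p * q"]) simp
qed

lemma poly_on_lines_prod:
  "(\<And>i. i \<in> I \<Longrightarrow> poly_on_lines P (f i)) \<Longrightarrow> poly_on_lines P (\<lambda>F. \<Prod>i\<in>I. f i F)"
proof (induction I rule: infinite_finite_induct)
  case (insert i I)
  then show ?case using poly_on_lines_mult[of P "f i"] by simp
qed (auto simp: poly_on_lines_def intro: exI[of _ "1"])

text \<open>On the line through a nonvanishing point of \<open>f\<close> and one of \<open>g\<close>, both functions are nonzero
  polynomials in one variable.\<close>

lemma common_nonvanishing_point:
  assumes P: "complex_vector.subspace P"
    and f: "poly_on_lines P f" "F \<in> P" "f F \<noteq> 0"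
    and g: "poly_on_lines P g" "G \<in> P" "g G \<noteq> 0"
  obtains H where "H \<in> P" "f H \<noteq> 0" "g H \<noteq> 0"
proof -
  have D: "G - F \<in> P" using P f(2) g(2) by (simp add: complex_vector.subspace_diff)
  obtain p where p: "\<And>t. f (F + scaleC t (G - F)) = poly p t"
    using f(1,2) D unfolding poly_on_lines_def by metis
  obtain q where q: "\<And>t. g (F + scaleC t (G - F)) = poly q t"
    using g(1) f(2) D unfolding poly_on_lines_def by metis
  have "poly p 0 \<noteq> 0" "poly q 1 \<noteq> 0" using p[of 0] q[of 1] f(3) g(3) by (simp_all add: scaleC_one)
  then have "p * q \<noteq> 0" by auto
  then have "finite {t. poly (p * q) t = 0}" by (rule poly_roots_finite)
  then have "{t. poly (p * q) t = 0} \<noteq> UNIV"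
    by (metis infinite_UNIV_char_0)
  then obtain t where t: "poly (p * q) t \<noteq> 0" by blast
  show ?thesis
  proof (rule that)
    show "F + scaleC t (G - F) \<in> P"
      using P f(2) D by (intro complex_vector.subspace_add complex_vector.subspace_scale)
  qed (use t in \<open>auto simp: p q\<close>)
qed

lemma openin_homogeneous:
  assumes "homogeneous_fun m g"
  shows "openin (zariski V) (nonvanishing_locus V {g})"
  unfolding openin_zariski using assms by blast

text \<open>Vanishing of a homogeneous function does not depend on the vector that represents a line.\<close>

lemma line_in_nonvanishing_locus:
  assumes "homogeneous_fun m g" "v \<noteq> 0"
  shows "line v \<in> nonvanishing_locus V {g} \<longleftrightarrow> line v \<in> proj_space V \<and> g v \<noteq> 0"
proof
  assume "line v \<in> nonvanishing_locus V {g}"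
  then obtain w where w: "line v = line w" "w \<in> V" "w \<noteq> 0" "g w \<noteq> 0"
    by (auto elim: nonvanishing_locusE)
  obtain c where "c \<noteq> 0" "w = scaleC c v" using line_eqD[OF w(1,3)] by metis
  then show "line v \<in> proj_space V \<and> g v \<noteq> 0"
    using w homogeneous_fun_scale[OF assms(1)] unfolding proj_space_def by auto
next
  assume "line v \<in> proj_space V \<and> g v \<noteq> 0"
  then obtain w where w: "line v = line w" "w \<in> V" "w \<noteq> 0" "g v \<noteq> 0" unfolding proj_space_def by blast
  obtain c where "c \<noteq> 0" "w = scaleC c v" using line_eqD[OF w(1,3)] by metis
  then have "g w \<noteq> 0" using w(4) homogeneous_fun_scale[OF assms(1)] by simp
  then show "line v \<in> nonvanishing_locus V {g}"
    using w nonvanishing_locusI[of w V g "{g}"] by simp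
qed

locale parametrised_variety =
  fixes V :: "'v :: complex_vector set" and P :: "'p :: complex_vector set" and R :: "'p \<Rightarrow> 'v"
  assumes P: "complex_vector.subspace P"
    and R_in: "F \<in> P \<Longrightarrow> R F \<in> V"
    and R_poly: "homogeneous_fun m f \<Longrightarrow> poly_on_lines P (\<lambda>F. f (R F))"
begin

definition image where "image = {line (R F) | F. F \<in> P \<and> R F \<noteq> 0}"
definition closed_image where "closed_image = zariski V closure_of image"

lemma closed_image_subset: "closed_image \<subseteq> proj_space V"
  unfolding closed_image_def using closure_of_subset_topspace[of "zariski V"] by simp

lemma image_subset: "image \<subseteq> closed_image"
  unfolding closed_image_def
  by (rule closure_of_subset) (auto simp: image_def proj_space_def R_in)

lemma topspace_closed_image: "topspace (subtopology (zariski V) closed_image) = closed_image"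
  using closed_image_subset by auto

text \<open>The nonvanishing locus of \<open>f\<close> is open, so if it meets the closure then it meets the image.\<close>

lemma vanishing_on_closed_image:
  assumes f: "homogeneous_fun m f" and v: "line v \<in> closed_image" "v \<noteq> 0"
    and van: "\<And>F. F \<in> P \<Longrightarrow> f (R F) = 0"
  shows "f v = 0"
proof (rule ccontr)
  assume "f v \<noteq> 0"
  then have "line v \<in> nonvanishing_locus V {f}"
    using line_in_nonvanishing_locus[OF f v(2)] v(1) closed_image_subset by blast
  with v(1) obtain y where "y \<in> image" "y \<in> nonvanishing_locus V {f}"
    unfolding closed_image_def in_closure_of using openin_homogeneous[OF f] by blast
  then obtain F where "F \<in> P" "R F \<noteq> 0" "line (R F) \<in> nonvanishing_locus V {f}" unfolding image_def by blast
  then show False using van line_in_nonvanishing_locus[OF f] by blast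
qed

text \<open>A nonempty open subset of the closure is dense: a basic open set \<open>f \<noteq> 0\<close> that meets the
  closure also meets the image, and then the image has a point where neither \<open>f\<close> nor \<open>g\<close> vanishes.\<close>

lemma dense_open_closed_image:
  assumes g: "homogeneous_fun m g" and F: "F \<in> P" "g (R F) \<noteq> 0"
  shows "dense_open V closed_image (closed_image \<inter> nonvanishing_locus V {g})"
  unfolding dense_open_def
proof
  show "openin (subtopology (zariski V) closed_image) (closed_image \<inter> nonvanishing_locus V {g})"
    unfolding openin_subtopology using openin_homogeneous[OF g] by blast
  show "subtopology (zariski V) closed_image closure_of (closed_image \<inter> nonvanishing_locus V {g}) = closed_image"
  proof
    show "subtopology (zariski V) closed_image closure_of (closed_image \<inter> nonvanishing_locus V {g}) \<subseteq> closed_image"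
      using closure_of_subset_topspace topspace_closed_image by metis
    show "closed_image \<subseteq> subtopology (zariski V) closed_image closure_of (closed_image \<inter> nonvanishing_locus V {g})"
    proof
      fix x assume x: "x \<in> closed_image"
      show "x \<in> subtopology (zariski V) closed_image closure_of (closed_image \<inter> nonvanishing_locus V {g})"
        unfolding in_closure_of topspace_closed_image
      proof (intro conjI allI impI)
        fix T assume "x \<in> T \<and> openin (subtopology (zariski V) closed_image) T"
        then obtain U where U: "openin (zariski V) U" "T = U \<inter> closed_image" "x \<in> U"
          unfolding openin_subtopology by blast
        then obtain y where y: "y \<in> image" "y \<in> U" using x unfolding closed_image_def in_closure_of by blast
        then obtain G where G: "G \<in> P" "R G \<noteq> 0" "line (R G) \<in> U" unfolding image_def by blast
        obtain S where S: "\<forall>f\<in>S. \<exists>m. homogeneous_fun m f" "U = nonvanishing_locus V S"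
          using U(1) unfolding openin_zariski by blast
        from G(3)[unfolded S(2)] obtain v f where vf: "line (R G) = line v" "v \<in> V" "v \<noteq> 0" "f \<in> S" "f v \<noteq> 0"
          by (rule nonvanishing_locusE)
        obtain n where n: "homogeneous_fun n f" using vf(4) S(1) by blast
        obtain c where "v = scaleC c (R G)" using line_eqD[OF vf(1,3)] by metis
        then have "f (R G) \<noteq> 0" using vf(5) homogeneous_fun_scale[OF n] by auto
        then obtain H where H: "H \<in> P" "f (R H) \<noteq> 0" "g (R H) \<noteq> 0" "R H \<noteq> 0"
        \<comment> \<open>If \<open>f 0 = 0\<close> then \<open>f (R H) \<noteq> 0\<close> excludes \<open>R H = 0\<close>; otherwise \<open>f\<close> is multiplied by a functional.\<close>
        proof (cases "f 0 = 0")
          case True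
          with \<open>f (R G) \<noteq> 0\<close> show ?thesis using that
            by (metis common_nonvanishing_point[OF P R_poly[OF n] G(1) _ R_poly[OF g] F])
        next
          case False
          obtain l :: "'v \<Rightarrow> complex" where l: "clinear l" "l (R G) = 1" by (rule exists_functional[OF G(2)])
          have fl: "homogeneous_fun (n + 1) (\<lambda>v. f v * l v)"
            by (rule homogeneous_fun_mult[OF n homogeneous_fun_linear[OF l(1)]])
          show ?thesis
            using common_nonvanishing_point[OF P R_poly[OF fl] G(1) _ R_poly[OF g] F] \<open>f (R G) \<noteq> 0\<close> l that
            by (metis clinear_zero mult_eq_0_iff zero_neq_one)
        qed
        have im: "line (R H) \<in> closed_image" using image_subset H unfolding image_def by blast
        moreover have "line (R H) \<in> nonvanishing_locus V {g}" "line (R H) \<in> nonvanishing_locus V S"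
          using nonvanishing_locusI[OF R_in[OF H(1)] H(4)] H vf(4) by blast+
        ultimately show "\<exists>y. y \<in> closed_image \<inter> nonvanishing_locus V {g} \<and> y \<in> T" using U(2) S(2) by blast
      qed (use x in auto)
    qed
  qed
qed

end

section \<open>Rationality from a generic inverse\<close>

text \<open>The representative is chosen arbitrarily; for homogeneous \<open>F\<close> the choice does not matter.\<close>

definition proj_map :: "('v :: complex_vector \<Rightarrow> 'w :: complex_vector) \<Rightarrow> 'v set \<Rightarrow> 'w set" where
  "proj_map F p = line (F (SOME v. v \<noteq> 0 \<and> p = line v))"

lemma proj_map_line:
  assumes "homogeneous_map m F" "v \<noteq> 0"
  shows "proj_map F (line v) = line (F v)"
proof -
  define w where "w = (SOME w. w \<noteq> 0 \<and> line v = line w)"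
  have "w \<noteq> 0 \<and> line v = line w" unfolding w_def by (rule someI[of _ v]) (use assms(2) in simp)
  then obtain c where c: "c \<noteq> 0" "w = scaleC c v" using line_eqD by metis
  have "line (F w) = line (F v)"
    unfolding c(2) homogeneous_map_scale[OF assms(1)] using c(1) by (intro line_scale) simp
  then show ?thesis unfolding proj_map_def w_def by simp
qed

lemma regular_map_proj_map:
  assumes "homogeneous_map m F" "A \<subseteq> proj_space V"
    and "\<And>v. v \<noteq> 0 \<Longrightarrow> line v \<in> A \<Longrightarrow> F v \<noteq> 0 \<and> F v \<in> W"
  shows "regular_map V A W (proj_map F)"
  unfolding regular_map_def
proof (intro conjI ballI)
  show "proj_map F ` A \<subseteq> proj_space W"
  proof
    fix q assume "q \<in> proj_map F ` A"
    then obtain p where p: "p \<in> A" "q = proj_map F p" by blast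
    then obtain v where "p = line v" "v \<noteq> 0" using assms(2) unfolding proj_space_def by blast
    then show "q \<in> proj_space W"
      using p assms(3) proj_map_line[OF assms(1)] unfolding proj_space_def by auto
  qed
  fix p assume "p \<in> A"
  moreover have "openin (subtopology (zariski V) A) A"
    using assms(2) by (metis inf.absorb2 openin_topspace topspace_subtopology topspace_zariski)
  ultimately show "\<exists>N m F'. openin (subtopology (zariski V) A) N \<and> p \<in> N \<and> homogeneous_map m F' \<and>
      (\<forall>v. v \<noteq> 0 \<and> line v \<in> N \<longrightarrow> F' v \<noteq> 0 \<and> proj_map F (line v) = line (F' v))"
    using assms(1,3) proj_map_line[OF assms(1)] by blast
qed

lemma subspace_affine_space: "complex_vector.subspace (affine_space n)"
  by (rule complex_vector.subspaceI) (auto simp: affine_space_def)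

text \<open>\<open>\<Psi>\<close> parametrises part of the image by an affine space, namely by the chart \<open>c\<^sub>0 \<noteq> 0\<close> of a
  projective space, and \<open>C\<close> reads off the parameter. Both composites need only be the identity up
  to a scalar, and \<open>\<Psi> \<circ> C\<close> only on the image of the parameters with \<open>D \<noteq> 0\<close>: being parallel is a
  closed condition, so it extends to the closure. The domains \<open>A\<close> and \<open>B\<close> are cut out such that
  the two maps are mutually inverse bijections between them.\<close>

theorem (in parametrised_variety) rational_variety_if_generically_invertible:
  fixes C :: "'v \<Rightarrow> nat \<Rightarrow> complex" and \<Psi> :: "(nat \<Rightarrow> complex) \<Rightarrow> 'v"
  assumes C: "homogeneous_map m C" "\<And>v. C v \<in> affine_space (Suc N)" and m: "m > 0"
    and \<Psi>: "homogeneous_map k \<Psi>" "\<And>c. c \<in> affine_space (Suc N) \<Longrightarrow> \<exists>F\<in>P. \<Psi> c = R F"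
    and C_\<Psi>: "\<And>c. c \<in> affine_space (Suc N) \<Longrightarrow> c 0 \<noteq> 0 \<Longrightarrow> \<exists>h. C (\<Psi> c) = scaleC h c"
    and \<Psi>_C: "\<And>F. F \<in> P \<Longrightarrow> D F \<noteq> 0 \<Longrightarrow> \<exists>g. \<Psi> (C (R F)) = scaleC g (R F)"
    and D: "poly_on_lines P D" "F\<^sub>0 \<in> P" "D F\<^sub>0 \<noteq> 0"
    and c\<^sub>0: "c\<^sub>0 \<in> affine_space (Suc N)" "c\<^sub>0 0 \<noteq> 0" "C (\<Psi> c\<^sub>0) 0 \<noteq> 0"
  shows "rational_variety V closed_image"
proof -
  let ?W = "affine_space (Suc N)"
  \<comment> \<open>Projective space is its own image, so the density lemma also serves for the domain of \<open>\<Psi>\<close>.\<close>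
  interpret W: parametrised_variety ?W ?W "\<lambda>c. c"
  proof
    show "poly_on_lines ?W f" if "homogeneous_fun m f" for m f
      unfolding poly_on_lines_def by (metis homogeneous_fun_on_line[OF that])
  qed (simp_all add: subspace_affine_space)
  have W_closed_image: "W.closed_image = proj_space ?W"
    using W.closed_image_subset W.image_subset unfolding W.image_def proj_space_def by blast

  define a where "a v = C v 0 * C (\<Psi> (C v)) 0" for v
  define b where "b c = c 0 * C (\<Psi> c) 0" for c
  define A where "A = closed_image \<inter> nonvanishing_locus V {a}"
  define B where "B = proj_space ?W \<inter> nonvanishing_locus ?W {b}"
  have C0: "homogeneous_fun m (\<lambda>v. C v 0)"
    using C(1)[unfolded homogeneous_map_def, rule_format, OF clinear_apply] .
  have hb: "homogeneous_fun (1 + m * k) b"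
    unfolding b_def
    by (intro homogeneous_fun_mult homogeneous_fun_linear clinear_apply
        homogeneous_fun_compose[OF C0 \<Psi>(1)])
  have ha: "homogeneous_fun (m + m * (k * m)) a"
    unfolding a_def
    by (intro homogeneous_fun_mult C0 homogeneous_fun_compose[OF C0]
        homogeneous_map_compose[OF \<Psi>(1) C(1)])
  have in_A: "line v \<in> A \<longleftrightarrow> line v \<in> closed_image \<and> a v \<noteq> 0" if "v \<noteq> 0" for v
    using line_in_nonvanishing_locus[OF ha that] closed_image_subset unfolding A_def by blast
  have in_B: "line c \<in> B \<longleftrightarrow> line c \<in> proj_space ?W \<and> b c \<noteq> 0" if "c \<noteq> 0" for c
    using line_in_nonvanishing_locus[OF hb that] unfolding B_def by blast
  have A_cases: "\<exists>v. p = line v \<and> v \<noteq> 0 \<and> a v \<noteq> 0 \<and> line v \<in> closed_image" if "p \<in> A" for p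
  proof -
    obtain v where "p = line v" "v \<noteq> 0" using \<open>p \<in> A\<close> closed_image_subset unfolding A_def proj_space_def by blast
    then show ?thesis using in_A that by blast
  qed
  have B_cases: "\<exists>c. p = line c \<and> c \<noteq> 0 \<and> b c \<noteq> 0 \<and> c \<in> ?W" if "p \<in> B" for p
  proof -
    obtain v where "p = line v" "v \<noteq> 0" "v \<in> ?W" using \<open>p \<in> B\<close> unfolding B_def proj_space_def by blast
    then show ?thesis using in_B that by blast
  qed
  have C_zero: "C 0 0 = 0"
  proof -
    have "C (scaleC 0 0) 0 = 0 ^ m * C 0 0" by (rule homogeneous_fun_scale[OF C0])
    then show ?thesis using m by (simp add: power_0_left)
  qed

  \<comment> \<open>The minors of \<open>\<Psi> (C v)\<close> and \<open>v\<close> vanish on \<open>R F\<close> whenever \<open>D F \<noteq> 0\<close>, hence on the whole closure.\<close>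
  have parallel: "\<exists>g. \<Psi> (C v) = scaleC g v" if v: "line v \<in> closed_image" "v \<noteq> 0" for v
  proof -
    have "l (\<Psi> (C v)) * l' v - l' (\<Psi> (C v)) * l v = 0" if l: "clinear l" "clinear l'" for l l' :: "'v \<Rightarrow> complex"
    proof -
      let ?f = "\<lambda>v. l (\<Psi> (C v)) * l' v - l' (\<Psi> (C v)) * l v"
      have hf: "homogeneous_fun (k * m + 1) ?f"
        using homogeneous_map_compose[OF \<Psi>(1) C(1)] l unfolding homogeneous_map_def
        by (intro homogeneous_fun_diff homogeneous_fun_mult homogeneous_fun_linear) auto
      have "?f (R F) = 0" if F: "F \<in> P" for F
      proof (rule ccontr)
        assume "?f (R F) \<noteq> 0"
        from common_nonvanishing_point[OF P R_poly[OF hf] F this D] obtain H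
          where H: "H \<in> P" "?f (R H) \<noteq> 0" "D H \<noteq> 0" by blast
        with \<Psi>_C[OF H(1,3)] l show False by (auto simp: clinear_scale)
      qed
      then show ?thesis by (rule vanishing_on_closed_image[OF hf v])
    qed
    then show ?thesis using parallel_if_minors_vanish[OF v(2), of "\<Psi> (C v)"]
      by (metis right_minus_eq)
  qed

  have \<Psi>_nz: "\<Psi> c \<noteq> 0" if "b c \<noteq> 0" for c
    using that C_zero unfolding b_def by auto
  have C_nz: "C v \<noteq> 0 \<and> C v \<in> ?W" if "a v \<noteq> 0" for v
    using that C(2) unfolding a_def by auto
  have a_\<Psi>: "a (\<Psi> c) \<noteq> 0" if c: "c \<in> ?W" "b c \<noteq> 0" for c
  proof -
    from c obtain h where h: "C (\<Psi> c) = scaleC h c" using C_\<Psi> unfolding b_def by auto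
    then have "h \<noteq> 0" using c(2) unfolding b_def by auto
    moreover have "C (\<Psi> (C (\<Psi> c))) = scaleC ((h ^ k) ^ m) (C (\<Psi> c))"
      unfolding h homogeneous_map_scale[OF \<Psi>(1)] homogeneous_map_scale[OF C(1)] by (rule refl)
    ultimately show ?thesis using c(2) unfolding a_def b_def by simp
  qed
  have b_C: "b (C v) \<noteq> 0" if "a v \<noteq> 0" for v using that unfolding a_def b_def by simp

  let ?\<phi> = "proj_map C" and ?\<psi> = "proj_map \<Psi>"
  have \<phi>: "?\<phi> (line v) = line (C v)" "line (C v) \<in> B" if "v \<noteq> 0" "a v \<noteq> 0" for v
    using that proj_map_line[OF C(1)] in_B C_nz b_C unfolding proj_space_def by auto
  have \<psi>: "?\<psi> (line c) = line (\<Psi> c)" "line (\<Psi> c) \<in> A" if c: "c \<noteq> 0" "b c \<noteq> 0" "c \<in> ?W" for c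
  proof -
    show "?\<psi> (line c) = line (\<Psi> c)" using c proj_map_line[OF \<Psi>(1)] by blast
    obtain F where "F \<in> P" "\<Psi> c = R F" using \<Psi>(2)[OF c(3)] by blast
    then have "line (\<Psi> c) \<in> image" using \<Psi>_nz[OF c(2)] unfolding image_def by auto
    then have "line (\<Psi> c) \<in> closed_image" using image_subset by blast
    then show "line (\<Psi> c) \<in> A" using in_A[OF \<Psi>_nz[OF c(2)]] a_\<Psi>[OF c(3,2)] by simp
  qed
  have dense_A: "dense_open V closed_image A"
  proof -
    obtain F where "F \<in> P" "\<Psi> c\<^sub>0 = R F" using \<Psi>(2)[OF c\<^sub>0(1)] by blast
    then show ?thesis
      unfolding A_def using dense_open_closed_image[OF ha] a_\<Psi>[OF c\<^sub>0(1)] c\<^sub>0(2,3) unfolding b_def by auto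
  qed
  have dense_B: "dense_open ?W (proj_space ?W) B"
    using W.dense_open_closed_image[OF hb c\<^sub>0(1)] c\<^sub>0(2,3) unfolding B_def W_closed_image b_def by auto
  have "birational V closed_image ?W (proj_space ?W)"
    unfolding birational_def
  proof (intro exI conjI ballI impI)
    show "rational_map V closed_image ?W (proj_space ?W) A ?\<phi>"
      unfolding rational_map_def
    proof (intro conjI)
      show "regular_map V A ?W ?\<phi>"
        using in_A C_nz closed_image_subset unfolding A_def by (intro regular_map_proj_map[OF C(1)]) auto
      show "?\<phi> ` A \<subseteq> proj_space ?W"
      proof
        fix q assume "q \<in> ?\<phi> ` A"
        then show "q \<in> proj_space ?W" using A_cases \<phi> unfolding B_def by fastforce
      qed
    qed (rule dense_A)
    show "rational_map ?W (proj_space ?W) V closed_image B ?\<psi>"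
      unfolding rational_map_def
    proof (intro conjI)
      have "\<Psi> c \<in> V" if c: "c \<noteq> 0" "line c \<in> B" for c
      proof -
        obtain c' where c': "line c = line c'" "c' \<noteq> 0" "c' \<in> ?W" using B_cases[OF c(2)] by blast
        obtain t where "c = scaleC t c'" using line_eqD[OF c'(1)[symmetric] c(1)] by blast
        then have "c \<in> ?W" using c'(3) complex_vector.subspace_scale[OF subspace_affine_space] by blast
        then show ?thesis using \<Psi>(2) R_in by metis
      qed
      then show "regular_map ?W B V ?\<psi>"
        using in_B \<Psi>_nz unfolding B_def by (intro regular_map_proj_map[OF \<Psi>(1)]) auto
      show "?\<psi> ` B \<subseteq> closed_image"
      proof
        fix q assume "q \<in> ?\<psi> ` B"
        then show "q \<in> closed_image" using B_cases \<psi> unfolding A_def by fastforce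
      qed
    qed (rule dense_B)
    have "{p \<in> A. ?\<phi> p \<in> B} = A" using A_cases \<phi> by fastforce
    then show "dense_open V closed_image {p \<in> A. ?\<phi> p \<in> B}" using dense_A by simp
    have "{p \<in> B. ?\<psi> p \<in> A} = B" using B_cases \<psi> by fastforce
    then show "dense_open ?W (proj_space ?W) {p \<in> B. ?\<psi> p \<in> A}" using dense_B by simp
  next
    fix p assume "p \<in> A"
    then obtain v where v: "p = line v" "v \<noteq> 0" "a v \<noteq> 0" "line v \<in> closed_image" using A_cases by blast
    obtain g where g: "\<Psi> (C v) = scaleC g v" using parallel[OF v(4,2)] by blast
    have "b (C v) \<noteq> 0" by (rule b_C[OF v(3)])
    then have "g \<noteq> 0" using \<Psi>_nz g by fastforce
    have "?\<psi> (?\<phi> p) = line (\<Psi> (C v))"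
      using v(1) \<phi>(1)[OF v(2,3)] C_nz[OF v(3)] proj_map_line[OF \<Psi>(1), of "C v"] by simp
    then show "?\<psi> (?\<phi> p) = p" using line_scale[OF \<open>g \<noteq> 0\<close>, of v] g v(1) by simp
  next
    fix p assume "p \<in> B"
    then obtain c where c: "p = line c" "c \<noteq> 0" "b c \<noteq> 0" "c \<in> ?W" using B_cases by blast
    then obtain h where h: "C (\<Psi> c) = scaleC h c" using C_\<Psi> unfolding b_def by auto
    then have "h \<noteq> 0" using c(3) unfolding b_def by auto
    have "?\<phi> (?\<psi> p) = line (C (\<Psi> c))"
      using c(1) \<psi>(1)[OF c(2,3,4)] \<Psi>_nz[OF c(3)] proj_map_line[OF C(1), of "\<Psi> c"] by simp
    then show "?\<phi> (?\<psi> p) = p" using line_scale[OF \<open>h \<noteq> 0\<close>, of c] h c(1) by simp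
  qed
  then show ?thesis unfolding rational_variety_def by blast
qed

section \<open>Exterior multiplication by 1-forms\<close>

text \<open>The sign with which \<open>dx\<^sub>j\<close> is moved to its place among the \<open>dx\<^sub>l\<close> with \<open>l \<in> K\<close>.\<close>

definition position_sign :: "nat \<Rightarrow> nat set \<Rightarrow> 'a :: comm_ring_1" where
  "position_sign j K = (- 1) ^ card {l \<in> K. l < j}"

lemma position_sign_square [simp]: "position_sign j K * position_sign j K = 1"
  unfolding position_sign_def by (metis left_minus_one_mult_self mult.right_neutral)

lemma position_sign_remove:
  assumes "j \<in> K"
  shows "position_sign k (K - {j}) = (if j < k then - position_sign k K else position_sign k K)"
proof (cases "j < k")
  case True
  have "{l \<in> K. l < k} = insert j {l \<in> K - {j}. l < k}" using assms True by auto
  then have "card {l \<in> K. l < k} = Suc (card {l \<in> K - {j}. l < k})" by simp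
  then show ?thesis using True unfolding position_sign_def by simp
next
  case False
  then have "{l \<in> K - {j}. l < k} = {l \<in> K. l < k}" by auto
  then show ?thesis using False unfolding position_sign_def by simp
qed

lemma position_sign_self [simp]: "position_sign j (K - {j}) = position_sign j K"
  unfolding position_sign_def by (rule arg_cong[of _ _ "\<lambda>S. (- 1) ^ card S"]) auto

lemma position_sign_insert_self [simp]: "position_sign j (insert j K) = position_sign j K"
  unfolding position_sign_def by (rule arg_cong[of _ _ "\<lambda>S. (- 1) ^ card S"]) auto

text \<open>Removing \<open>j\<close> and then \<open>k\<close> from \<open>K\<close> gives the opposite sign to removing \<open>k\<close> and then \<open>j\<close>.
  This is why 1-forms anticommute, and why second derivatives cancel in an exterior derivative.\<close>

lemma antisymmetric_double_sum:
  fixes f :: "nat \<Rightarrow> nat \<Rightarrow> 'a :: comm_ring_1"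
  shows "(\<Sum>j\<in>K. \<Sum>k\<in>K - {j}. position_sign j K * position_sign k (K - {j}) * f j k) =
    - (\<Sum>j\<in>K. \<Sum>k\<in>K - {j}. position_sign j K * position_sign k (K - {j}) * f k j)"
proof (cases "finite K")
  case True
  define g where "g f j k = (if j = k then 0 else
    position_sign j K * position_sign k (K - {j}) * f j k)" for f :: "nat \<Rightarrow> nat \<Rightarrow> 'a" and j k
  have g: "(\<Sum>j\<in>K. \<Sum>k\<in>K - {j}. position_sign j K * position_sign k (K - {j}) * f j k) =
      (\<Sum>j\<in>K. \<Sum>k\<in>K. g f j k)" for f
    unfolding g_def using True by (intro sum.cong refl sum.mono_neutral_cong_left) auto
  have "g f j k = - g (\<lambda>j k. f k j) k j" if "j \<in> K" "k \<in> K" for j k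
    unfolding g_def using that by (auto simp: position_sign_remove)
  then have "(\<Sum>j\<in>K. \<Sum>k\<in>K. g f j k) = (\<Sum>j\<in>K. \<Sum>k\<in>K. - g (\<lambda>j k. f k j) k j)"
    by (intro sum.cong refl)
  also have "\<dots> = - (\<Sum>k\<in>K. \<Sum>j\<in>K. g (\<lambda>j k. f k j) k j)"
    unfolding sum_negf by (subst sum.swap) (rule refl)
  finally show ?thesis unfolding g .
qed simp

lemma eq_minus_self:
  fixes x :: "'a :: {idom, ring_char_0}"
  assumes "x = - x" shows "x = 0"
proof -
  have "x + x = 0" using assms unfolding eq_neg_iff_add_eq_0 .
  then have "2 * x = 0" unfolding mult_2 .
  then show ?thesis unfolding mult_eq_0_iff by simp
qed

lemma symmetric_double_sum:
  fixes f :: "nat \<Rightarrow> nat \<Rightarrow> 'a :: {idom, ring_char_0}"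
  assumes "\<And>j k. j \<in> K \<Longrightarrow> k \<in> K \<Longrightarrow> f j k = f k j"
  shows "(\<Sum>j\<in>K. \<Sum>k\<in>K - {j}. position_sign j K * position_sign k (K - {j}) * f j k) = 0"
    (is "?S = 0")
proof -
  have "?S = - (\<Sum>j\<in>K. \<Sum>k\<in>K - {j}. position_sign j K * position_sign k (K - {j}) * f k j)"
    by (rule antisymmetric_double_sum)
  also have "\<dots> = - ?S"
    by (rule arg_cong[of _ _ uminus], intro sum.cong refl) (use assms in auto)
  finally show ?thesis by (rule eq_minus_self)
qed

text \<open>A 1-form is given by its coefficients. The coefficient ring is left general because the same
  calculus is needed for polynomial forms and, for the exponents of monomials, for complex
  covectors.\<close>

definition wedge_by :: "(nat \<Rightarrow> 'a :: comm_ring_1) \<Rightarrow> (nat set \<Rightarrow> 'a) \<Rightarrow> nat set \<Rightarrow> 'a" where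
  "wedge_by \<alpha> \<omega> K = (\<Sum>j\<in>K. position_sign j K * \<alpha> j * \<omega> (K - {j}))"

lemma wedge_by_infinite: "infinite K \<Longrightarrow> wedge_by \<alpha> \<omega> K = 0"
  by (simp add: wedge_by_def)

lemma wedge_by_wedge_by:
  "wedge_by \<alpha> (wedge_by \<beta> \<omega>) K = (\<Sum>j\<in>K. \<Sum>k\<in>K - {j}. position_sign j K * position_sign k (K - {j}) *
     (\<alpha> j * \<beta> k * \<omega> (K - {j} - {k})))"
  unfolding wedge_by_def sum_distrib_left by (intro sum.cong refl) (simp add: mult_ac)

lemma minus_minus_commute: "K - {j} - {k} = K - {k} - {j}"
  by auto

lemma wedge_by_anticommute: "wedge_by \<alpha> (wedge_by \<beta> \<omega>) = (\<lambda>K. - wedge_by \<beta> (wedge_by \<alpha> \<omega>) K)"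
  unfolding wedge_by_wedge_by
  by (rule HOL.ext, subst antisymmetric_double_sum)
    (intro arg_cong[of _ _ uminus] sum.cong refl, simp add: mult_ac minus_minus_commute[of _ _])

lemma wedge_by_square: "wedge_by \<alpha> (wedge_by \<alpha> \<omega>) = (\<lambda>_. 0)"
  for \<alpha> :: "nat \<Rightarrow> 'a :: {idom, ring_char_0}"
  unfolding wedge_by_wedge_by
  by (rule HOL.ext, rule symmetric_double_sum) (simp add: minus_minus_commute mult_ac)

lemma wedge_by_add_left: "wedge_by (\<lambda>j. \<alpha> j + \<beta> j) \<omega> = (\<lambda>K. wedge_by \<alpha> \<omega> K + wedge_by \<beta> \<omega> K)"
  unfolding wedge_by_def by (simp add: algebra_simps sum.distrib)

lemma wedge_by_add_right: "wedge_by \<alpha> (\<lambda>K. \<omega> K + \<eta> K) = (\<lambda>K. wedge_by \<alpha> \<omega> K + wedge_by \<alpha> \<eta> K)"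
  unfolding wedge_by_def by (simp add: algebra_simps sum.distrib)

lemma wedge_by_scale_right: "wedge_by \<alpha> (\<lambda>K. c * \<omega> K) = (\<lambda>K. c * wedge_by \<alpha> \<omega> K)"
  unfolding wedge_by_def sum_distrib_left by (simp add: mult_ac)

lemma wedge_by_zero_right [simp]: "wedge_by \<alpha> (\<lambda>_. 0) = (\<lambda>_. 0)"
  unfolding wedge_by_def by simp

lemma wedge_by_combination:
  "wedge_by (\<lambda>j. \<Sum>k\<in>S. a k * \<alpha> k j) \<omega> K = (\<Sum>k\<in>S. a k * wedge_by (\<alpha> k) \<omega> K)"
  unfolding wedge_by_def sum_distrib_left sum_distrib_right
  by (subst sum.swap) (simp add: mult_ac)

section \<open>Polynomials and their partial derivatives\<close>

text \<open>Reduces identities that are additive in a polynomial to monomials.\<close>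

lemma poly_mapping_induct_add:
  fixes p :: "'a \<Rightarrow>\<^sub>0 'b :: comm_monoid_add"
  assumes "\<And>m a. Q (Poly_Mapping.single m a)" "\<And>p q. Q p \<Longrightarrow> Q q \<Longrightarrow> Q (p + q)"
  shows "Q p"
proof -
  have "p = (\<Sum>m\<in>Poly_Mapping.keys p. Poly_Mapping.single m (Poly_Mapping.lookup p m))"
  proof (rule poly_mapping_eqI)
    fix k
    have "Poly_Mapping.lookup (\<Sum>m\<in>Poly_Mapping.keys p. Poly_Mapping.single m (Poly_Mapping.lookup p m)) k
        = (\<Sum>m\<in>Poly_Mapping.keys p. if m = k then Poly_Mapping.lookup p m else 0)"
      unfolding lookup_sum lookup_single when_def by (rule refl)
    then show "Poly_Mapping.lookup p k =
        Poly_Mapping.lookup (\<Sum>m\<in>Poly_Mapping.keys p. Poly_Mapping.single m (Poly_Mapping.lookup p m)) k"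
      by (simp add: in_keys_iff)
  qed
  moreover have "Q (\<Sum>m\<in>S. Poly_Mapping.single m (Poly_Mapping.lookup p m))" for S
  proof (induction S rule: infinite_finite_induct)
    case (insert m S)
    then show ?case using assms by simp
  qed (use assms(1)[of undefined 0] in simp_all)
  ultimately show ?thesis by metis
qed

lemma scaleC_eq_mult: "scaleC c p = Poly_Mapping.single 0 c * p" for p :: polynomial
  unfolding scaleC_poly_mapping_def scaleC_complex_def by (rule mult_map_scale_conv_mult)

lemma clinear_mult_left: "clinear (\<lambda>q. p * q)" for p :: polynomial
  by (rule clinearI) (simp_all add: scaleC_eq_mult algebra_simps)

lemma clinear_mult_right: "clinear (\<lambda>q. q * p)" for p :: polynomial
  by (rule clinearI) (simp_all add: scaleC_eq_mult algebra_simps)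

lemma clinear_lookup: "clinear (\<lambda>p :: polynomial. Poly_Mapping.lookup p m)"
  by (rule clinearI) (simp_all add: lookup_add lookup_scaleC)

lemma lookup_partial_deriv:
  "Poly_Mapping.lookup (partial_deriv i p) m =
     of_nat (Suc (Poly_Mapping.lookup m i)) * Poly_Mapping.lookup p (m + Poly_Mapping.single i 1)"
proof -
  let ?n = "m + Poly_Mapping.single i 1"
  have eq: "n - Poly_Mapping.single i 1 = m \<longleftrightarrow> n = ?n" if "Poly_Mapping.lookup n i \<noteq> 0" for n
  proof
    assume "n - Poly_Mapping.single i 1 = m"
    then show "n = ?n"
      using that by (intro poly_mapping_eqI) (auto simp: lookup_add lookup_minus lookup_single when_def)
  next
    assume "n = ?n"
    then show "n - Poly_Mapping.single i 1 = m" by simp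
  qed
  have "Poly_Mapping.lookup (partial_deriv i p) m = (\<Sum>n\<in>Poly_Mapping.keys p.
      if n = ?n then of_nat (Poly_Mapping.lookup n i) * Poly_Mapping.lookup p n else 0)"
    unfolding partial_deriv_def lookup_sum lookup_single when_def
    by (intro sum.cong refl) (use eq in auto)
  also have "\<dots> = of_nat (Poly_Mapping.lookup ?n i) * Poly_Mapping.lookup p ?n"
    by (simp add: in_keys_iff)
  finally show ?thesis by (simp add: lookup_add)
qed

lemma clinear_partial_deriv: "clinear (partial_deriv i)"
  by (rule clinearI) (simp_all add: poly_mapping_eq_iff fun_eq_iff lookup_partial_deriv lookup_add
      lookup_scaleC algebra_simps)

lemmas partial_deriv_add = clinear_add[OF clinear_partial_deriv]
lemmas partial_deriv_zero [simp] = clinear_zero[OF clinear_partial_deriv]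
lemmas partial_deriv_diff = clinear_diff[OF clinear_partial_deriv]
lemmas partial_deriv_sum = clinear_sum[OF clinear_partial_deriv]

lemma partial_deriv_commute: "partial_deriv i (partial_deriv j p) = partial_deriv j (partial_deriv i p)"
  by (cases "i = j")
    (simp_all add: poly_mapping_eq_iff fun_eq_iff lookup_partial_deriv lookup_add lookup_single add_ac)

lemma partial_deriv_single:
  "partial_deriv i (Poly_Mapping.single m a) =
     Poly_Mapping.single (m - Poly_Mapping.single i 1) (of_nat (Poly_Mapping.lookup m i) * a)"
  by (cases "a = 0") (simp_all add: partial_deriv_def)

lemma partial_deriv_mult: "partial_deriv i (p * q) = partial_deriv i p * q + p * partial_deriv i q"
proof (induction p rule: poly_mapping_induct_add)
  case (1 m a)
  show ?case
  proof (induction q rule: poly_mapping_induct_add)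
    case (1 n b)
    let ?e = "Poly_Mapping.single i (1 :: nat)"
    have *: "Poly_Mapping.single (m - ?e + n) (of_nat (Poly_Mapping.lookup m i) * c) =
        Poly_Mapping.single (m + n - ?e) (of_nat (Poly_Mapping.lookup m i) * c)"
      for m n :: "nat \<Rightarrow>\<^sub>0 nat" and c :: complex
    proof (cases "Poly_Mapping.lookup m i = 0")
      case False
      then have "m - ?e + n = m + n - ?e"
        by (intro poly_mapping_eqI) (auto simp: lookup_add lookup_minus lookup_single when_def)
      then show ?thesis by simp
    qed simp
    show ?case
      using *[of m n "a * b"] *[of n m "a * b"]
      by (simp add: mult_single partial_deriv_single lookup_add algebra_simps flip: single_add)
  next
    case (2 q q')
    then show ?case by (simp add: partial_deriv_add algebra_simps)
  qed
next
  case (2 p p')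
  then show ?case by (simp add: partial_deriv_add algebra_simps)
qed

lemma partial_deriv_one [simp]: "partial_deriv i 1 = 0"
  using partial_deriv_single[of i 0 1] by simp

lemma partial_deriv_of_nat [simp]: "partial_deriv i (of_nat n) = 0"
  by (induction n) (simp_all add: partial_deriv_add)

lemma partial_deriv_minus [simp]: "partial_deriv i (- p) = - partial_deriv i p"
  using partial_deriv_diff[of i 0 p] by simp

lemma partial_deriv_position_sign [simp]: "partial_deriv i (position_sign j K) = 0"
  unfolding position_sign_def by (cases "even (card {l \<in> K. l < j})") simp_all

lemma Var_mult_partial_deriv:
  "Poly_Mapping.lookup (Var i * partial_deriv i p) m = of_nat (Poly_Mapping.lookup m i) * Poly_Mapping.lookup p m"
proof (induction p rule: poly_mapping_induct_add)
  case (1 n a)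
  have "Poly_Mapping.single i 1 + (n - Poly_Mapping.single i 1) = n" if "Poly_Mapping.lookup n i \<noteq> 0"
    using that by (intro poly_mapping_eqI) (auto simp: lookup_add lookup_minus lookup_single when_def)
  then show ?case
    by (cases "Poly_Mapping.lookup n i = 0")
      (auto simp: Var_def partial_deriv_single mult_single lookup_single when_def)
next
  case (2 p q)
  then show ?case by (simp add: partial_deriv_add lookup_add algebra_simps)
qed

lemma euler_identity:
  assumes "F \<in> homogeneous_polys r e"
  shows "(\<Sum>i\<le>r. Var i * partial_deriv i F) = of_nat e * F"
proof (rule poly_mapping_eqI)
  fix m
  have "Poly_Mapping.lookup (\<Sum>i\<le>r. Var i * partial_deriv i F) m =
      of_nat (\<Sum>i\<le>r. Poly_Mapping.lookup m i) * Poly_Mapping.lookup F m"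
    by (simp add: lookup_sum Var_mult_partial_deriv sum_distrib_right)
  also have "\<dots> = of_nat e * Poly_Mapping.lookup F m"
    using assms unfolding homogeneous_polys_def by (cases "m \<in> Poly_Mapping.keys F") (auto simp: in_keys_iff)
  also have "\<dots> = Poly_Mapping.lookup (scaleC (of_nat e) F) m" by (simp add: lookup_scaleC)
  also have "scaleC (of_nat e) F = of_nat e * F" by (simp add: scaleC_eq_mult)
  finally show "Poly_Mapping.lookup (\<Sum>i\<le>r. Var i * partial_deriv i F) m = Poly_Mapping.lookup (of_nat e * F) m" .
qed

lemma partial_deriv_outside:
  assumes "F \<in> homogeneous_polys r e" "j > r"
  shows "partial_deriv j F = 0"
proof (rule poly_mapping_eqI)
  fix m
  have "m + Poly_Mapping.single j 1 \<notin> Poly_Mapping.keys F"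
  proof
    assume "m + Poly_Mapping.single j 1 \<in> Poly_Mapping.keys F"
    then have "Poly_Mapping.keys (m + Poly_Mapping.single j 1) \<subseteq> {..r}"
      using assms(1) unfolding homogeneous_polys_def by auto
    moreover have "j \<in> Poly_Mapping.keys (m + Poly_Mapping.single j 1)" by (simp add: in_keys_iff lookup_add)
    ultimately show False using assms(2) by auto
  qed
  then show "Poly_Mapping.lookup (partial_deriv j F) m = Poly_Mapping.lookup 0 m"
    by (simp add: lookup_partial_deriv in_keys_iff)
qed

section \<open>Contraction, exterior derivative and Jacobian forms\<close>

text \<open>A differential is supported on singletons, so among the subsets of \<open>K\<close> only those
  contribute; an infinite \<open>K\<close> has infinitely many subsets, and both sides are \<open>0\<close> by convention.\<close>

lemma wedge_differential: "wedge (differential F) \<omega> = wedge_by (\<lambda>j. partial_deriv j F) \<omega>"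
proof
  fix K
  show "wedge (differential F) \<omega> K = wedge_by (\<lambda>j. partial_deriv j F) \<omega> K"
  proof (cases "finite K")
    case True
    have "wedge (differential F) \<omega> K = (\<Sum>I\<in>(\<lambda>j. {j}) ` K.
        (- 1) ^ card {(i, j). i \<in> I \<and> j \<in> K - I \<and> j < i} * differential F I * \<omega> (K - I))"
      unfolding wedge_def using True
      by (intro sum.mono_neutral_right) (auto simp: differential_def is_singleton_def)
    also have "\<dots> = (\<Sum>j\<in>K. (- 1) ^ card {(i, l). i \<in> {j} \<and> l \<in> K - {j} \<and> l < i} *
        differential F {j} * \<omega> (K - {j}))"
      by (subst sum.reindex) (auto simp: inj_on_def)
    also have "\<dots> = wedge_by (\<lambda>j. partial_deriv j F) \<omega> K"
      unfolding wedge_by_def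
    proof (intro sum.cong refl)
      fix j assume "j \<in> K"
      have "{(i, l). i \<in> {j} \<and> l \<in> K - {j} \<and> l < i} = Pair j ` {l \<in> K. l < j}" by auto
      then have "card {(i, l). i \<in> {j} \<and> l \<in> K - {j} \<and> l < i} = card {l \<in> K. l < j}"
        by (simp add: card_image inj_on_def)
      then show "(- 1) ^ card {(i, l). i \<in> {j} \<and> l \<in> K - {j} \<and> l < i} * differential F {j} * \<omega> (K - {j}) =
          position_sign j K * partial_deriv j F * \<omega> (K - {j})"
        by (simp add: position_sign_def differential_def)
    qed
    finally show ?thesis .
  next
    case False
    then show ?thesis by (simp add: wedge_def wedge_by_def)
  qed
qed

definition grad :: "polynomial \<Rightarrow> nat \<Rightarrow> polynomial" where
  "grad F = (\<lambda>j. partial_deriv j F)"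

text \<open>The form \<open>dF\<^bsub>i\<^sub>1\<^esub> \<and> \<dots> \<and> dF\<^bsub>i\<^sub>k\<^esub>\<close>, whose coefficients are the Jacobian minors.\<close>

definition jacobian_form :: "(nat \<Rightarrow> polynomial) \<Rightarrow> nat list \<Rightarrow> diff_form" where
  "jacobian_form F xs = foldr (\<lambda>i. wedge_by (grad (F i))) xs unit_form"

lemma jacobian_form_simps [simp]:
  "jacobian_form F [] = unit_form"
  "jacobian_form F (i # xs) = wedge_by (grad (F i)) (jacobian_form F xs)"
  by (simp_all add: jacobian_form_def)

lemma rho_eq: "rho r q F = contract_radial r (jacobian_form F [0..<Suc q])"
  unfolding rho_def jacobian_form_def grad_def wedge_differential by (rule refl)

definition ext_deriv :: "diff_form \<Rightarrow> diff_form" where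
  "ext_deriv \<omega> K = (\<Sum>j\<in>K. position_sign j K * partial_deriv j (\<omega> (K - {j})))"

lemma contract_radial_eq:
  "contract_radial r \<omega> J = (\<Sum>i\<in>{..r} - J. position_sign i J * Var i * \<omega> (insert i J))"
  unfolding contract_radial_def position_sign_def by (rule refl)

text \<open>Contraction is an antiderivation. In the double sums, the terms in which \<open>x\<^sub>i \<partial>/\<partial>x\<^sub>i\<close> meets
  \<open>dx\<^sub>i\<close> give the pairing of \<open>\<alpha>\<close> with the radial field; the others, collected in \<open>T\<close>, cancel.\<close>

lemma contract_radial_wedge_by:
  assumes \<omega>: "\<And>K. infinite K \<Longrightarrow> \<omega> K = 0" and \<alpha>: "\<And>j. j > r \<Longrightarrow> \<alpha> j = 0"
  shows "contract_radial r (wedge_by \<alpha> \<omega>) J = (\<Sum>i\<le>r. Var i * \<alpha> i) * \<omega> J - wedge_by \<alpha> (contract_radial r \<omega>) J"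
proof (cases "finite J")
  case False
  then show ?thesis using \<omega> by (simp add: wedge_by_infinite contract_radial_eq)
next
  case fin: True
  define T where "T = (\<Sum>i\<in>{..r} - J. \<Sum>j\<in>J. position_sign i J * position_sign j (insert i J) *
    (Var i * \<alpha> j * \<omega> (insert i J - {j})))"
  have 1: "contract_radial r (wedge_by \<alpha> \<omega>) J = (\<Sum>i\<in>{..r} - J. Var i * \<alpha> i) * \<omega> J + T"
  proof -
    have "position_sign i J * Var i * wedge_by \<alpha> \<omega> (insert i J) = Var i * \<alpha> i * \<omega> J +
        (\<Sum>j\<in>J. position_sign i J * position_sign j (insert i J) * (Var i * \<alpha> j * \<omega> (insert i J - {j})))"
      if "i \<in> {..r} - J" for i
    proof -
      have "wedge_by \<alpha> \<omega> (insert i J) = position_sign i J * \<alpha> i * \<omega> J +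
          (\<Sum>j\<in>J. position_sign j (insert i J) * \<alpha> j * \<omega> (insert i J - {j}))"
        unfolding wedge_by_def using fin that by (subst sum.insert) auto
      moreover have "position_sign i J * Var i * (position_sign i J * \<alpha> i * \<omega> J) =
          (position_sign i J * position_sign i J) * (Var i * \<alpha> i * \<omega> J)" by (simp only: mult_ac)
      ultimately show ?thesis by (simp add: distrib_left sum_distrib_left mult_ac)
    qed
    then show ?thesis
      unfolding contract_radial_eq T_def by (simp add: sum.distrib sum_distrib_right)
  qed
  have 2: "wedge_by \<alpha> (contract_radial r \<omega>) J = (\<Sum>i\<in>{..r} \<inter> J. Var i * \<alpha> i) * \<omega> J - T"
  proof -
    have "position_sign j J * \<alpha> j * contract_radial r \<omega> (J - {j}) = Var j * \<alpha> j * \<omega> J -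
        (\<Sum>i\<in>{..r} - J. position_sign i J * position_sign j (insert i J) *
          (Var i * \<alpha> j * \<omega> (insert i J - {j})))" if j: "j \<in> J" for j
    proof (cases "j \<le> r")
      case False
      then show ?thesis using \<alpha> by simp
    next
      case True
      have sets: "{..r} - (J - {j}) = insert j ({..r} - J)" using True j by auto
      have "contract_radial r \<omega> (J - {j}) = position_sign j J * Var j * \<omega> J +
          (\<Sum>i\<in>{..r} - J. position_sign i (J - {j}) * Var i * \<omega> (insert i (J - {j})))"
        unfolding contract_radial_eq sets using j by (subst sum.insert) (auto simp: insert_absorb)
      moreover have "position_sign j J * \<alpha> j * (position_sign j J * Var j * \<omega> J) =
          (position_sign j J * position_sign j J) * (Var j * \<alpha> j * \<omega> J)" by (simp only: mult_ac)
      moreover have "position_sign j J * \<alpha> j * (position_sign i (J - {j}) * Var i * \<omega> (insert i (J - {j}))) =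
          - (position_sign i J * position_sign j (insert i J) * (Var i * \<alpha> j * \<omega> (insert i J - {j})))"
        if i: "i \<in> {..r} - J" for i
      proof -
        have sets: "insert i J - {i} = J" "insert i (J - {j}) = insert i J - {j}" and "i \<noteq> j"
          using i j by auto
        have a: "position_sign j J = ((if i < j then - position_sign j (insert i J)
            else position_sign j (insert i J)) :: polynomial)"
          using position_sign_remove[of i "insert i J" j] unfolding sets by simp
        show ?thesis
          unfolding sets position_sign_remove[OF j, of i] unfolding a
          using \<open>i \<noteq> j\<close> by (cases "i < j") (simp_all add: mult_ac)
      qed
      ultimately show ?thesis
        by (simp add: distrib_left sum_distrib_left sum_negf)
    qed
    then have "wedge_by \<alpha> (contract_radial r \<omega>) J = (\<Sum>j\<in>J. Var j * \<alpha> j * \<omega> J) - T"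
      unfolding wedge_by_def T_def by (simp add: sum_subtractf) (rule sum.swap)
    also have "(\<Sum>j\<in>J. Var j * \<alpha> j * \<omega> J) = (\<Sum>j\<in>{..r} \<inter> J. Var j * \<alpha> j * \<omega> J)"
    proof (rule sum.mono_neutral_right)
      show "\<forall>j\<in>J - {..r} \<inter> J. Var j * \<alpha> j * \<omega> J = 0"
      proof
        fix j assume "j \<in> J - {..r} \<inter> J"
        then have "j > r" by auto
        then show "Var j * \<alpha> j * \<omega> J = 0" by (simp add: \<alpha>)
      qed
    qed (use fin in auto)
    finally show ?thesis by (simp add: sum_distrib_right)
  qed
  have "(\<Sum>i\<le>r. Var i * \<alpha> i) = (\<Sum>i\<in>{..r} - J. Var i * \<alpha> i) + (\<Sum>i\<in>{..r} \<inter> J. Var i * \<alpha> i)"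
    by (subst sum.union_disjoint[symmetric]) (auto intro: sum.cong)
  then show ?thesis unfolding 1 2 by (simp add: algebra_simps)
qed

lemma contract_radial_twice: "contract_radial r (contract_radial r \<omega>) J = 0"
proof -
  define g where "g i k = position_sign i J * position_sign k (insert i J) *
    (Var i * Var k * \<omega> (insert k (insert i J)))" for i k
  let ?A = "{..r} - J"
  have "contract_radial r (contract_radial r \<omega>) J = (\<Sum>i\<in>?A. \<Sum>k\<in>?A - {i}. g i k)"
    unfolding contract_radial_eq sum_distrib_left g_def
    by (intro sum.cong refl) (auto simp: mult_ac)
  also have "\<dots> = (\<Sum>i\<in>?A. \<Sum>k\<in>?A. if i = k then 0 else g i k)"
    by (intro sum.cong refl sum.mono_neutral_cong_left) auto
  finally have S: "contract_radial r (contract_radial r \<omega>) J = (\<Sum>i\<in>?A. \<Sum>k\<in>?A. if i = k then 0 else g i k)" .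
  have "(if i = k then 0 else g i k) = - (if k = i then 0 else g k i)" if "i \<in> ?A" "k \<in> ?A" for i k
  proof (cases "i = k")
    case False
    have sets: "insert i J - {i} = J" "insert k J - {k} = J" using that by auto
    have a: "position_sign k J = ((if i < k then - position_sign k (insert i J)
        else position_sign k (insert i J)) :: polynomial)"
      using position_sign_remove[of i "insert i J" k] unfolding sets by simp
    have b: "position_sign i J = ((if k < i then - position_sign i (insert k J)
        else position_sign i (insert k J)) :: polynomial)"
      using position_sign_remove[of k "insert k J" i] unfolding sets by simp
    show ?thesis
      unfolding g_def a b insert_commute[of k i] using False by (cases "i < k") (simp_all add: mult_ac)
  qed simp
  then have "contract_radial r (contract_radial r \<omega>) J = (\<Sum>i\<in>?A. \<Sum>k\<in>?A. - (if k = i then 0 else g k i))"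
    unfolding S by (intro sum.cong refl)
  also have "\<dots> = - contract_radial r (contract_radial r \<omega>) J"
    unfolding S sum_negf by (subst sum.swap) (rule refl)
  finally show ?thesis by (rule eq_minus_self)
qed

lemma ext_deriv_mult: "ext_deriv (\<lambda>J. F * \<omega> J) K = wedge_by (grad F) \<omega> K + F * ext_deriv \<omega> K"
  unfolding ext_deriv_def wedge_by_def grad_def sum_distrib_left
  by (simp add: partial_deriv_mult algebra_simps sum.distrib)

text \<open>The second derivatives of \<open>F\<close> are symmetric, so their contribution vanishes.\<close>

lemma ext_deriv_wedge_by_grad: "ext_deriv (wedge_by (grad F) \<omega>) K = - wedge_by (grad F) (ext_deriv \<omega>) K"
proof -
  have "ext_deriv (wedge_by (grad F) \<omega>) K =
      (\<Sum>j\<in>K. \<Sum>k\<in>K - {j}. position_sign j K * position_sign k (K - {j}) *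
        (partial_deriv j (partial_deriv k F) * \<omega> (K - {j} - {k}))) +
      (\<Sum>j\<in>K. \<Sum>k\<in>K - {j}. position_sign j K * position_sign k (K - {j}) *
        (partial_deriv k F * partial_deriv j (\<omega> (K - {j} - {k}))))"
    unfolding ext_deriv_def wedge_by_def grad_def sum.distrib[symmetric] partial_deriv_sum sum_distrib_left
    by (intro sum.cong refl) (simp add: partial_deriv_mult mult.assoc distrib_left)
  also have "(\<Sum>j\<in>K. \<Sum>k\<in>K - {j}. position_sign j K * position_sign k (K - {j}) *
        (partial_deriv j (partial_deriv k F) * \<omega> (K - {j} - {k}))) = 0"
    by (rule symmetric_double_sum) (metis minus_minus_commute partial_deriv_commute)
  also have "(\<Sum>j\<in>K. \<Sum>k\<in>K - {j}. position_sign j K * position_sign k (K - {j}) *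
        (partial_deriv k F * partial_deriv j (\<omega> (K - {j} - {k})))) =
      - (\<Sum>j\<in>K. \<Sum>k\<in>K - {j}. position_sign j K * position_sign k (K - {j}) *
        (partial_deriv j F * partial_deriv k (\<omega> (K - {k} - {j}))))"
    by (rule antisymmetric_double_sum)
  also have "(\<Sum>j\<in>K. \<Sum>k\<in>K - {j}. position_sign j K * position_sign k (K - {j}) *
        (partial_deriv j F * partial_deriv k (\<omega> (K - {k} - {j})))) = wedge_by (grad F) (ext_deriv \<omega>) K"
    unfolding ext_deriv_def wedge_by_def grad_def sum_distrib_left
    by (intro sum.cong refl) (simp add: mult_ac minus_minus_commute)
  finally show ?thesis by simp
qed

lemma jacobian_form_infinite: "infinite K \<Longrightarrow> jacobian_form F xs K = 0"
  by (cases xs) (auto simp: unit_form_def wedge_by_infinite)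

lemma ext_deriv_jacobian_form: "ext_deriv (jacobian_form F xs) = (\<lambda>_. 0)"
proof (induction xs)
  case Nil
  show ?case by (rule HOL.ext) (auto simp: ext_deriv_def unit_form_def intro: sum.neutral)
next
  case (Cons i xs)
  then show ?case by (auto simp: ext_deriv_wedge_by_grad)
qed

text \<open>Cartan's formula for the Lie derivative along the radial field, which multiplies the closed
  form \<open>\<Omega> = dF\<^bsub>i\<^sub>1\<^esub> \<and> \<dots> \<and> dF\<^bsub>i\<^sub>k\<^esub>\<close> by its total degree. In the induction,
  \<open>i\<^sub>R (dF \<and> \<Omega>) = deg F \<cdot> F \<Omega> - dF \<and> i\<^sub>R \<Omega>\<close>.\<close>

lemma ext_deriv_contract_jacobian_form:
  assumes "\<And>i. i \<in> set xs \<Longrightarrow> F i \<in> homogeneous_polys r (d i)"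
  shows "ext_deriv (contract_radial r (jacobian_form F xs)) =
    (\<lambda>K. of_nat (\<Sum>i\<leftarrow>xs. d i) * jacobian_form F xs K)"
  using assms
proof (induction xs)
  case Nil
  show ?case by (rule HOL.ext) (simp add: ext_deriv_def contract_radial_eq unit_form_def)
next
  case (Cons i xs)
  let ?w = "jacobian_form F xs" and ?\<alpha> = "grad (F i)"
  have Fi: "F i \<in> homogeneous_polys r (d i)" using Cons.prems by simp
  have "contract_radial r (jacobian_form F (i # xs)) =
      (\<lambda>J. of_nat (d i) * (F i * ?w J) - wedge_by ?\<alpha> (contract_radial r ?w) J)"
    using contract_radial_wedge_by[of ?w r ?\<alpha>] jacobian_form_infinite partial_deriv_outside[OF Fi]
      euler_identity[OF Fi] by (simp add: grad_def fun_eq_iff mult.assoc)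
  moreover have diff: "ext_deriv (\<lambda>J. a J - b J) K = ext_deriv a K - ext_deriv b K" for a b K
    unfolding ext_deriv_def by (simp add: partial_deriv_diff right_diff_distrib sum_subtractf)
  moreover have nat: "ext_deriv (\<lambda>J. of_nat n * a J) K = of_nat n * ext_deriv a K" for a n K
    unfolding ext_deriv_def sum_distrib_left by (simp add: partial_deriv_mult mult_ac)
  moreover have "ext_deriv (contract_radial r ?w) = (\<lambda>K. of_nat (\<Sum>i\<leftarrow>xs. d i) * ?w K)"
    using Cons by simp
  ultimately have "ext_deriv (contract_radial r (jacobian_form F (i # xs))) K =
      of_nat (d i) * wedge_by ?\<alpha> ?w K + of_nat (\<Sum>i\<leftarrow>xs. d i) * wedge_by ?\<alpha> ?w K" for K
    by (simp only: ext_deriv_mult ext_deriv_jacobian_form ext_deriv_wedge_by_grad wedge_by_scale_right) simp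
  then show ?case by (simp add: fun_eq_iff distrib_right)
qed

lemma ext_deriv_rho:
  assumes "\<And>i. i \<le> q \<Longrightarrow> F i \<in> homogeneous_polys r (d i)"
  shows "ext_deriv (rho r q F) = (\<lambda>K. of_nat (\<Sum>i\<le>q. d i) * jacobian_form F [0..<Suc q] K)"
proof -
  have "(\<Sum>i\<leftarrow>[0..<Suc q]. d i) = (\<Sum>i\<le>q. d i)"
    by (simp only: sum_list_distinct_conv_sum_set distinct_upt set_upt atLeast0LessThan lessThan_Suc_atMost)
  moreover have "F i \<in> homogeneous_polys r (d i)" if "i \<in> set [0..<Suc q]" for i using that assms by auto
  ultimately show ?thesis
    unfolding rho_eq using ext_deriv_contract_jacobian_form[of "[0..<Suc q]" F r d] by metis
qed

section \<open>Degrees\<close>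

text \<open>Homogeneity of degree \<open>n - a\<close>, written without a truncated subtraction: a coefficient of a
  form counts the \<open>a\<close> differentials with degree \<open>1\<close> each.\<close>

definition shifted_homogeneous :: "nat \<Rightarrow> nat \<Rightarrow> nat \<Rightarrow> polynomial set" where
  "shifted_homogeneous r a n = {p. \<forall>m\<in>Poly_Mapping.keys p.
     Poly_Mapping.keys m \<subseteq> {..r} \<and> (\<Sum>i\<le>r. Poly_Mapping.lookup m i) + a = n}"

lemma homogeneous_polys_eq_shifted: "homogeneous_polys r n = shifted_homogeneous r 0 n"
  by (simp add: homogeneous_polys_def shifted_homogeneous_def)

lemma shifted_homogeneous_zero: "0 \<in> shifted_homogeneous r a n"
  by (simp add: shifted_homogeneous_def)

lemma shifted_homogeneous_add:
  "p \<in> shifted_homogeneous r a n \<Longrightarrow> q \<in> shifted_homogeneous r a n \<Longrightarrow> p + q \<in> shifted_homogeneous r a n"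
  unfolding shifted_homogeneous_def using Poly_Mapping.keys_add[of p q] by blast

lemma shifted_homogeneous_scale: "p \<in> shifted_homogeneous r a n \<Longrightarrow> scaleC c p \<in> shifted_homogeneous r a n"
  unfolding shifted_homogeneous_def by (auto simp: in_keys_iff lookup_scaleC)

lemma shifted_homogeneous_sum:
  "(\<And>i. i \<in> I \<Longrightarrow> f i \<in> shifted_homogeneous r a n) \<Longrightarrow> (\<Sum>i\<in>I. f i) \<in> shifted_homogeneous r a n"
  by (induction I rule: infinite_finite_induct) (auto intro: shifted_homogeneous_zero shifted_homogeneous_add)

lemma shifted_homogeneous_mult:
  assumes "p \<in> shifted_homogeneous r a n" "q \<in> shifted_homogeneous r b k"
  shows "p * q \<in> shifted_homogeneous r (a + b) (n + k)"
  unfolding shifted_homogeneous_def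
proof (intro CollectI ballI)
  fix m assume "m \<in> Poly_Mapping.keys (p * q)"
  then obtain u v where "m = u + v" "u \<in> Poly_Mapping.keys p" "v \<in> Poly_Mapping.keys q"
    using keys_mult[of p q] by blast
  moreover have "Poly_Mapping.keys (u + v) \<subseteq> Poly_Mapping.keys u \<union> Poly_Mapping.keys v"
    by (rule Poly_Mapping.keys_add)
  ultimately show "Poly_Mapping.keys m \<subseteq> {..r} \<and> (\<Sum>i\<le>r. Poly_Mapping.lookup m i) + (a + b) = n + k"
    using assms unfolding shifted_homogeneous_def by (fastforce simp: lookup_add sum.distrib)
qed

lemma shifted_homogeneous_position_sign:
  assumes "p \<in> shifted_homogeneous r a n" shows "position_sign j K * p \<in> shifted_homogeneous r a n"
proof (cases "even (card {l \<in> K. l < j})")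
  case True
  then show ?thesis using assms by (simp add: position_sign_def)
next
  case False
  then show ?thesis using assms by (simp add: position_sign_def shifted_homogeneous_def)
qed

lemma shifted_homogeneous_partial_deriv:
  assumes "p \<in> shifted_homogeneous r a n"
  shows "partial_deriv i p \<in> shifted_homogeneous r (Suc a) n"
  unfolding shifted_homogeneous_def
proof (intro CollectI ballI)
  fix m assume "m \<in> Poly_Mapping.keys (partial_deriv i p)"
  then have "m + Poly_Mapping.single i 1 \<in> Poly_Mapping.keys p"
    by (simp add: in_keys_iff lookup_partial_deriv)
  then have *: "Poly_Mapping.keys (m + Poly_Mapping.single i 1) \<subseteq> {..r}"
    "(\<Sum>l\<le>r. Poly_Mapping.lookup (m + Poly_Mapping.single i 1) l) + a = n"
    using assms unfolding shifted_homogeneous_def by blast+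
  have "i \<in> Poly_Mapping.keys (m + Poly_Mapping.single i 1)" by (simp add: in_keys_iff lookup_add)
  then have "i \<le> r" using *(1) by auto
  then have "(\<Sum>l\<le>r. Poly_Mapping.lookup (m + Poly_Mapping.single i 1) l) =
      Suc (\<Sum>l\<le>r. Poly_Mapping.lookup m l)"
    by (simp add: lookup_add sum.distrib lookup_single when_def)
  moreover have "Poly_Mapping.keys m \<subseteq> Poly_Mapping.keys (m + Poly_Mapping.single i 1)"
    by (auto simp: in_keys_iff lookup_add)
  ultimately show "Poly_Mapping.keys m \<subseteq> {..r} \<and> (\<Sum>l\<le>r. Poly_Mapping.lookup m l) + Suc a = n"
    using * by auto
qed

lemma Var_homogeneous: "i \<le> r \<Longrightarrow> Var i \<in> shifted_homogeneous r 0 1"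
  unfolding Var_def shifted_homogeneous_def by (auto simp: lookup_single when_def)

lemma homogeneous_polys_prod:
  assumes "finite I" "\<And>i. i \<in> I \<Longrightarrow> f i \<in> homogeneous_polys r (n i)"
  shows "(\<Prod>i\<in>I. f i) \<in> homogeneous_polys r (\<Sum>i\<in>I. n i)"
  using assms
proof (induction I rule: finite_induct)
  case empty
  show ?case by (simp add: homogeneous_polys_def)
next
  case (insert i I)
  then show ?case
    using shifted_homogeneous_mult[of "f i" r 0 "n i" "\<Prod>i\<in>I. f i" 0] by (simp add: homogeneous_polys_eq_shifted)
qed

lemma homogeneous_polys_power: "p \<in> homogeneous_polys r n \<Longrightarrow> p ^ k \<in> homogeneous_polys r (k * n)"
  using homogeneous_polys_prod[of "{..<k}" "\<lambda>_. p" r "\<lambda>_. n"] by simp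

text \<open>Terms of \<open>h\<close> of positive degree would produce terms of the wrong degree.\<close>

lemma homogeneous_quotient_is_constant:
  assumes p: "p \<in> shifted_homogeneous r a n" and hp: "h * p \<in> shifted_homogeneous r a n"
  shows "h * p = scaleC (Poly_Mapping.lookup h 0) p"
proof -
  define h' where "h' = h - Poly_Mapping.single 0 (Poly_Mapping.lookup h 0)"
  have h'0: "Poly_Mapping.lookup h' 0 = 0" by (simp add: h'_def lookup_minus)
  have eq: "h' * p = h * p + scaleC (- Poly_Mapping.lookup h 0) p"
    by (simp add: h'_def scaleC_eq_mult single_uminus algebra_simps)
  then have h'p: "h' * p \<in> shifted_homogeneous r a n"
    by (simp only:) (intro shifted_homogeneous_add shifted_homogeneous_scale hp p)
  have "Poly_Mapping.keys (h' * p) = {}"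
  proof (rule ccontr)
    assume "Poly_Mapping.keys (h' * p) \<noteq> {}"
    then obtain m where m: "m \<in> Poly_Mapping.keys (h' * p)" by blast
    then obtain u v where uv: "m = u + v" "u \<in> Poly_Mapping.keys h'" "v \<in> Poly_Mapping.keys p"
      using keys_mult[of h' p] by blast
    have "Poly_Mapping.keys m \<subseteq> {..r}" "(\<Sum>i\<le>r. Poly_Mapping.lookup m i) + a = n"
      using m h'p unfolding shifted_homogeneous_def by blast+
    moreover have "(\<Sum>i\<le>r. Poly_Mapping.lookup v i) + a = n"
      using uv(3) p unfolding shifted_homogeneous_def by blast
    ultimately have keys: "Poly_Mapping.keys m \<subseteq> {..r}" and "(\<Sum>i\<le>r. Poly_Mapping.lookup u i) = 0"
      by (auto simp: uv(1) lookup_add sum.distrib)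
    then have zero: "\<And>i. i \<le> r \<Longrightarrow> Poly_Mapping.lookup u i = 0" by simp
    have "Poly_Mapping.lookup u i = 0" for i
    proof (cases "i \<le> r")
      case False
      then have "i \<notin> Poly_Mapping.keys m" using keys by auto
      then show ?thesis by (simp add: uv(1) in_keys_iff lookup_add)
    qed (rule zero)
    then have "u = 0" by (simp add: poly_mapping_eq_iff fun_eq_iff)
    then show False using uv(2) h'0 by (simp add: in_keys_iff)
  qed
  then have "h' * p = 0" by simp
  then show ?thesis using eq by (simp add: scaleC_eq_mult single_uminus)
qed

lemma jacobian_form_homogeneous:
  assumes "\<And>i. i \<in> set xs \<Longrightarrow> F i \<in> homogeneous_polys r (d i)"
  shows "jacobian_form F xs K \<in> shifted_homogeneous r (card K) (\<Sum>i\<leftarrow>xs. d i)"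
  using assms
proof (induction xs arbitrary: K)
  case Nil
  show ?case by (simp add: unit_form_def shifted_homogeneous_def)
next
  case (Cons i xs)
  have "position_sign j K * grad (F i) j * jacobian_form F xs (K - {j})
      \<in> shifted_homogeneous r (card K) (\<Sum>i\<leftarrow>i # xs. d i)" if "j \<in> K" "finite K" for j
  proof -
    have "grad (F i) j \<in> shifted_homogeneous r (Suc 0) (d i)"
      using Cons.prems[of i] shifted_homogeneous_partial_deriv
      unfolding grad_def homogeneous_polys_eq_shifted by simp
    moreover have "jacobian_form F xs (K - {j}) \<in> shifted_homogeneous r (card (K - {j})) (\<Sum>i\<leftarrow>xs. d i)"
      using Cons by simp
    moreover have "card K = Suc 0 + card (K - {j})" using that by (simp add: card_gt_0_iff) (metis Suc_pred card_gt_0_iff empty_iff)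
    ultimately have "position_sign j K * (grad (F i) j * jacobian_form F xs (K - {j}))
        \<in> shifted_homogeneous r (Suc 0 + card (K - {j})) (d i + (\<Sum>i\<leftarrow>xs. d i))"
      by (intro shifted_homogeneous_position_sign shifted_homogeneous_mult)
    then show ?thesis unfolding mult.assoc \<open>card K = Suc 0 + card (K - {j})\<close> by simp
  qed
  then show ?case
    unfolding jacobian_form_simps wedge_by_def
    by (cases "finite K") (auto intro: shifted_homogeneous_sum simp: shifted_homogeneous_zero)
qed

lemma jacobian_form_support:
  assumes "\<And>i. i \<in> set xs \<Longrightarrow> F i \<in> homogeneous_polys r (d i)" "jacobian_form F xs K \<noteq> 0"
  shows "K \<subseteq> {..r}" "card K = length xs"
proof -
  have "K \<subseteq> {..r} \<and> card K = length xs"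
    using assms
  proof (induction xs arbitrary: K)
    case Nil
    then show ?case by (auto simp: unit_form_def split: if_splits)
  next
    case (Cons i xs)
    then have fin: "finite K" using jacobian_form_infinite[of K F "i # xs"] by auto
    from Cons.prems(2) obtain j where j: "j \<in> K" "grad (F i) j \<noteq> 0" "jacobian_form F xs (K - {j}) \<noteq> 0"
    proof -
      obtain j where "j \<in> K" "position_sign j K * grad (F i) j * jacobian_form F xs (K - {j}) \<noteq> 0"
        using Cons.prems(2) unfolding jacobian_form_simps wedge_by_def
        by (metis (mono_tags, lifting) sum.not_neutral_contains_not_neutral)
      then show ?thesis using that by auto
    qed
    have "j \<le> r" using partial_deriv_outside[of "F i" r "d i" j] Cons.prems(1)[of i] j(2)
      unfolding grad_def by (metis leI list.set_intros(1))
    moreover have "K - {j} \<subseteq> {..r} \<and> card (K - {j}) = length xs" using Cons.IH[OF _ j(3)] Cons.prems(1) by simp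
    moreover have "card K = Suc (card (K - {j}))" using j(1) fin by (metis card.remove)
    ultimately show ?case by auto
  qed
  then show "K \<subseteq> {..r}" "card K = length xs" by auto
qed

lemma rho_in_twisted_forms:
  assumes F: "\<And>i. i \<le> q \<Longrightarrow> F i \<in> homogeneous_polys r (d i)"
  shows "rho r q F \<in> twisted_forms r q (\<Sum>i\<le>q. d i)"
proof -
  let ?xs = "[0..<Suc q]" and ?D = "\<Sum>i\<le>q. d i"
  have F': "F i \<in> homogeneous_polys r (d i)" if "i \<in> set ?xs" for i using that F by auto
  have D: "(\<Sum>i\<leftarrow>?xs. d i) = ?D"
    by (simp only: sum_list_distinct_conv_sum_set distinct_upt set_upt atLeast0LessThan lessThan_Suc_atMost)
  have "J \<subseteq> {..r} \<and> card J = q \<and> q \<le> ?D \<and> rho r q F J \<in> homogeneous_polys r (?D - q)"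
    if nz: "rho r q F J \<noteq> 0" for J
  proof -
    have supp: "insert i J \<subseteq> {..r} \<and> card (insert i J) = Suc q"
      if "jacobian_form F ?xs (insert i J) \<noteq> 0" for i
      using jacobian_form_support[OF F' that] by simp
    obtain i where i: "i \<notin> J" "jacobian_form F ?xs (insert i J) \<noteq> 0"
    proof (rule ccontr)
      assume "\<not> thesis"
      then have "\<forall>i. i \<notin> J \<longrightarrow> jacobian_form F ?xs (insert i J) = 0" using that by blast
      then show False using nz unfolding rho_eq contract_radial_eq by simp
    qed
    have finJ: "finite J" using supp[OF i(2)] by (auto intro: finite_subset)
    have J: "J \<subseteq> {..r}" "card J = q" using supp[OF i(2)] i(1) finJ by auto
    have "rho r q F J \<in> shifted_homogeneous r (Suc q) (Suc ?D)"
      unfolding rho_eq contract_radial_eq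
    proof (rule shifted_homogeneous_sum)
      fix i assume i: "i \<in> {..r} - J"
      have "jacobian_form F ?xs (insert i J) \<in> shifted_homogeneous r (Suc q) ?D"
      proof -
        have "jacobian_form F ?xs (insert i J) \<in> shifted_homogeneous r (card (insert i J)) ?D"
          using jacobian_form_homogeneous[of ?xs F r d "insert i J", OF F'] unfolding D .
        moreover have "card (insert i J) = Suc q" using i J finJ by simp
        ultimately show ?thesis by (simp only:)
      qed
      then show "position_sign i J * Var i * jacobian_form F ?xs (insert i J) \<in> shifted_homogeneous r (Suc q) (Suc ?D)"
        unfolding mult.assoc
        using shifted_homogeneous_position_sign shifted_homogeneous_mult[OF Var_homogeneous, of i r] i
        by fastforce
    qed
    then have *: "\<And>m. m \<in> Poly_Mapping.keys (rho r q F J) \<Longrightarrow>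
        Poly_Mapping.keys m \<subseteq> {..r} \<and> (\<Sum>i\<le>r. Poly_Mapping.lookup m i) + q = ?D"
      unfolding shifted_homogeneous_def by simp
    have "Poly_Mapping.keys (rho r q F J) \<noteq> {}" using nz by simp
    then have "q \<le> ?D" using * by fastforce
    then show ?thesis using J * unfolding homogeneous_polys_def by fastforce
  qed
  moreover have "contract_radial r (rho r q F) = 0"
    unfolding rho_eq by (simp add: fun_eq_iff contract_radial_twice)
  ultimately show ?thesis unfolding twisted_forms_def by blast
qed

section \<open>Polynomial dependence on the tuple\<close>

lemma position_sign_scale: "position_sign j K * scaleC c p = scaleC c (position_sign j K * p)" for p :: polynomial
  by (simp add: scaleC_eq_mult mult.left_commute)

lemma clinear_wedge_by_right: "clinear (wedge_by \<alpha>)" for \<alpha> :: "nat \<Rightarrow> polynomial"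
  by (rule clinearI)
    (auto simp: fun_eq_iff wedge_by_def algebra_simps sum.distrib scaleC_eq_mult sum_distrib_left)

lemma clinear_wedge_by_left: "clinear (\<lambda>\<alpha>. wedge_by \<alpha> \<omega>)" for \<omega> :: diff_form
  by (rule clinearI)
    (auto simp: fun_eq_iff wedge_by_def algebra_simps sum.distrib scaleC_eq_mult sum_distrib_left)

lemma clinear_contract_radial: "clinear (contract_radial r)"
  by (rule clinearI)
    (auto simp: fun_eq_iff contract_radial_eq algebra_simps sum.distrib scaleC_eq_mult sum_distrib_left)

lemma clinear_ext_deriv: "clinear ext_deriv"
  by (rule clinearI)
    (auto simp: fun_eq_iff ext_deriv_def partial_deriv_add clinear_scale[OF clinear_partial_deriv]
      position_sign_scale distrib_left sum.distrib scaleC_sum_right)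

lemma clinear_grad: "clinear grad"
  by (rule clinearI) (auto simp: fun_eq_iff grad_def partial_deriv_add clinear_scale[OF clinear_partial_deriv])

lemma form_map_jacobian_form:
  assumes "\<And>i. i \<in> set xs \<Longrightarrow> form_map 1 (\<lambda>c. F c i)"
  shows "form_map (length xs) (\<lambda>c. jacobian_form (F c) xs)"
  using assms
proof (induction xs)
  case Nil
  show ?case by (simp add: form_map.const)
next
  case (Cons i xs)
  have "form_map (1 + length xs) (\<lambda>c. wedge_by (grad (F c i)) (jacobian_form (F c) xs))"
  proof (rule form_map_bilinear[where B = wedge_by])
    show "form_map 1 (\<lambda>c. grad (F c i))" using Cons.prems by (intro form_map_linear[OF _ clinear_grad]) simp
    show "form_map (length xs) (\<lambda>c. jacobian_form (F c) xs)" using Cons by simp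
  qed (rule clinear_wedge_by_right clinear_wedge_by_left)+
  then show ?case by simp
qed

lemma form_map_rho:
  assumes "\<And>i. i \<le> q \<Longrightarrow> form_map 1 (\<lambda>c. F c i)"
  shows "form_map (Suc q) (\<lambda>c. rho r q (F c))"
proof -
  have "form_map (length [0..<Suc q]) (\<lambda>c. jacobian_form (F c) [0..<Suc q])"
    using assms by (intro form_map_jacobian_form) auto
  then show ?thesis unfolding rho_eq using form_map_linear[OF _ clinear_contract_radial] by simp
qed

lemma form_map_pencil: "form_map 1 (\<lambda>c :: nat \<Rightarrow> complex. scaleC (c 0) F + scaleC (c 1) G)"
proof -
  have "clinear (\<lambda>c :: nat \<Rightarrow> complex. c i)" for i by (rule clinear_apply)
  then have "form_map (Suc 0) (\<lambda>c :: nat \<Rightarrow> complex. scaleC (c i) F)" for i and F :: 'a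
    using form_map.mult[OF _ form_map.const] by blast
  then show ?thesis by (simp add: form_map.add)
qed

text \<open>Homogenising: the line through \<open>F\<close> in direction \<open>G\<close> is an affine chart of the pencil spanned
  by \<open>F\<close> and \<open>G\<close>.\<close>

lemma poly_on_linesI:
  assumes "\<And>F G. F \<in> P \<Longrightarrow> G \<in> P \<Longrightarrow> \<exists>n. homogeneous_fun n (\<lambda>c :: nat \<Rightarrow> complex. f (scaleC (c 0) F + scaleC (c 1) G))"
  shows "poly_on_lines P f"
  unfolding poly_on_lines_def
proof (intro ballI)
  fix F G assume FG: "F \<in> P" "G \<in> P"
  from assms[OF this] obtain n
    where n: "homogeneous_fun n (\<lambda>c :: nat \<Rightarrow> complex. f (scaleC (c 0) F + scaleC (c 1) G))" by blast
  let ?e = "\<lambda>i j. if j = i then 1 else 0 :: complex"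
  obtain p where p: "\<And>t. f (scaleC ((?e 0 + scaleC t (?e (1 :: nat))) 0) F + scaleC ((?e 0 + scaleC t (?e (1 :: nat))) 1) G) = poly p t"
    using homogeneous_fun_on_line[OF n, of "?e 0" "?e 1"] by blast
  have "f (F + scaleC t G) = poly p t" for t
    using p[of t] by (simp add: scaleC_one)
  then show "\<exists>p. \<forall>t. f (F + scaleC t G) = poly p t" by blast
qed

section \<open>Products of combinations of 1-forms\<close>

definition wedge_product :: "(nat \<Rightarrow> nat \<Rightarrow> 'a :: comm_ring_1) \<Rightarrow> nat list \<Rightarrow> nat set \<Rightarrow> 'a" where
  "wedge_product \<alpha> xs = foldr (\<lambda>i. wedge_by (\<alpha> i)) xs (\<lambda>I. if I = {} then 1 else 0)"

lemma wedge_product_simps [simp]: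
  "wedge_product \<alpha> [] = (\<lambda>I. if I = {} then 1 else 0)"
  "wedge_product \<alpha> (i # xs) = wedge_by (\<alpha> i) (wedge_product \<alpha> xs)"
  by (simp_all add: wedge_product_def)

lemma jacobian_form_eq_wedge_product: "jacobian_form F xs = wedge_product (\<lambda>i. grad (F i)) xs"
  by (simp add: jacobian_form_def wedge_product_def unit_form_def[abs_def])

lemma wedge_by_wedge_product_member:
  fixes \<alpha> :: "nat \<Rightarrow> nat \<Rightarrow> 'a :: {idom, ring_char_0}"
  shows "i \<in> set xs \<Longrightarrow> wedge_by (\<alpha> i) (wedge_product \<alpha> xs) = (\<lambda>_. 0)"
proof (induction xs)
  case (Cons a xs)
  show ?case
  proof (cases "i = a")
    case True
    then show ?thesis by (simp add: wedge_by_square)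
  next
    case False
    then have "wedge_by (\<alpha> i) (wedge_product \<alpha> xs) = (\<lambda>_. 0)" using Cons by simp
    then show ?thesis by (simp add: wedge_by_anticommute[of "\<alpha> i"])
  qed
qed simp

lemma wedge_by_wedge_product_insort:
  fixes \<alpha> :: "nat \<Rightarrow> nat \<Rightarrow> 'a :: comm_ring_1"
  shows "\<exists>e. wedge_by (\<alpha> i) (wedge_product \<alpha> xs) = (\<lambda>K. e * wedge_product \<alpha> (insort i xs) K)"
proof (induction xs)
  case Nil
  show ?case by (intro exI[of _ 1]) simp
next
  case (Cons a xs)
  then obtain e where e: "wedge_by (\<alpha> i) (wedge_product \<alpha> xs) = (\<lambda>K. e * wedge_product \<alpha> (insort i xs) K)" by blast
  show ?case
  proof (cases "i \<le> a")
    case True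
    then show ?thesis by (intro exI[of _ 1]) simp
  next
    case False
    then show ?thesis by (intro exI[of _ "- e"]) (simp add: wedge_by_anticommute[of "\<alpha> i"] e wedge_by_scale_right)
  qed
qed

text \<open>The submodule spanned by the products, in increasing order, of \<open>s\<close> distinct members of
  \<open>\<alpha>\<^sub>0, \<dots>, \<alpha>\<^sub>q\<close>. For \<open>s = q + 1\<close> it has a single generator.\<close>

inductive_set product_span :: "(nat \<Rightarrow> nat \<Rightarrow> 'a :: comm_ring_1) \<Rightarrow> nat \<Rightarrow> nat \<Rightarrow> (nat set \<Rightarrow> 'a) set"
  for \<alpha> q s where
  zero: "(\<lambda>_. 0) \<in> product_span \<alpha> q s"
| add_multiple: "\<omega> \<in> product_span \<alpha> q s \<Longrightarrow> sorted_wrt (<) xs \<Longrightarrow> set xs \<subseteq> {..q} \<Longrightarrow> length xs = s \<Longrightarrow>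
    (\<lambda>K. \<omega> K + h * wedge_product \<alpha> xs K) \<in> product_span \<alpha> q s"

lemma wedge_product_span:
  fixes \<alpha> :: "nat \<Rightarrow> nat \<Rightarrow> 'a :: {idom, ring_char_0}"
  assumes "\<omega> \<in> product_span \<alpha> q s"
  shows "wedge_by (\<lambda>j. \<Sum>k\<le>q. a k * \<alpha> k j) \<omega> \<in> product_span \<alpha> q (Suc s)"
  using assms
proof induction
  case zero
  show ?case by (simp add: product_span.zero)
next
  case (add_multiple \<omega> xs h)
  have "(\<lambda>K. wedge_by (\<lambda>j. \<Sum>k\<le>q. a k * \<alpha> k j) \<omega> K + (\<Sum>k\<in>S. h * (a k * wedge_by (\<alpha> k) (wedge_product \<alpha> xs) K)))
      \<in> product_span \<alpha> q (Suc s)" if "finite S" "S \<subseteq> {..q}" for S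
    using that
  proof (induction S rule: finite_induct)
    case empty
    show ?case using add_multiple.IH by simp
  next
    case (insert k S)
    then have IH: "(\<lambda>K. wedge_by (\<lambda>j. \<Sum>k\<le>q. a k * \<alpha> k j) \<omega> K + (\<Sum>k\<in>S. h * (a k * wedge_by (\<alpha> k) (wedge_product \<alpha> xs) K)))
      \<in> product_span \<alpha> q (Suc s)" by simp
    show ?case
    proof (cases "k \<in> set xs")
      case True
      then show ?thesis using IH insert by (simp add: wedge_by_wedge_product_member)
    next
      case False
      obtain e where e: "wedge_by (\<alpha> k) (wedge_product \<alpha> xs) = (\<lambda>K. e * wedge_product \<alpha> (insort k xs) K)"
        using wedge_by_wedge_product_insort by blast
      have "sorted_wrt (<) (insort k xs)" "set (insort k xs) \<subseteq> {..q}" "length (insort k xs) = Suc s"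
        using add_multiple.hyps insert.prems False
        by (auto simp: strict_sorted_iff sorted_insort distinct_insort set_insort_key)
      from product_span.add_multiple[OF IH this, of "h * a k * e"]
      show ?thesis using insert by (simp add: e algebra_simps)
    qed
  qed
  from this[of "{..q}"]
  have "(\<lambda>K. wedge_by (\<lambda>j. \<Sum>k\<le>q. a k * \<alpha> k j) \<omega> K + (\<Sum>k\<le>q. h * (a k * wedge_by (\<alpha> k) (wedge_product \<alpha> xs) K)))
      \<in> product_span \<alpha> q (Suc s)" by simp
  moreover have "wedge_by (\<lambda>j. \<Sum>k\<le>q. a k * \<alpha> k j) (\<lambda>K. \<omega> K + h * wedge_product \<alpha> xs K) =
      (\<lambda>K. wedge_by (\<lambda>j. \<Sum>k\<le>q. a k * \<alpha> k j) \<omega> K + (\<Sum>k\<le>q. h * (a k * wedge_by (\<alpha> k) (wedge_product \<alpha> xs) K)))"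
  proof
    fix K
    show "wedge_by (\<lambda>j. \<Sum>k\<le>q. a k * \<alpha> k j) (\<lambda>K. \<omega> K + h * wedge_product \<alpha> xs K) K =
      wedge_by (\<lambda>j. \<Sum>k\<le>q. a k * \<alpha> k j) \<omega> K + (\<Sum>k\<le>q. h * (a k * wedge_by (\<alpha> k) (wedge_product \<alpha> xs) K))"
      unfolding wedge_by_add_right wedge_by_scale_right wedge_by_combination by (simp add: sum_distrib_left)
  qed
  ultimately show ?case by simp
qed

text \<open>The factor \<open>h\<close> is the determinant of the matrix \<open>a\<close>.\<close>

lemma wedge_product_combinations:
  fixes \<alpha> \<beta> :: "nat \<Rightarrow> nat \<Rightarrow> 'a :: {idom, ring_char_0}"
  assumes "\<And>i. i \<le> q \<Longrightarrow> \<beta> i = (\<lambda>j. \<Sum>k\<le>q. a i k * \<alpha> k j)"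
  obtains h where "wedge_product \<beta> [0..<Suc q] = (\<lambda>K. h * wedge_product \<alpha> [0..<Suc q] K)"
proof -
  have "set ys \<subseteq> {..q} \<Longrightarrow> wedge_product \<beta> ys \<in> product_span \<alpha> q (length ys)" for ys
  proof (induction ys)
    case Nil
    show ?case using product_span.add_multiple[of "\<lambda>_. 0" \<alpha> q 0 "[]" 1] by (simp add: product_span.zero)
  next
    case (Cons i ys)
    then show ?case using wedge_product_span[of "wedge_product \<beta> ys" \<alpha> q "length ys" "a i"] assms[of i] by simp
  qed
  from this[of "[0..<Suc q]"] have "wedge_product \<beta> [0..<Suc q] \<in> product_span \<alpha> q (Suc q)" by force
  moreover have "\<exists>h. \<omega> = (\<lambda>K. h * wedge_product \<alpha> [0..<Suc q] K)" if "\<omega> \<in> product_span \<alpha> q (Suc q)" for \<omega>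
    using that
  proof induction
    case zero
    show ?case by (intro exI[of _ 0]) simp
  next
    case (add_multiple \<omega> xs h)
    then obtain h' where "\<omega> = (\<lambda>K. h' * wedge_product \<alpha> [0..<Suc q] K)" by blast
    moreover have "xs = [0..<Suc q]"
    proof (rule strict_sorted_equal)
      have "card (set xs) = Suc q" using add_multiple.hyps distinct_card[of xs] by (simp add: strict_sorted_iff)
      then have "set xs = {..q}" by (intro card_subset_eq add_multiple.hyps) simp_all
      then show "set xs = set [0..<Suc q]"
        by (simp only: set_upt atLeast0LessThan lessThan_Suc_atMost)
      show "sorted_wrt (<) [0..<Suc q]" by (rule sorted_wrt_upt)
      show "sorted_wrt (<) xs" by (rule add_multiple.hyps)
    qed
    ultimately have "(\<lambda>K. \<omega> K + h * wedge_product \<alpha> xs K) = (\<lambda>K. (h' + h) * wedge_product \<alpha> [0..<Suc q] K)"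
      by (simp only: distrib_right)
    then show ?case by blast
  qed
  ultimately show ?thesis using that by blast
qed

section \<open>Determinants over finite index sets\<close>

text \<open>The unknowns of the linear systems below are indexed by monomials; an arbitrary numbering
  turns them into matrices.\<close>

definition enumeration :: "'i set \<Rightarrow> nat \<Rightarrow> 'i" where
  "enumeration I = (SOME e. bij_betw e {0..<card I} I)"

lemma enumeration: "finite I \<Longrightarrow> bij_betw (enumeration I) {0..<card I} I"
  unfolding enumeration_def using ex_bij_betw_nat_finite by (rule someI_ex)

definition index_mat :: "'i set \<Rightarrow> ('i \<Rightarrow> 'i \<Rightarrow> 'a) \<Rightarrow> 'a mat" where
  "index_mat I A = mat (card I) (card I) (\<lambda>(i, j). A (enumeration I i) (enumeration I j))"

definition index_det :: "'i set \<Rightarrow> ('i \<Rightarrow> 'i \<Rightarrow> 'a :: comm_ring_1) \<Rightarrow> 'a" where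
  "index_det I A = det (index_mat I A)"

lemma index_mat_carrier: "index_mat I A \<in> carrier_mat (card I) (card I)"
  by (simp add: index_mat_def)

lemma enumeration_cases:
  assumes "finite I" "x \<in> I"
  obtains k where "k < card I" "x = enumeration I k"
  using enumeration[OF assms(1)] assms(2) unfolding bij_betw_def by (metis atLeastLessThan_iff imageE)

lemma enumeration_in: "finite I \<Longrightarrow> k < card I \<Longrightarrow> enumeration I k \<in> I"
  using enumeration unfolding bij_betw_def by (metis atLeastLessThan_iff imageI le0)

lemma enumeration_eq_iff:
  "finite I \<Longrightarrow> k < card I \<Longrightarrow> l < card I \<Longrightarrow> enumeration I k = enumeration I l \<longleftrightarrow> k = l"
  using enumeration[of I] unfolding bij_betw_def inj_on_def by (metis atLeastLessThan_iff le0)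

lemma index_mat_mult_vec:
  fixes A :: "'i \<Rightarrow> 'i \<Rightarrow> 'a :: comm_ring_1"
  assumes "finite I" "k < card I"
  shows "(index_mat I A *\<^sub>v vec (card I) (\<lambda>l. u (enumeration I l))) $ k = (\<Sum>y\<in>I. A (enumeration I k) y * u y)"
proof -
  have "(index_mat I A *\<^sub>v vec (card I) (\<lambda>l. u (enumeration I l))) $ k =
      (\<Sum>l\<in>{0..<card I}. A (enumeration I k) (enumeration I l) * u (enumeration I l))"
    using assms by (simp add: index_mat_def scalar_prod_def)
  also have "\<dots> = (\<Sum>y\<in>I. A (enumeration I k) y * u y)"
    by (rule sum.reindex_bij_betw[OF enumeration[OF assms(1)]])
  finally show ?thesis .
qed

lemma cramer_index_det:
  fixes A :: "'i \<Rightarrow> 'i \<Rightarrow> 'a :: comm_ring_1"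
  assumes I: "finite I" and eq: "\<And>x. x \<in> I \<Longrightarrow> (\<Sum>y\<in>I. A x y * u y) = b x" and z: "z \<in> I"
  shows "index_det I A * u z = index_det I (\<lambda>x y. if y = z then b x else A x y)"
proof -
  obtain k where k: "k < card I" "z = enumeration I k" using enumeration_cases[OF I z] .
  define v where "v = vec (card I) (\<lambda>l. u (enumeration I l))"
  have "det (replace_col (index_mat I A) (index_mat I A *\<^sub>v v) k) = v $ k * det (index_mat I A)"
    by (rule cramer_lemma_mat[OF index_mat_carrier _ k(1)]) (simp add: v_def)
  moreover have "replace_col (index_mat I A) (index_mat I A *\<^sub>v v) k =
      index_mat I (\<lambda>x y. if y = z then b x else A x y)"
  proof (rule eq_matI)
    fix i j assume "i < dim_row (index_mat I (\<lambda>x y. if y = z then b x else A x y))"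
      "j < dim_col (index_mat I (\<lambda>x y. if y = z then b x else A x y))"
    then have ij: "i < card I" "j < card I" by (simp_all add: index_mat_def)
    have "(index_mat I A *\<^sub>v v) $ i = b (enumeration I i)"
      unfolding v_def index_mat_mult_vec[OF I ij(1)] by (rule eq[OF enumeration_in[OF I ij(1)]])
    then show "replace_col (index_mat I A) (index_mat I A *\<^sub>v v) k $$ (i, j) =
        index_mat I (\<lambda>x y. if y = z then b x else A x y) $$ (i, j)"
      using ij k by (auto simp: replace_col_def index_mat_def enumeration_eq_iff[OF I] simp del: index_mult_mat_vec)
  qed (simp_all add: replace_col_def index_mat_def)
  ultimately show ?thesis using k by (simp add: index_det_def v_def mult.commute)
qed

lemma index_det_nonzero_imp_solvable:
  fixes A :: "'i \<Rightarrow> 'i \<Rightarrow> 'a :: field"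
  assumes I: "finite I" and "index_det I A \<noteq> 0"
  shows "\<exists>u. \<forall>x\<in>I. (\<Sum>y\<in>I. A x y * u y) = b x"
proof -
  let ?n = "card I" and ?M = "index_mat I A"
  define w where "w = vec ?n (\<lambda>l. b (enumeration I l))"
  define v where "v = (1 / det ?M) \<cdot>\<^sub>v (adj_mat ?M *\<^sub>v w)"
  have w: "w \<in> carrier_vec ?n" by (simp add: w_def)
  have adj: "adj_mat ?M \<in> carrier_mat ?n ?n" and prod: "?M * adj_mat ?M = det ?M \<cdot>\<^sub>m 1\<^sub>m ?n"
    using adj_mat[OF index_mat_carrier] by blast+
  have aw: "adj_mat ?M *\<^sub>v w \<in> carrier_vec ?n" using adj w by simp
  have "?M *\<^sub>v (adj_mat ?M *\<^sub>v w) = (?M * adj_mat ?M) *\<^sub>v w"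
    using assoc_mult_mat_vec[OF index_mat_carrier adj w] by simp
  then have "?M *\<^sub>v (adj_mat ?M *\<^sub>v w) = det ?M \<cdot>\<^sub>v w"
    unfolding prod using w by auto
  then have Mv: "?M *\<^sub>v v = w"
    unfolding v_def using mult_mat_vec[OF index_mat_carrier aw] assms(2) w
    by (simp add: index_det_def smult_smult_assoc)
  have v: "v \<in> carrier_vec ?n" using aw by (simp add: v_def)
  define u where "u = (\<lambda>x. v $ (inv_into {0..<?n} (enumeration I) x))"
  have "u (enumeration I l) = v $ l" if "l < ?n" for l
    unfolding u_def using that enumeration[OF I] by (simp add: bij_betw_def)
  then have vu: "v = vec ?n (\<lambda>l. u (enumeration I l))" using v by (intro eq_vecI) auto
  show ?thesis
  proof (intro exI[of _ u] ballI)
    fix x assume "x \<in> I"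
    then obtain k where k: "k < ?n" "x = enumeration I k" using enumeration_cases[OF I] by blast
    show "(\<Sum>y\<in>I. A x y * u y) = b x"
      using index_mat_mult_vec[OF I k(1), of A u] Mv k unfolding vu[symmetric] by (simp add: w_def)
  qed
qed

lemma index_det_diagonal:
  fixes A :: "'i \<Rightarrow> 'i \<Rightarrow> 'a :: idom"
  assumes I: "finite I" and "\<And>x y. x \<in> I \<Longrightarrow> y \<in> I \<Longrightarrow> x \<noteq> y \<Longrightarrow> A x y = 0" "\<And>x. x \<in> I \<Longrightarrow> A x x \<noteq> 0"
  shows "index_det I A \<noteq> 0"
proof -
  have "upper_triangular (index_mat I A)"
    unfolding index_mat_def using assms enumeration_in[OF I] enumeration_eq_iff[OF I] by auto
  then have "index_det I A = prod_list (diag_mat (index_mat I A))"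
    unfolding index_det_def using index_mat_carrier by (rule det_upper_triangular)
  moreover have "0 \<notin> set (diag_mat (index_mat I A))"
    unfolding diag_mat_def index_mat_def using assms(3) enumeration_in[OF I] by auto
  ultimately show ?thesis by (simp add: prod_list_zero_iff)
qed

text \<open>Every term of the Leibniz formula contains exactly one factor from each column.\<close>

lemma homogeneous_fun_index_det:
  assumes I: "finite I" and A: "\<And>x y. x \<in> I \<Longrightarrow> y \<in> I \<Longrightarrow> homogeneous_fun (n y) (\<lambda>v. A v x y)"
  shows "homogeneous_fun (\<Sum>y\<in>I. n y) (\<lambda>v. index_det I (A v))"
proof -
  let ?n = "card I" and ?e = "enumeration I"
  have det: "index_det I (A v) =
      (\<Sum>p\<in>{p. p permutes {0..<?n}}. signof p * (\<Prod>i\<in>{0..<?n}. A v (?e i) (?e (p i))))" for v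
    unfolding index_det_def det_def'[OF index_mat_carrier]
    by (intro sum.cong refl arg_cong2[of _ _ _ _ times] prod.cong)
      (auto simp: index_mat_def permutes_in_image)
  show ?thesis
    unfolding det
  proof (intro homogeneous_fun_sum homogeneous_fun_cmult)
    fix p assume "p \<in> {p. p permutes {0..<?n}}"
    then have p: "p permutes {0..<?n}" by simp
    have "(\<Sum>i\<in>{0..<?n}. n (?e (p i))) = (\<Sum>i\<in>{0..<?n}. n (?e i))"
      using sum.permute[OF p, of "\<lambda>i. n (?e i)"] by (simp add: comp_def)
    also have "\<dots> = (\<Sum>y\<in>I. n y)" by (rule sum.reindex_bij_betw[OF enumeration[OF I]])
    finally have deg: "(\<Sum>i\<in>{0..<?n}. n (?e (p i))) = (\<Sum>y\<in>I. n y)" .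
    have "homogeneous_fun (\<Sum>i\<in>{0..<?n}. n (?e (p i))) (\<lambda>v. \<Prod>i\<in>{0..<?n}. A v (?e i) (?e (p i)))"
      using enumeration_in[OF I] permutes_in_image[OF p] by (intro homogeneous_fun_prod A) auto
    then show "homogeneous_fun (\<Sum>y\<in>I. n y) (\<lambda>v. \<Prod>i\<in>{0..<?n}. A v (?e i) (?e (p i)))"
      unfolding deg .
  qed
qed

section \<open>Polynomials dependent on a tuple\<close>

lemma form_map_prod:
  fixes f :: "'i \<Rightarrow> 'v :: complex_vector \<Rightarrow> polynomial"
  assumes "finite S" "\<And>i. i \<in> S \<Longrightarrow> form_map (n i) (f i)"
  shows "form_map (\<Sum>i\<in>S. n i) (\<lambda>c. \<Prod>i\<in>S. f i c)"
  using assms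
proof (induction S rule: finite_induct)
  case empty
  show ?case by (simp add: form_map.const)
next
  case (insert i S)
  have "form_map (n i + (\<Sum>i\<in>S. n i)) (\<lambda>c. f i c * (\<Prod>i\<in>S. f i c))"
    using insert by (intro form_map_bilinear[where B = times] clinear_mult_left clinear_mult_right) auto
  then show ?case using insert by simp
qed

lemma jacobian_form_cong: "(\<And>i. i \<in> set xs \<Longrightarrow> F i = G i) \<Longrightarrow> jacobian_form F xs = jacobian_form G xs"
  by (induction xs) simp_all

lemma rho_cong: "(\<And>i. i \<le> q \<Longrightarrow> F i = G i) \<Longrightarrow> rho r q F = rho r q G"
  unfolding rho_eq by (rule arg_cong[of _ _ "contract_radial r"], rule jacobian_form_cong) auto

text \<open>Hence tuples with a zero entry, which are not points of the product of projective spaces,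
  contribute nothing to the image.\<close>

lemma rho_zero_entry:
  assumes "i \<le> q" "F i = 0" shows "rho r q F = 0"
proof -
  have "i \<in> set xs \<Longrightarrow> jacobian_form F xs = (\<lambda>_. 0)" for xs
  proof (induction xs)
    case (Cons a xs)
    show ?case
    proof (cases "a = i")
      case True
      have "grad (F i) = (\<lambda>_. 0)" by (simp add: grad_def assms(2))
      then show ?thesis by (simp add: True wedge_by_def fun_eq_iff)
    next
      case False
      then show ?thesis using Cons by simp
    qed
  qed simp
  from this[of "[0..<Suc q]"] have "jacobian_form F [0..<Suc q] = (\<lambda>_. 0)" using assms(1) by force
  then show ?thesis unfolding rho_eq by (simp add: contract_radial_eq fun_eq_iff)
qed

text \<open>\<open>dG\<close> lies in the module spanned by \<open>dF\<^sub>0, \<dots>, dF\<^sub>q\<close>. The chain rule for the elements of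
  \<open>\<complex>[F\<^sub>0, \<dots>, F\<^sub>q]\<close> is contained in the closure properties below.\<close>

definition gradient_combination :: "(nat \<Rightarrow> polynomial) \<Rightarrow> nat \<Rightarrow> polynomial \<Rightarrow> bool" where
  "gradient_combination F q G \<longleftrightarrow> (\<exists>a. grad G = (\<lambda>j. \<Sum>k\<le>q. a k * grad (F k) j))"

lemma gradient_combination_self:
  assumes "i \<le> q" shows "gradient_combination F q (F i)"
  unfolding gradient_combination_def
  using assms by (intro exI[of _ "\<lambda>k. if k = i then 1 else 0"]) (simp add: fun_eq_iff if_distrib[of "\<lambda>x. x * _"] cong: if_cong)

lemma gradient_combination_one: "gradient_combination F q 1"
  unfolding gradient_combination_def by (intro exI[of _ "\<lambda>_. 0"]) (simp add: grad_def)

lemma gradient_combination_mult: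
  assumes "gradient_combination F q G" "gradient_combination F q H"
  shows "gradient_combination F q (G * H)"
proof -
  obtain a b where "grad G = (\<lambda>j. \<Sum>k\<le>q. a k * grad (F k) j)" "grad H = (\<lambda>j. \<Sum>k\<le>q. b k * grad (F k) j)"
    using assms unfolding gradient_combination_def by blast
  then have G: "\<And>j. partial_deriv j G = (\<Sum>k\<le>q. a k * grad (F k) j)"
    and H: "\<And>j. partial_deriv j H = (\<Sum>k\<le>q. b k * grad (F k) j)"
    unfolding grad_def by meson+
  have "grad (G * H) = (\<lambda>j. \<Sum>k\<le>q. (H * a k + G * b k) * grad (F k) j)"
  proof
    fix j
    have "grad (G * H) j = H * (\<Sum>k\<le>q. a k * grad (F k) j) + G * (\<Sum>k\<le>q. b k * grad (F k) j)"
      unfolding grad_def[of "G * H"] partial_deriv_mult G H by (simp add: mult.commute)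
    then show "grad (G * H) j = (\<Sum>k\<le>q. (H * a k + G * b k) * grad (F k) j)"
      by (simp add: sum_distrib_left sum.distrib distrib_right mult.assoc)
  qed
  then show ?thesis
    unfolding gradient_combination_def by (rule exI[of _ "\<lambda>k. H * a k + G * b k"])
qed

lemma gradient_combination_prod:
  "(\<And>i. i \<in> S \<Longrightarrow> gradient_combination F q (f i)) \<Longrightarrow> gradient_combination F q (\<Prod>i\<in>S. f i)"
  by (induction S rule: infinite_finite_induct)
    (auto intro: gradient_combination_one gradient_combination_mult)

lemma gradient_combination_power: "gradient_combination F q G \<Longrightarrow> gradient_combination F q (G ^ k)"
  by (induction k) (auto intro: gradient_combination_one gradient_combination_mult)

lemma gradient_combination_add:
  assumes "gradient_combination F q G" "gradient_combination F q H"
  shows "gradient_combination F q (G + H)"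
proof -
  obtain a b where "grad G = (\<lambda>j. \<Sum>k\<le>q. a k * grad (F k) j)" "grad H = (\<lambda>j. \<Sum>k\<le>q. b k * grad (F k) j)"
    using assms unfolding gradient_combination_def by blast
  then have "grad (G + H) = (\<lambda>j. \<Sum>k\<le>q. (a k + b k) * grad (F k) j)"
    unfolding clinear_add[OF clinear_grad] by (simp add: fun_eq_iff distrib_right sum.distrib)
  then show ?thesis
    unfolding gradient_combination_def by (rule exI[of _ "\<lambda>k. a k + b k"])
qed

lemma gradient_combination_scale:
  assumes "gradient_combination F q G" shows "gradient_combination F q (scaleC c G)"
proof -
  obtain a where "grad G = (\<lambda>j. \<Sum>k\<le>q. a k * grad (F k) j)"
    using assms unfolding gradient_combination_def by blast
  then have "grad (scaleC c G) = (\<lambda>j. \<Sum>k\<le>q. (Poly_Mapping.single 0 c * a k) * grad (F k) j)"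
    unfolding clinear_scale[OF clinear_grad] by (simp add: fun_eq_iff scaleC_eq_mult sum_distrib_left mult.assoc)
  then show ?thesis
    unfolding gradient_combination_def by (rule exI[of _ "\<lambda>k. Poly_Mapping.single 0 c * a k"])
qed

lemma gradient_combination_sum:
  "(\<And>i. i \<in> S \<Longrightarrow> gradient_combination F q (f i)) \<Longrightarrow> gradient_combination F q (\<Sum>i\<in>S. f i)"
proof (induction S rule: infinite_finite_induct)
  case (insert i S)
  then show ?case by (auto intro: gradient_combination_add)
qed (use gradient_combination_scale[OF gradient_combination_one, of F q 0] in simp_all)

lemma gradient_combination_wedge:
  assumes "gradient_combination F q G"
  shows "wedge_by (grad G) (jacobian_form F [0..<Suc q]) = (\<lambda>_. 0)"
proof -
  obtain a where a: "grad G = (\<lambda>j. \<Sum>k\<le>q. a k * grad (F k) j)"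
    using assms unfolding gradient_combination_def by blast
  have "wedge_by (grad (F k)) (jacobian_form F [0..<Suc q]) = (\<lambda>_. 0)" if "k \<le> q" for k
    unfolding jacobian_form_eq_wedge_product using that
    by (intro wedge_by_wedge_product_member[where \<alpha> = "\<lambda>i. grad (F i)"]) auto
  then show ?thesis unfolding a wedge_by_combination by (simp add: fun_eq_iff)
qed

text \<open>Replacing the entries of a tuple by dependent ones of the same degrees multiplies the
  Jacobian form by a polynomial, and this polynomial has degree \<open>0\<close>.\<close>

lemma rho_of_gradient_combinations:
  assumes F: "\<And>i. i \<le> q \<Longrightarrow> F i \<in> homogeneous_polys r (d i)"
    and G: "\<And>i. i \<le> q \<Longrightarrow> G i \<in> homogeneous_polys r (d i)"
    and comb: "\<And>i. i \<le> q \<Longrightarrow> gradient_combination F q (G i)"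
  obtains c where "rho r q G = scaleC c (rho r q F)"
proof -
  let ?xs = "[0..<Suc q]"
  have "\<exists>a. \<forall>i\<le>q. grad (G i) = (\<lambda>j. \<Sum>k\<le>q. a i k * grad (F k) j)"
    using comb unfolding gradient_combination_def by metis
  then obtain a where a: "\<And>i. i \<le> q \<Longrightarrow> grad (G i) = (\<lambda>j. \<Sum>k\<le>q. a i k * grad (F k) j)" by blast
  obtain h where h: "jacobian_form G ?xs = (\<lambda>K. h * jacobian_form F ?xs K)"
    unfolding jacobian_form_eq_wedge_product
    by (rule wedge_product_combinations[of q "\<lambda>i. grad (G i)" a "\<lambda>i. grad (F i)", OF a])
  have hom: "jacobian_form H ?xs K \<in> shifted_homogeneous r (card K) (\<Sum>i\<leftarrow>?xs. d i)"
    if "\<And>i. i \<le> q \<Longrightarrow> H i \<in> homogeneous_polys r (d i)" for H K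
    using that by (intro jacobian_form_homogeneous) auto
  have "jacobian_form G ?xs K = scaleC (Poly_Mapping.lookup h 0) (jacobian_form F ?xs K)" for K
    using homogeneous_quotient_is_constant[OF hom[OF F], of h K] hom[OF G, of K] unfolding h by blast
  then have "jacobian_form G ?xs = scaleC (Poly_Mapping.lookup h 0) (jacobian_form F ?xs)" by (simp add: fun_eq_iff)
  then have "rho r q G = scaleC (Poly_Mapping.lookup h 0) (rho r q F)"
    unfolding rho_eq by (simp only: clinear_scale[OF clinear_contract_radial])
  then show ?thesis by (rule that)
qed

section \<open>Monomials\<close>

definition monomials :: "nat \<Rightarrow> nat \<Rightarrow> (nat \<Rightarrow>\<^sub>0 nat) set" where
  "monomials r e = {m. Poly_Mapping.keys m \<subseteq> {..r} \<and> (\<Sum>i\<le>r. Poly_Mapping.lookup m i) = e}"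

lemma finite_monomials: "finite (monomials r e)"
proof (rule finite_imageD)
  have "Poly_Mapping.lookup ` monomials r e \<subseteq> {f. \<forall>i. (i \<in> {..r} \<longrightarrow> f i \<in> {..e}) \<and> (i \<notin> {..r} \<longrightarrow> f i = 0)}"
  proof (intro subsetI CollectI allI conjI impI)
    fix f i assume "f \<in> Poly_Mapping.lookup ` monomials r e"
    then obtain m where m: "f = Poly_Mapping.lookup m" "m \<in> monomials r e" by blast
    show "f i \<in> {..e}" if "i \<in> {..r}"
      using m member_le_sum[OF that, of "Poly_Mapping.lookup m"] unfolding monomials_def by simp
    show "f i = 0" if "i \<notin> {..r}" using m that unfolding monomials_def by (auto simp: in_keys_iff)
  qed
  then show "finite (Poly_Mapping.lookup ` monomials r e)"
    by (rule finite_subset) (intro finite_set_of_finite_funs finite_atMost)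
  show "inj_on Poly_Mapping.lookup (monomials r e)"
    by (rule inj_onI) (rule poly_mapping_eq_iff[THEN iffD2])
qed

lemma homogeneous_polys_iff: "p \<in> homogeneous_polys r e \<longleftrightarrow> Poly_Mapping.keys p \<subseteq> monomials r e"
  unfolding homogeneous_polys_def monomials_def by blast

lemma single_homogeneous: "m \<in> monomials r e \<Longrightarrow> Poly_Mapping.single m a \<in> homogeneous_polys r e"
  unfolding homogeneous_polys_iff by simp

lemma homogeneous_polys_zero: "0 \<in> homogeneous_polys r e"
  by (simp add: homogeneous_polys_iff)

lemma homogeneous_polys_add: "p \<in> homogeneous_polys r e \<Longrightarrow> p' \<in> homogeneous_polys r e \<Longrightarrow> p + p' \<in> homogeneous_polys r e"
  unfolding homogeneous_polys_eq_shifted by (rule shifted_homogeneous_add)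

lemma homogeneous_polys_scale: "p \<in> homogeneous_polys r e \<Longrightarrow> scaleC c p \<in> homogeneous_polys r e"
  unfolding homogeneous_polys_eq_shifted by (rule shifted_homogeneous_scale)

lemma homogeneous_polys_sum: "(\<And>i. i \<in> I \<Longrightarrow> f i \<in> homogeneous_polys r e) \<Longrightarrow> (\<Sum>i\<in>I. f i) \<in> homogeneous_polys r e"
  unfolding homogeneous_polys_eq_shifted by (rule shifted_homogeneous_sum)

text \<open>The covector of \<open>m\<close> gives the logarithmic differential: \<open>dx\<^sup>m = x\<^sup>m \<Sum>\<^sub>j m\<^sub>j dx\<^sub>j / x\<^sub>j\<close>.\<close>

definition exponent_covector :: "(nat \<Rightarrow>\<^sub>0 nat) \<Rightarrow> nat \<Rightarrow> complex" where
  "exponent_covector m j = of_nat (Poly_Mapping.lookup m j)"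

text \<open>The product of the \<open>x\<^sub>k\<close> with \<open>k \<in> K\<close>. Multiplying the coefficient of a form at \<open>K\<close> by it
  replaces each \<open>dx\<^sub>k\<close> by \<open>dx\<^sub>k / x\<^sub>k\<close> and so avoids division by variables.\<close>

definition support_monomial :: "nat set \<Rightarrow> polynomial" where
  "support_monomial K = Poly_Mapping.single (\<Sum>k\<in>K. Poly_Mapping.single k 1) 1"

lemma support_monomial_remove:
  assumes "finite K" "j \<in> K"
  shows "support_monomial K = Var j * support_monomial (K - {j})"
  unfolding support_monomial_def Var_def mult_single by (subst sum.remove[OF assms]) simp

lemma Var_mult_partial_deriv_single:
  "Var j * partial_deriv j (Poly_Mapping.single m 1) = Poly_Mapping.single m (exponent_covector m j)"
  by (rule poly_mapping_eqI) (auto simp: Var_mult_partial_deriv lookup_single when_def exponent_covector_def)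

lemma position_sign_mult_single:
  "position_sign j K * Poly_Mapping.single s c = Poly_Mapping.single s (position_sign j K * c)" for c :: complex
  unfolding position_sign_def by (cases "even (card {l \<in> K. l < j})") (simp_all add: single_uminus)

lemma single_sum: "Poly_Mapping.single s (\<Sum>j\<in>S. f j) = (\<Sum>j\<in>S. Poly_Mapping.single s (f j))"
  by (induction S rule: infinite_finite_induct) (simp_all add: single_add)

lemma wedge_by_grad_monomial:
  assumes "\<And>K. support_monomial K * \<omega> K = Poly_Mapping.single s (c K)"
  shows "support_monomial K * wedge_by (grad (Poly_Mapping.single m 1)) \<omega> K =
    Poly_Mapping.single (m + s) (wedge_by (exponent_covector m) c K)"
proof (cases "finite K")
  case True
  have "support_monomial K * wedge_by (grad (Poly_Mapping.single m 1)) \<omega> K =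
      (\<Sum>j\<in>K. position_sign j K * ((Var j * partial_deriv j (Poly_Mapping.single m 1)) *
        (support_monomial (K - {j}) * \<omega> (K - {j}))))"
    unfolding wedge_by_def grad_def sum_distrib_left
    by (intro sum.cong refl) (simp add: support_monomial_remove[OF True] mult_ac)
  also have "\<dots> = (\<Sum>j\<in>K. Poly_Mapping.single (m + s) (position_sign j K * exponent_covector m j * c (K - {j})))"
    unfolding Var_mult_partial_deriv_single assms mult_single position_sign_mult_single by (simp add: mult.assoc)
  also have "\<dots> = Poly_Mapping.single (m + s) (wedge_by (exponent_covector m) c K)"
    unfolding wedge_by_def single_sum ..
  finally show ?thesis .
qed (simp add: wedge_by_infinite)

text \<open>In the basis \<open>dx\<^sub>k / x\<^sub>k\<close>, the Jacobian form of monomials is the product of the monomials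
  times a constant form, namely the product of their exponent covectors.\<close>

lemma jacobian_form_monomials:
  "support_monomial K * jacobian_form (\<lambda>i. Poly_Mapping.single (v i) 1) xs K =
    Poly_Mapping.single (\<Sum>i\<leftarrow>xs. v i) (wedge_product (\<lambda>i. exponent_covector (v i)) xs K)"
proof (induction xs arbitrary: K)
  case Nil
  show ?case by (simp add: unit_form_def support_monomial_def)
next
  case (Cons i xs)
  show ?case unfolding jacobian_form_simps wedge_product_simps list.map sum_list.Cons
    by (rule wedge_by_grad_monomial) (rule Cons.IH)
qed

section \<open>Pivotal and free monomials\<close>

locale rational_form_data =
  fixes r q :: nat and d :: "nat \<Rightarrow> nat"
  assumes q_le: "q + 2 \<le> r" and d_pos: "\<And>i. i \<le> q \<Longrightarrow> d i \<ge> 1"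
begin

definition pivot :: "nat \<Rightarrow> nat \<Rightarrow>\<^sub>0 nat" where
  "pivot i = Poly_Mapping.single i 1 + Poly_Mapping.single (Suc q) (d i - 1)"

definition params :: "(nat \<Rightarrow> polynomial) set" where
  "params = {F. \<forall>i\<le>q. F i \<in> homogeneous_polys r (d i)}"

definition pivot_tuple :: "nat \<Rightarrow> polynomial" where
  "pivot_tuple i = Poly_Mapping.single (pivot i) 1"

text \<open>The exponent of \<open>m\<close> is the combination of the pivots whose coefficients are its own entries
  at \<open>0, \<dots>, q\<close>. Any combination of the pivots has this property, because the pivot \<open>i\<close> has entry
  \<open>1\<close> at \<open>i\<close> and \<open>0\<close> at the other indices up to \<open>q\<close>.\<close>

definition is_pivotal :: "(nat \<Rightarrow>\<^sub>0 nat) \<Rightarrow> bool" where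
  "is_pivotal m \<longleftrightarrow> Poly_Mapping.keys m \<subseteq> {..Suc q} \<and>
     Poly_Mapping.lookup m (Suc q) = (\<Sum>i\<le>q. Poly_Mapping.lookup m i * (d i - 1))"

text \<open>A pivotal monomial \<open>\<alpha>\<close> serves as a multi-index, through its entries at \<open>0, \<dots>, q\<close>. In this
  way the rows and columns of the matrix that compares \<open>\<complex>[F\<^sub>0, \<dots>, F\<^sub>q]\<close> with the pivotal monomials
  have the same index set.\<close>

definition power_product :: "(nat \<Rightarrow> polynomial) \<Rightarrow> (nat \<Rightarrow>\<^sub>0 nat) \<Rightarrow> polynomial" where
  "power_product F \<alpha> = (\<Prod>i\<le>q. F i ^ Poly_Mapping.lookup \<alpha> i)"

definition pivotal_monomials where "pivotal_monomials e = {m \<in> monomials r e. is_pivotal m}"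
definition free_monomials where "free_monomials e = {m \<in> monomials r e. \<not> is_pivotal m}"

lemma lookup_pivot: "Poly_Mapping.lookup (pivot i) j =
    (if j = i then 1 else 0) + (if j = Suc q then d i - 1 else 0)"
  by (simp add: pivot_def lookup_add lookup_single when_def eq_commute)

lemma finite_pivotal_monomials: "finite (pivotal_monomials e)" and finite_free_monomials: "finite (free_monomials e)"
  unfolding pivotal_monomials_def free_monomials_def using finite_monomials by auto

lemma sum_upto_Suc_q:
  assumes "\<And>j. Suc q < j \<Longrightarrow> f j = 0"
  shows "(\<Sum>j\<le>r. f j) = (\<Sum>j\<le>q. f j) + f (Suc q)"
proof -
  have "(\<Sum>j\<le>r. f j) = (\<Sum>j\<le>Suc q. f j)"
    using q_le assms by (intro sum.mono_neutral_right) auto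
  then show ?thesis by simp
qed

lemma pivot_in_pivotal_monomials: assumes "i \<le> q" shows "pivot i \<in> pivotal_monomials (d i)"
proof -
  have keys: "Poly_Mapping.keys (pivot i) \<subseteq> {..Suc q}"
    using assms by (auto simp: in_keys_iff lookup_pivot split: if_splits)
  have "(\<Sum>j\<le>r. Poly_Mapping.lookup (pivot i) j) = (\<Sum>j\<le>q. Poly_Mapping.lookup (pivot i) j) + Poly_Mapping.lookup (pivot i) (Suc q)"
    by (rule sum_upto_Suc_q) (use assms in \<open>simp add: lookup_pivot\<close>)
  also have "(\<Sum>j\<le>q. Poly_Mapping.lookup (pivot i) j) = (\<Sum>j\<le>q. if j = i then 1 else 0)"
    by (intro sum.cong) (auto simp: lookup_pivot)
  also have "\<dots> + Poly_Mapping.lookup (pivot i) (Suc q) = d i"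
    using assms d_pos[OF assms] by (simp add: lookup_pivot)
  finally have "(\<Sum>j\<le>r. Poly_Mapping.lookup (pivot i) j) = d i" .
  moreover have "(\<Sum>j\<le>q. Poly_Mapping.lookup (pivot i) j * (d j - 1)) = (\<Sum>j\<le>q. if j = i then d i - 1 else 0)"
    by (intro sum.cong) (auto simp: lookup_pivot)
  moreover have "Poly_Mapping.keys (pivot i) \<subseteq> {..r}"
    using keys q_le by (auto dest!: subsetD)
  ultimately show ?thesis
    using keys assms unfolding pivotal_monomials_def monomials_def is_pivotal_def by (simp add: lookup_pivot)
qed

lemma pivot_tuple_in_params: "pivot_tuple \<in> params"
  using pivot_in_pivotal_monomials single_homogeneous unfolding params_def pivot_tuple_def pivotal_monomials_def by blast

lemma power_product_homogeneous:
  assumes "F \<in> params" "\<alpha> \<in> pivotal_monomials e"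
  shows "power_product F \<alpha> \<in> homogeneous_polys r e"
proof -
  have \<alpha>: "Poly_Mapping.keys \<alpha> \<subseteq> {..Suc q}" "(\<Sum>j\<le>r. Poly_Mapping.lookup \<alpha> j) = e"
    "Poly_Mapping.lookup \<alpha> (Suc q) = (\<Sum>i\<le>q. Poly_Mapping.lookup \<alpha> i * (d i - 1))"
    using assms(2) unfolding pivotal_monomials_def is_pivotal_def monomials_def by auto
  have "(\<Sum>j\<le>r. Poly_Mapping.lookup \<alpha> j) = (\<Sum>j\<le>q. Poly_Mapping.lookup \<alpha> j) + Poly_Mapping.lookup \<alpha> (Suc q)"
  proof (rule sum_upto_Suc_q)
    fix j assume "Suc q < j"
    then have "j \<notin> Poly_Mapping.keys \<alpha>" using \<alpha>(1) by auto
    then show "Poly_Mapping.lookup \<alpha> j = 0" by (simp add: in_keys_iff)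
  qed
  also have "\<dots> = (\<Sum>i\<le>q. Poly_Mapping.lookup \<alpha> i * d i)"
    unfolding \<alpha>(3) sum.distrib[symmetric]
  proof (intro sum.cong refl)
    fix i assume "i \<in> {..q}"
    then have "d i = Suc (d i - 1)" using d_pos[of i] by simp
    then show "Poly_Mapping.lookup \<alpha> i + Poly_Mapping.lookup \<alpha> i * (d i - 1) = Poly_Mapping.lookup \<alpha> i * d i"
      by (metis mult_Suc_right)
  qed
  finally have e: "e = (\<Sum>i\<le>q. Poly_Mapping.lookup \<alpha> i * d i)" using \<alpha>(2) by simp
  show ?thesis
    unfolding power_product_def e using assms(1)
    by (intro homogeneous_polys_prod homogeneous_polys_power) (auto simp: params_def)
qed

lemma power_product_pivot_tuple:
  assumes "is_pivotal \<alpha>" shows "power_product pivot_tuple \<alpha> = Poly_Mapping.single \<alpha> 1"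
proof -
  have pow: "\<exists>s. pivot_tuple i ^ k = Poly_Mapping.single s 1 \<and> (\<forall>j. Poly_Mapping.lookup s j = k * Poly_Mapping.lookup (pivot i) j)"
    for i k
  proof (induction k)
    case 0
    show ?case by (intro exI[of _ 0]) simp
  next
    case (Suc k)
    then obtain s where "pivot_tuple i ^ k = Poly_Mapping.single s 1" "\<forall>j. Poly_Mapping.lookup s j = k * Poly_Mapping.lookup (pivot i) j" by blast
    then show ?case
      by (intro exI[of _ "pivot i + s"]) (simp add: pivot_tuple_def mult_single lookup_add)
  qed
  have "\<exists>s. (\<Prod>i\<in>S. pivot_tuple i ^ Poly_Mapping.lookup \<alpha> i) = Poly_Mapping.single s 1 \<and>
      (\<forall>j. Poly_Mapping.lookup s j = (\<Sum>i\<in>S. Poly_Mapping.lookup \<alpha> i * Poly_Mapping.lookup (pivot i) j))"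
    if "finite S" for S
    using that
  proof (induction S rule: finite_induct)
    case empty
    show ?case by (intro exI[of _ 0]) simp
  next
    case (insert i S)
    obtain s where s: "(\<Prod>i\<in>S. pivot_tuple i ^ Poly_Mapping.lookup \<alpha> i) = Poly_Mapping.single s 1"
      "\<forall>j. Poly_Mapping.lookup s j = (\<Sum>i\<in>S. Poly_Mapping.lookup \<alpha> i * Poly_Mapping.lookup (pivot i) j)" using insert.IH by blast
    obtain t where t: "pivot_tuple i ^ Poly_Mapping.lookup \<alpha> i = Poly_Mapping.single t 1"
      "\<forall>j. Poly_Mapping.lookup t j = Poly_Mapping.lookup \<alpha> i * Poly_Mapping.lookup (pivot i) j" using pow by blast
    show ?case
      using insert s t by (intro exI[of _ "t + s"]) (simp add: mult_single lookup_add)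
  qed
  from this[of "{..q}"] obtain s where s: "power_product pivot_tuple \<alpha> = Poly_Mapping.single s 1"
    "\<And>j. Poly_Mapping.lookup s j = (\<Sum>i\<le>q. Poly_Mapping.lookup \<alpha> i * Poly_Mapping.lookup (pivot i) j)"
    unfolding power_product_def by auto
  have "Poly_Mapping.lookup s j = Poly_Mapping.lookup \<alpha> j" for j
  proof (cases "j \<le> q")
    case True
    have "Poly_Mapping.lookup s j = (\<Sum>i\<le>q. if i = j then Poly_Mapping.lookup \<alpha> j else 0)"
      unfolding s(2) using True by (intro sum.cong) (auto simp: lookup_pivot)
    then show ?thesis using True by simp
  next
    case False
    have "Poly_Mapping.lookup s j = (\<Sum>i\<le>q. if j = Suc q then Poly_Mapping.lookup \<alpha> i * (d i - 1) else 0)"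
      unfolding s(2) using False by (intro sum.cong) (auto simp: lookup_pivot)
    moreover have "Poly_Mapping.lookup \<alpha> j = 0" if "j \<noteq> Suc q"
    proof -
      have "j \<notin> Poly_Mapping.keys \<alpha>" using assms that False unfolding is_pivotal_def by auto
      then show ?thesis by (simp add: in_keys_iff)
    qed
    ultimately show ?thesis using assms unfolding is_pivotal_def by (cases "j = Suc q") simp_all
  qed
  then have "s = \<alpha>" by (simp add: poly_mapping_eq_iff fun_eq_iff)
  then show ?thesis using s(1) by simp
qed

section \<open>The linear system at the tuple of pivots\<close>

text \<open>What remains of the exponent of \<open>m\<close> after subtracting the combination of pivots that agrees
  with it at \<open>0, \<dots>, q\<close>. In the product with all the pivot covectors only this part matters.\<close>

definition off_pivot_part :: "(nat \<Rightarrow>\<^sub>0 nat) \<Rightarrow> nat \<Rightarrow> complex" where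
  "off_pivot_part m j = exponent_covector m j -
     (\<Sum>i\<le>q. of_nat (Poly_Mapping.lookup m i) * exponent_covector (pivot i) j)"

lemma off_pivot_part_zero: assumes "j \<le> q" shows "off_pivot_part m j = 0"
proof -
  have "(\<Sum>i\<le>q. of_nat (Poly_Mapping.lookup m i) * exponent_covector (pivot i) j) =
      (\<Sum>i\<le>q. if i = j then exponent_covector m j else 0)"
    using assms by (intro sum.cong) (auto simp: exponent_covector_def lookup_pivot)
  then show ?thesis using assms by (simp add: off_pivot_part_def)
qed

text \<open>A free monomial is not even a rational combination of the pivots.\<close>

lemma off_pivot_part_nonzero:
  assumes "\<not> is_pivotal m"
  obtains j where "q < j" "off_pivot_part m j \<noteq> 0"
proof (rule ccontr)
  assume "\<not> thesis"
  then have zero: "\<And>j. q < j \<Longrightarrow> off_pivot_part m j = 0" using that by blast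
  have "Poly_Mapping.lookup m j = 0" if "j > Suc q" for j
  proof -
    have "(\<Sum>i\<le>q. of_nat (Poly_Mapping.lookup m i) * exponent_covector (pivot i) j) = 0"
      using that by (intro sum.neutral) (auto simp: exponent_covector_def lookup_pivot)
    then show ?thesis using zero[of j] that by (simp add: off_pivot_part_def exponent_covector_def)
  qed
  then have "Poly_Mapping.keys m \<subseteq> {..Suc q}" by (auto simp: in_keys_iff not_le[symmetric])
  moreover have "Poly_Mapping.lookup m (Suc q) = (\<Sum>i\<le>q. Poly_Mapping.lookup m i * (d i - 1))"
  proof -
    have "(\<Sum>i\<le>q. of_nat (Poly_Mapping.lookup m i) * exponent_covector (pivot i) (Suc q)) =
        of_nat (\<Sum>i\<le>q. Poly_Mapping.lookup m i * (d i - 1))"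
      unfolding of_nat_sum by (intro sum.cong) (auto simp: exponent_covector_def lookup_pivot)
    then have "(of_nat (Poly_Mapping.lookup m (Suc q)) :: complex) = of_nat (\<Sum>i\<le>q. Poly_Mapping.lookup m i * (d i - 1))"
      using zero[of "Suc q"] by (simp add: off_pivot_part_def exponent_covector_def)
    then show ?thesis by (simp only: of_nat_eq_iff)
  qed
  ultimately show False using assms unfolding is_pivotal_def by blast
qed

definition pivot_form :: "nat set \<Rightarrow> complex" where
  "pivot_form = wedge_product (\<lambda>i. exponent_covector (pivot i)) [0..<Suc q]"

text \<open>On the indices up to \<open>q\<close> the pivot covectors are the standard basis.\<close>

lemma pivot_form_atMost: "pivot_form {..q} = 1"
proof -
  \<comment> \<open>In the product of the last \<open>k\<close> covectors, the first one can only contribute its own index.\<close>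
  have "k \<le> Suc q \<Longrightarrow> wedge_product (\<lambda>i. exponent_covector (pivot i)) [Suc q - k..<Suc q] {Suc q - k..q} = 1" for k
  proof (induction k)
    case (Suc k)
    define s where "s = Suc q - Suc k"
    have s: "s \<le> q" "Suc q - k = Suc s" using Suc.prems by (auto simp: s_def)
    have upt: "[s..<Suc q] = s # [Suc s..<Suc q]" using s(1) by (simp add: upt_conv_Cons)
    have IH: "wedge_product (\<lambda>i. exponent_covector (pivot i)) [Suc s..<Suc q] {Suc s..q} = 1"
      using Suc unfolding s by simp
    have sets: "{s..q} - {s} = {Suc s..q}" "{l \<in> {s..q}. l < s} = {}" using s(1) by auto
    have "wedge_product (\<lambda>i. exponent_covector (pivot i)) [s..<Suc q] {s..q} =
        (\<Sum>j\<in>{s..q}. if j = s then 1 else 0)"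
      unfolding upt wedge_product_simps wedge_by_def
    proof (intro sum.cong refl)
      fix j assume j: "j \<in> {s..q}"
      show "position_sign j {s..q} * exponent_covector (pivot s) j *
          wedge_product (\<lambda>i. exponent_covector (pivot i)) [Suc s..<Suc q] ({s..q} - {j}) = (if j = s then 1 else 0)"
      proof (cases "j = s")
        case True
        moreover have "position_sign s {s..q} = (1 :: complex)" unfolding position_sign_def sets(2) by simp
        moreover have "exponent_covector (pivot s) s = 1" using s(1) by (simp add: exponent_covector_def lookup_pivot)
        ultimately show ?thesis using IH sets(1) by simp
      next
        case False
        then show ?thesis using j by (simp add: exponent_covector_def lookup_pivot)
      qed
    qed
    then show ?case using s(1) unfolding s_def by simp
  qed simp
  from this[of "Suc q"] show ?thesis by (simp add: pivot_form_def atLeast0AtMost)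
qed

lemma wedge_by_pivot_form:
  assumes "q < j"
  shows "wedge_by (exponent_covector m) pivot_form (insert j {..q}) = position_sign j (insert j {..q}) * off_pivot_part m j"
proof -
  let ?K = "insert j {..q}"
  have "exponent_covector m = (\<lambda>j. off_pivot_part m j +
      (\<Sum>i\<le>q. of_nat (Poly_Mapping.lookup m i) * exponent_covector (pivot i) j))"
    by (simp add: off_pivot_part_def fun_eq_iff)
  then have "wedge_by (exponent_covector m) pivot_form ?K = wedge_by (off_pivot_part m) pivot_form ?K +
      (\<Sum>i\<le>q. of_nat (Poly_Mapping.lookup m i) * wedge_by (exponent_covector (pivot i)) pivot_form ?K)"
    by (simp only: wedge_by_add_left wedge_by_combination)
  also have "(\<Sum>i\<le>q. of_nat (Poly_Mapping.lookup m i) * wedge_by (exponent_covector (pivot i)) pivot_form ?K) = 0"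
  proof (intro sum.neutral ballI)
    fix i assume "i \<in> {..q}"
    then have "i \<in> set [0..<Suc q]" by auto
    from wedge_by_wedge_product_member[OF this, of "\<lambda>i. exponent_covector (pivot i)"]
    show "of_nat (Poly_Mapping.lookup m i) * wedge_by (exponent_covector (pivot i)) pivot_form ?K = 0"
      unfolding pivot_form_def by simp
  qed
  also have "wedge_by (off_pivot_part m) pivot_form ?K = position_sign j ?K * off_pivot_part m j * pivot_form (?K - {j})"
    unfolding wedge_by_def using assms by (subst sum.insert) (auto simp: off_pivot_part_zero)
  also have "?K - {j} = {..q}" using assms by auto
  finally show ?thesis by (simp add: pivot_form_atMost)
qed

text \<open>An index set at which \<open>dm \<and> dp\<^sub>0 \<and> \<dots> \<and> dp\<^sub>q\<close> has a nonzero coefficient, if \<open>m\<close> is free.\<close>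

definition witness :: "(nat \<Rightarrow>\<^sub>0 nat) \<Rightarrow> nat set" where
  "witness m = insert (SOME j. q < j \<and> off_pivot_part m j \<noteq> 0) {..q}"

lemma wedge_by_pivot_form_witness:
  assumes "\<not> is_pivotal m"
  shows "wedge_by (exponent_covector m) pivot_form (witness m) \<noteq> 0"
proof -
  define j where "j = (SOME j. q < j \<and> off_pivot_part m j \<noteq> 0)"
  have j: "q < j \<and> off_pivot_part m j \<noteq> 0"
    unfolding j_def by (rule someI_ex) (metis off_pivot_part_nonzero[OF assms])
  have "position_sign j (insert j {..q}) \<noteq> (0 :: complex)" by (simp add: position_sign_def)
  then show ?thesis using j wedge_by_pivot_form[of j m] unfolding witness_def j_def[symmetric] by simp
qed

definition weight where "weight = (\<Sum>i\<leftarrow>[0..<Suc q]. pivot i)"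

text \<open>One scalar equation of the system \<open>dG \<and> d\<omega> = 0\<close> for each free monomial \<open>m\<close>. The exponent is
  the one at which \<open>G = m\<close> contributes when \<open>\<omega>\<close> comes from the tuple of pivots; no other monomial
  contributes there.\<close>

definition row :: "(nat \<Rightarrow>\<^sub>0 nat) \<Rightarrow> polynomial \<Rightarrow> diff_form \<Rightarrow> complex" where
  "row m G \<omega> = Poly_Mapping.lookup (support_monomial (witness m) * wedge_by (grad G) (ext_deriv \<omega>) (witness m)) (m + weight)"

lemma clinear_row_form: "clinear (row m G)"
  unfolding row_def
  by (rule clinear_compose[OF clinear_lookup], rule clinear_compose[OF clinear_mult_left],
      rule clinear_compose[OF clinear_apply], rule clinear_compose[OF clinear_wedge_by_right clinear_ext_deriv])

lemma clinear_row_poly: "clinear (\<lambda>G. row m G \<omega>)"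
  unfolding row_def
  by (rule clinear_compose[OF clinear_lookup], rule clinear_compose[OF clinear_mult_left],
      rule clinear_compose[OF clinear_apply], rule clinear_compose[OF clinear_wedge_by_left clinear_grad])

lemma ext_deriv_rho_params:
  "F \<in> params \<Longrightarrow> ext_deriv (rho r q F) = (\<lambda>K. of_nat (\<Sum>i\<le>q. d i) * jacobian_form F [0..<Suc q] K)"
  by (rule ext_deriv_rho) (simp add: params_def)

lemma row_rho_zero:
  assumes "F \<in> params" "gradient_combination F q G"
  shows "row m G (rho r q F) = 0"
  unfolding row_def ext_deriv_rho_params[OF assms(1)] wedge_by_scale_right gradient_combination_wedge[OF assms(2)]
  by simp

lemma row_rho_pivot_tuple:
  "row m (Poly_Mapping.single n 1) (rho r q pivot_tuple) =
     (if m = n then of_nat (\<Sum>i\<le>q. d i) * wedge_by (exponent_covector n) pivot_form (witness m) else 0)"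
proof -
  have "support_monomial K * jacobian_form pivot_tuple [0..<Suc q] K = Poly_Mapping.single weight (pivot_form K)" for K
    using jacobian_form_monomials[of K pivot "[0..<Suc q]"] unfolding pivot_tuple_def[abs_def] weight_def pivot_form_def .
  then have "support_monomial K * wedge_by (grad (Poly_Mapping.single n 1)) (jacobian_form pivot_tuple [0..<Suc q]) K =
      Poly_Mapping.single (n + weight) (wedge_by (exponent_covector n) pivot_form K)" for K
    by (rule wedge_by_grad_monomial)
  then have "support_monomial K * wedge_by (grad (Poly_Mapping.single n 1)) (ext_deriv (rho r q pivot_tuple)) K =
      of_nat (\<Sum>i\<le>q. d i) * Poly_Mapping.single (n + weight) (wedge_by (exponent_covector n) pivot_form K)" for K
    unfolding ext_deriv_rho_params[OF pivot_tuple_in_params] wedge_by_scale_right mult.left_commute[of "support_monomial K"] by simp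
  also have "\<dots> K = scaleC (of_nat (\<Sum>i\<le>q. d i)) (Poly_Mapping.single (n + weight) (wedge_by (exponent_covector n) pivot_form K))" for K
    by (simp only: scaleC_eq_mult single_of_nat)
  finally show ?thesis
    unfolding row_def by (simp add: lookup_scaleC lookup_single when_def eq_commute)
qed

section \<open>The slice and the recovery of its coordinates\<close>

definition free_coords :: "(nat \<times> (nat \<Rightarrow>\<^sub>0 nat)) set" where
  "free_coords = Sigma {..q} (\<lambda>i. free_monomials (d i))"

lemma finite_free_coords: "finite free_coords"
  unfolding free_coords_def using finite_free_monomials by auto

text \<open>The equations for different \<open>G\<^sub>i\<close> are put into one block-diagonal system, to have a common
  denominator in Cramer's rule.\<close>

definition system :: "diff_form \<Rightarrow> nat \<times> (nat \<Rightarrow>\<^sub>0 nat) \<Rightarrow> nat \<times> (nat \<Rightarrow>\<^sub>0 nat) \<Rightarrow> complex" where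
  "system \<omega> x y = (if fst x = fst y then row (snd x) (Poly_Mapping.single (snd y) 1) \<omega> else 0)"

definition rhs :: "diff_form \<Rightarrow> nat \<times> (nat \<Rightarrow>\<^sub>0 nat) \<Rightarrow> complex" where
  "rhs \<omega> x = - row (snd x) (pivot_tuple (fst x)) \<omega>"

definition numerator where
  "numerator \<omega> z = index_det free_coords (\<lambda>x y. if y = z then rhs \<omega> x else system \<omega> x y)"

text \<open>Coordinate \<open>0\<close> is the common denominator, so this is the solution of the system in
  homogeneous coordinates.\<close>

definition recover :: "diff_form \<Rightarrow> nat \<Rightarrow> complex" where
  "recover \<omega> k = (if k = 0 then index_det free_coords (system \<omega>)
     else if k \<le> card free_coords then numerator \<omega> (enumeration free_coords (k - 1)) else 0)"

definition position :: "nat \<times> (nat \<Rightarrow>\<^sub>0 nat) \<Rightarrow> nat" where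
  "position z = Suc (inv_into {0..<card free_coords} (enumeration free_coords) z)"

text \<open>Homogenised tuples in normal form: \<open>c\<^sub>0\<close> multiplies the pivots, the other coordinates are the
  coefficients at the free monomials.\<close>

definition slice :: "(nat \<Rightarrow> complex) \<Rightarrow> nat \<Rightarrow> polynomial" where
  "slice c i = scaleC (c 0) (pivot_tuple i) +
     (\<Sum>m\<in>free_monomials (d i). scaleC (c (position (i, m))) (Poly_Mapping.single m 1))"

lemma position_enumeration: "k < card free_coords \<Longrightarrow> position (enumeration free_coords k) = Suc k"
  using enumeration[OF finite_free_coords] unfolding position_def bij_betw_def by (simp add: inv_into_f_f)

lemma recover_position:
  assumes "z \<in> free_coords" shows "recover \<omega> (position z) = numerator \<omega> z"
proof -
  obtain k where k: "k < card free_coords" "z = enumeration free_coords k" by (rule enumeration_cases[OF finite_free_coords assms])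
  then show ?thesis by (simp add: position_enumeration recover_def)
qed

lemma recover_affine: "recover \<omega> \<in> affine_space (Suc (card free_coords))"
  by (simp add: affine_space_def recover_def)

lemma homogeneous_fun_system: "homogeneous_fun 1 (\<lambda>\<omega>. system \<omega> x y)"
  using homogeneous_fun_linear[OF clinear_row_form] homogeneous_fun_zero
  unfolding system_def by (cases "fst x = fst y") simp_all

lemma homogeneous_fun_rhs: "homogeneous_fun 1 (\<lambda>\<omega>. rhs \<omega> x)"
  using homogeneous_fun_cmult[OF homogeneous_fun_linear[OF clinear_row_form], of "-1"] unfolding rhs_def by simp

lemma homogeneous_map_recover: "homogeneous_map (card free_coords) recover"
proof -
  have k: "homogeneous_fun (card free_coords) (\<lambda>\<omega>. recover \<omega> k)" for k
  proof -
    have den: "homogeneous_fun (\<Sum>y\<in>free_coords. 1) (\<lambda>\<omega>. index_det free_coords (system \<omega>))"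
      by (rule homogeneous_fun_index_det[OF finite_free_coords homogeneous_fun_system])
    have num: "homogeneous_fun (\<Sum>y\<in>free_coords. 1) (\<lambda>\<omega>. numerator \<omega> z)" for z
      unfolding numerator_def
    proof (rule homogeneous_fun_index_det[OF finite_free_coords])
      show "homogeneous_fun 1 (\<lambda>\<omega>. if y = z then rhs \<omega> x else system \<omega> x y)" for x y
        using homogeneous_fun_system homogeneous_fun_rhs by (cases "y = z") simp_all
    qed
    show ?thesis
      using den num[of "enumeration free_coords (k - 1)"] homogeneous_fun_zero
      unfolding recover_def by (cases "k = 0"; cases "k \<le> card free_coords") simp_all
  qed
  show ?thesis
    unfolding homogeneous_map_def
  proof (intro allI impI)
    fix l :: "(nat \<Rightarrow> complex) \<Rightarrow> complex" assume l: "clinear l"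
    define e where "e k = (\<lambda>j. if j = k then 1 else 0 :: complex)" for k :: nat
    have "recover \<omega> = (\<Sum>k\<le>card free_coords. scaleC (recover \<omega> k) (e k))" for \<omega>
    proof
      fix j
      have "(\<Sum>k\<le>card free_coords. scaleC (recover \<omega> k) (e k)) j = (\<Sum>k\<le>card free_coords. scaleC (recover \<omega> k) (e k) j)"
        by (rule clinear_sum[OF clinear_apply])
      also have "\<dots> = (\<Sum>k\<le>card free_coords. if k = j then recover \<omega> j else 0)"
        by (intro sum.cong) (auto simp: e_def)
      also have "\<dots> = recover \<omega> j" by (auto simp: recover_def)
      finally show "recover \<omega> j = (\<Sum>k\<le>card free_coords. scaleC (recover \<omega> k) (e k)) j" by simp
    qed
    then have "l (recover \<omega>) = l (\<Sum>k\<le>card free_coords. scaleC (recover \<omega> k) (e k))" for \<omega> by metis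
    then have "l (recover \<omega>) = (\<Sum>k\<le>card free_coords. l (e k) * recover \<omega> k)" for \<omega>
      by (simp add: clinear_sum[OF l] clinear_scale[OF l] mult.commute)
    then show "homogeneous_fun (card free_coords) (\<lambda>\<omega>. l (recover \<omega>))"
      by (simp only:) (intro homogeneous_fun_sum homogeneous_fun_cmult k)
  qed
qed

lemma slice_in_params: "slice c \<in> params"
proof -
  have "pivot_tuple i \<in> homogeneous_polys r (d i)" if "i \<le> q" for i
    using pivot_tuple_in_params that unfolding params_def by simp
  then show ?thesis
    unfolding params_def slice_def free_monomials_def
    by (auto intro!: homogeneous_polys_add homogeneous_polys_sum homogeneous_polys_scale single_homogeneous)
qed

lemma form_map_slice: "form_map 1 (\<lambda>c. slice c i)"
proof -
  have "form_map 1 (\<lambda>c :: nat \<Rightarrow> complex. scaleC (c k) p)" for k and p :: polynomial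
    using form_map.mult[OF clinear_apply form_map.const, of k p] by simp
  then show ?thesis unfolding slice_def by (intro form_map.add form_map_sum)
qed

lemma row_expansion:
  assumes "x \<in> free_coords" "G = scaleC t (pivot_tuple (fst x)) + (\<Sum>m\<in>free_monomials (d (fst x)). scaleC (u (fst x, m)) (Poly_Mapping.single m 1))"
  shows "row (snd x) G \<omega> = (\<Sum>y\<in>free_coords. system \<omega> x y * u y) - t * rhs \<omega> x"
proof -
  obtain i n where x: "x = (i, n)" by (cases x)
  have i: "i \<le> q" using assms(1) by (simp add: x free_coords_def)
  have "(\<Sum>y\<in>free_coords. system \<omega> x y * u y) = (\<Sum>k\<le>q. \<Sum>m\<in>free_monomials (d k). system \<omega> x (k, m) * u (k, m))"
    unfolding free_coords_def by (subst sum.Sigma) (auto simp: finite_free_monomials)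
  also have "\<dots> = (\<Sum>k\<le>q. if k = i then \<Sum>m\<in>free_monomials (d i). row n (Poly_Mapping.single m 1) \<omega> * u (i, m) else 0)"
    by (intro sum.cong refl) (auto simp: system_def x)
  also have "\<dots> = (\<Sum>m\<in>free_monomials (d i). row n (Poly_Mapping.single m 1) \<omega> * u (i, m))" using i by simp
  finally have S: "(\<Sum>y\<in>free_coords. system \<omega> x y * u y) = (\<Sum>m\<in>free_monomials (d i). row n (Poly_Mapping.single m 1) \<omega> * u (i, m))" .
  show ?thesis
    unfolding S assms(2) clinear_add[OF clinear_row_poly] clinear_sum[OF clinear_row_poly] clinear_scale[OF clinear_row_poly]
    by (simp add: x rhs_def mult.commute)
qed

text \<open>The entries of the tuple satisfy the linear system, and Cramer's rule expresses them by
  determinants.\<close>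

lemma recover_slice:
  assumes "c \<in> affine_space (Suc (card free_coords))" "c 0 \<noteq> 0"
  shows "\<exists>h. recover (rho r q (slice c)) = scaleC h c"
proof -
  let ?\<omega> = "rho r q (slice c)"
  let ?u = "\<lambda>y. c (position y) / c 0"
  have eqs: "(\<Sum>y\<in>free_coords. system ?\<omega> x y * ?u y) = rhs ?\<omega> x" if x: "x \<in> free_coords" for x
  proof -
    have "fst x \<le> q" using x by (auto simp: free_coords_def)
    then have "row (snd x) (slice c (fst x)) ?\<omega> = 0"
      by (intro row_rho_zero slice_in_params gradient_combination_self)
    then have "(\<Sum>y\<in>free_coords. system ?\<omega> x y * c (position y)) = c 0 * rhs ?\<omega> x"
      using row_expansion[OF x, of "slice c (fst x)" "c 0" "\<lambda>y. c (position y)" ?\<omega>] by (simp add: slice_def)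
    then show ?thesis using assms(2) by (simp add: sum_divide_distrib[symmetric] times_divide_eq_right)
  qed
  have cr: "index_det free_coords (system ?\<omega>) * ?u z = numerator ?\<omega> z" if "z \<in> free_coords" for z
    unfolding numerator_def
    by (rule cramer_index_det[of free_coords "system ?\<omega>" ?u "rhs ?\<omega>", OF finite_free_coords eqs that])
  have "recover ?\<omega> k = (index_det free_coords (system ?\<omega>) / c 0) * c k" for k
  proof -
    consider "k = 0" | l where "k = Suc l" "l < card free_coords" | "k > card free_coords"
      by (metis Suc_pred bot_nat_0.not_eq_extremum less_Suc_eq_le not_le_imp_less Suc_le_lessD)
    then show ?thesis
    proof cases
      case 1
      then show ?thesis using assms(2) by (simp add: recover_def)
    next
      case 2
      then have "enumeration free_coords l \<in> free_coords" by (intro enumeration_in finite_free_coords)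
      from cr[OF this] show ?thesis using 2 by (simp add: recover_def position_enumeration)
    next
      case 3
      then show ?thesis using assms(1) by (simp add: recover_def affine_space_def)
    qed
  qed
  then show ?thesis by (intro exI[of _ "index_det free_coords (system ?\<omega>) / c 0"]) (simp add: fun_eq_iff)
qed

text \<open>Nonzero if, in each degree \<open>d\<^sub>i\<close>, the power products of \<open>F\<close> project isomorphically to the
  span of the pivotal monomials.\<close>

definition projection_det :: "(nat \<Rightarrow> polynomial) \<Rightarrow> complex" where
  "projection_det F = (\<Prod>i\<le>q. index_det (pivotal_monomials (d i)) (\<lambda>\<beta> \<alpha>. Poly_Mapping.lookup (power_product F \<alpha>) \<beta>))"

lemma normal_form:
  assumes F: "F \<in> params" and "projection_det F \<noteq> 0" and i: "i \<le> q"
  obtains G where "G \<in> homogeneous_polys r (d i)" "gradient_combination F q G"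
    "G = pivot_tuple i + (\<Sum>m\<in>free_monomials (d i). scaleC (Poly_Mapping.lookup G m) (Poly_Mapping.single m 1))"
proof -
  have nz: "index_det (pivotal_monomials (d i)) (\<lambda>\<beta> \<alpha>. Poly_Mapping.lookup (power_product F \<alpha>) \<beta>) \<noteq> 0"
    using assms(2) i unfolding projection_det_def by simp
  obtain u where u: "\<And>\<beta>. \<beta> \<in> pivotal_monomials (d i) \<Longrightarrow>
      (\<Sum>\<alpha>\<in>pivotal_monomials (d i). Poly_Mapping.lookup (power_product F \<alpha>) \<beta> * u \<alpha>) = (if \<beta> = pivot i then 1 else 0)"
    using index_det_nonzero_imp_solvable[OF finite_pivotal_monomials nz, of "\<lambda>\<beta>. if \<beta> = pivot i then 1 else 0"] by blast
  define G where "G = (\<Sum>\<alpha>\<in>pivotal_monomials (d i). scaleC (u \<alpha>) (power_product F \<alpha>))"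
  have hom: "G \<in> homogeneous_polys r (d i)"
    unfolding G_def using power_product_homogeneous[OF F]
    by (intro homogeneous_polys_sum homogeneous_polys_scale) blast
  have "gradient_combination F q G"
    unfolding G_def power_product_def
    by (intro gradient_combination_sum gradient_combination_scale gradient_combination_prod
        gradient_combination_power gradient_combination_self) simp
  moreover have "Poly_Mapping.lookup G k = Poly_Mapping.lookup (pivot_tuple i + (\<Sum>m\<in>free_monomials (d i). scaleC (Poly_Mapping.lookup G m) (Poly_Mapping.single m 1))) k" for k
  proof -
    have R: "Poly_Mapping.lookup (pivot_tuple i + (\<Sum>m\<in>free_monomials (d i). scaleC (Poly_Mapping.lookup G m) (Poly_Mapping.single m 1))) k =
        (if k = pivot i then 1 else 0) + (if k \<in> free_monomials (d i) then Poly_Mapping.lookup G k else 0)"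
      using finite_free_monomials
      by (simp add: lookup_add lookup_sum lookup_scaleC pivot_tuple_def lookup_single when_def eq_commute if_distrib[of "\<lambda>x. _ * x"] cong: if_cong)
    have piv: "pivot i \<in> pivotal_monomials (d i)" by (rule pivot_in_pivotal_monomials[OF i])
    consider "k \<in> pivotal_monomials (d i)" | "k \<in> free_monomials (d i)" | "k \<notin> monomials r (d i)" unfolding pivotal_monomials_def free_monomials_def by blast
    then show ?thesis
    proof cases
      case 1
      then have "k \<notin> free_monomials (d i)" unfolding pivotal_monomials_def free_monomials_def by blast
      moreover have "Poly_Mapping.lookup G k = (if k = pivot i then 1 else 0)"
        using u[OF 1] unfolding G_def by (simp add: lookup_sum lookup_scaleC mult.commute)
      ultimately show ?thesis unfolding R by simp
    next
      case 2
      then have "k \<noteq> pivot i" using piv unfolding pivotal_monomials_def free_monomials_def by blast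
      then show ?thesis unfolding R using 2 by simp
    next
      case 3
      then have "Poly_Mapping.lookup G k = 0" using hom unfolding homogeneous_polys_iff by (auto simp: in_keys_iff)
      moreover have "k \<noteq> pivot i" "k \<notin> free_monomials (d i)" using 3 piv unfolding pivotal_monomials_def free_monomials_def by blast+
      ultimately show ?thesis unfolding R by simp
    qed
  qed
  then have "G = pivot_tuple i + (\<Sum>m\<in>free_monomials (d i). scaleC (Poly_Mapping.lookup G m) (Poly_Mapping.single m 1))"
    by (rule poly_mapping_eqI)
  ultimately show ?thesis using that hom by blast
qed

text \<open>The normal forms \<open>G\<^sub>i\<close> solve the system of the form of \<open>F\<close>, so by Cramer's rule the recovered
  tuple is a multiple of \<open>G\<close>, and the form of \<open>G\<close> is a multiple of that of \<open>F\<close>.\<close>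

lemma slice_recover:
  assumes F: "F \<in> params" and gen: "projection_det F \<noteq> 0"
  shows "\<exists>g. rho r q (slice (recover (rho r q F))) = scaleC g (rho r q F)"
proof -
  let ?\<omega> = "rho r q F" and ?\<Delta> = "index_det free_coords (system (rho r q F))"
  have "\<forall>i\<in>{..q}. \<exists>G. G \<in> homogeneous_polys r (d i) \<and> gradient_combination F q G \<and>
      G = pivot_tuple i + (\<Sum>m\<in>free_monomials (d i). scaleC (Poly_Mapping.lookup G m) (Poly_Mapping.single m 1))"
  proof
    fix i assume "i \<in> {..q}"
    then have "i \<le> q" by simp
    from normal_form[OF F gen this] show "\<exists>G. G \<in> homogeneous_polys r (d i) \<and> gradient_combination F q G \<and>
      G = pivot_tuple i + (\<Sum>m\<in>free_monomials (d i). scaleC (Poly_Mapping.lookup G m) (Poly_Mapping.single m 1))" by blast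
  qed
  from bchoice[OF this] obtain G where *: "\<forall>i\<in>{..q}. G i \<in> homogeneous_polys r (d i) \<and>
      gradient_combination F q (G i) \<and>
      G i = pivot_tuple i + (\<Sum>m\<in>free_monomials (d i). scaleC (Poly_Mapping.lookup (G i) m) (Poly_Mapping.single m 1))" by blast
  then have G: "\<And>i. i \<le> q \<Longrightarrow> G i \<in> homogeneous_polys r (d i)"
      "\<And>i. i \<le> q \<Longrightarrow> gradient_combination F q (G i)"
    by auto
  have G_eq: "G i = pivot_tuple i + (\<Sum>m\<in>free_monomials (d i). scaleC (Poly_Mapping.lookup (G i) m) (Poly_Mapping.single m 1))" if "i \<le> q" for i
    using bspec[OF *, of i] that by blast
  let ?u = "\<lambda>y. Poly_Mapping.lookup (G (fst y)) (snd y)"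
  have eqs: "(\<Sum>y\<in>free_coords. system ?\<omega> x y * ?u y) = rhs ?\<omega> x" if x: "x \<in> free_coords" for x
  proof -
    have i: "fst x \<le> q" using x by (auto simp: free_coords_def)
    have "row (snd x) (G (fst x)) ?\<omega> = 0" by (rule row_rho_zero[OF F G(2)[OF i]])
    moreover have "row (snd x) (G (fst x)) ?\<omega> = (\<Sum>y\<in>free_coords. system ?\<omega> x y * ?u y) - 1 * rhs ?\<omega> x"
      using G_eq[OF i] by (intro row_expansion[OF x]) (simp only: scaleC_one fst_conv snd_conv)
    ultimately show ?thesis by simp
  qed
  have cr: "?\<Delta> * ?u z = numerator ?\<omega> z" if "z \<in> free_coords" for z
    unfolding numerator_def
    by (rule cramer_index_det[of free_coords "system ?\<omega>" ?u "rhs ?\<omega>", OF finite_free_coords eqs that])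
  have slice: "slice (recover ?\<omega>) i = scaleC ?\<Delta> (G i)" if i: "i \<le> q" for i
  proof -
    have "slice (recover ?\<omega>) i = scaleC ?\<Delta> (pivot_tuple i) +
        (\<Sum>m\<in>free_monomials (d i). scaleC (?\<Delta> * Poly_Mapping.lookup (G i) m) (Poly_Mapping.single m 1))"
      unfolding slice_def
    proof (intro arg_cong2[of _ _ _ _ "(+)"] sum.cong refl)
      show "scaleC (recover ?\<omega> 0) (pivot_tuple i) = scaleC ?\<Delta> (pivot_tuple i)" by (simp add: recover_def)
      fix m assume "m \<in> free_monomials (d i)"
      then have "(i, m) \<in> free_coords" using i by (simp add: free_coords_def)
      then show "scaleC (recover ?\<omega> (position (i, m))) (Poly_Mapping.single m 1) =
          scaleC (?\<Delta> * Poly_Mapping.lookup (G i) m) (Poly_Mapping.single m 1)"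
        using recover_position cr by fastforce
    qed
    also have "\<dots> = scaleC ?\<Delta> (pivot_tuple i + (\<Sum>m\<in>free_monomials (d i). scaleC (Poly_Mapping.lookup (G i) m) (Poly_Mapping.single m 1)))"
      by (simp add: scaleC_add_right scaleC_sum_right scaleC_scaleC)
    also have "\<dots> = scaleC ?\<Delta> (G i)" using G_eq[OF i] by (simp only:)
    finally show ?thesis .
  qed
  obtain c where "rho r q (slice (recover ?\<omega>)) = scaleC c ?\<omega>"
  proof (rule rho_of_gradient_combinations)
    show "F i \<in> homogeneous_polys r (d i)" if "i \<le> q" for i using F that by (simp add: params_def)
    show "slice (recover ?\<omega>) i \<in> homogeneous_polys r (d i)" if "i \<le> q" for i
      using slice_in_params that by (simp add: params_def)
    show "gradient_combination F q (slice (recover ?\<omega>) i)" if "i \<le> q" for i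
      unfolding slice[OF that] by (intro gradient_combination_scale G(2) that)
  qed
  then show ?thesis by blast
qed

sublocale variety: parametrised_variety "twisted_forms r q (\<Sum>i\<le>q. d i)" params "rho r q"
proof
  show "complex_vector.subspace params"
    by (rule complex_vector.subspaceI)
      (auto simp: params_def homogeneous_polys_zero homogeneous_polys_add homogeneous_polys_scale)
  show "rho r q F \<in> twisted_forms r q (\<Sum>i\<le>q. d i)" if "F \<in> params" for F
    using that by (intro rho_in_twisted_forms) (simp add: params_def)
  show "poly_on_lines params (\<lambda>F. f (rho r q F))" if f: "homogeneous_fun m f" for m f
  proof (rule poly_on_linesI)
    fix F G :: "nat \<Rightarrow> polynomial"
    have "form_map 1 (\<lambda>c :: nat \<Rightarrow> complex. (scaleC (c 0) F + scaleC (c 1) G) i)" for i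
      using form_map_pencil[of "F i" "G i"] by simp
    then have "form_map (Suc q) (\<lambda>c :: nat \<Rightarrow> complex. rho r q (scaleC (c 0) F + scaleC (c 1) G))"
      by (intro form_map_rho)
    then show "\<exists>n. homogeneous_fun n (\<lambda>c :: nat \<Rightarrow> complex. f (rho r q (scaleC (c 0) F + scaleC (c 1) G)))"
      using homogeneous_fun_compose[OF f] form_map_imp_homogeneous_map by blast
  qed
qed

lemma poly_on_lines_projection_det: "poly_on_lines params projection_det"
  unfolding projection_det_def
proof (intro poly_on_lines_prod poly_on_linesI)
  fix i and F G :: "nat \<Rightarrow> polynomial"
  let ?H = "\<lambda>c :: nat \<Rightarrow> complex. scaleC (c 0) F + scaleC (c 1) G"
  have H: "form_map 1 (\<lambda>c. ?H c k)" for k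
    using form_map_pencil[of "F k" "G k"] by simp
  have pow: "form_map n (\<lambda>c. ?H c k ^ n)" for k n
    using form_map_prod[of "{..<n}" "\<lambda>_. 1" "\<lambda>_ c. ?H c k"] H[of k] by simp
  have "form_map (\<Sum>k\<le>q. Poly_Mapping.lookup \<alpha> k) (\<lambda>c. power_product (?H c) \<alpha>)" for \<alpha>
    unfolding power_product_def by (intro form_map_prod pow) simp
  then have "homogeneous_fun (\<Sum>k\<le>q. Poly_Mapping.lookup \<alpha> k) (\<lambda>c. Poly_Mapping.lookup (power_product (?H c) \<alpha>) \<beta>)" for \<alpha> \<beta>
    by (intro form_map_imp_homogeneous_fun form_map_linear[OF _ clinear_lookup])
  then show "\<exists>n. homogeneous_fun n (\<lambda>c. index_det (pivotal_monomials (d i)) (\<lambda>\<beta> \<alpha>. Poly_Mapping.lookup (power_product (?H c) \<alpha>) \<beta>))"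
    using homogeneous_fun_index_det[OF finite_pivotal_monomials, of "d i" "\<lambda>\<alpha>. \<Sum>k\<le>q. Poly_Mapping.lookup \<alpha> k"
        "\<lambda>c \<beta> \<alpha>. Poly_Mapping.lookup (power_product (?H c) \<alpha>) \<beta>"] by blast
qed

lemma projection_det_pivot_tuple: "projection_det pivot_tuple \<noteq> 0"
proof -
  have "index_det (pivotal_monomials e) (\<lambda>\<beta> \<alpha>. Poly_Mapping.lookup (power_product pivot_tuple \<alpha>) \<beta>) \<noteq> 0" for e
    by (rule index_det_diagonal[OF finite_pivotal_monomials])
      (auto simp: pivotal_monomials_def power_product_pivot_tuple lookup_single)
  then show ?thesis unfolding projection_det_def by simp
qed

text \<open>The system is diagonal with nonzero entries.\<close>

lemma recover_pivot_tuple: "recover (rho r q pivot_tuple) 0 \<noteq> 0"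
proof -
  have "d 0 \<le> (\<Sum>i\<le>q. d i)" by (rule member_le_sum) auto
  then have "(\<Sum>i\<le>q. d i) \<noteq> 0" using d_pos[of 0] by linarith
  then have D: "of_nat (\<Sum>i\<le>q. d i) \<noteq> (0 :: complex)" by (simp only: of_nat_eq_0_iff not_False_eq_True)
  have "index_det free_coords (system (rho r q pivot_tuple)) \<noteq> 0"
  proof (rule index_det_diagonal[OF finite_free_coords])
    fix x y assume "x \<in> free_coords" "y \<in> free_coords" "x \<noteq> y"
    then show "system (rho r q pivot_tuple) x y = 0"
      unfolding system_def row_rho_pivot_tuple by (auto simp: prod_eq_iff)
  next
    fix x assume "x \<in> free_coords"
    then have "\<not> is_pivotal (snd x)" by (auto simp: free_coords_def free_monomials_def)
    then show "system (rho r q pivot_tuple) x x \<noteq> 0"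
      unfolding system_def row_rho_pivot_tuple using D wedge_by_pivot_form_witness by simp
  qed
  then show ?thesis by (simp add: recover_def)
qed

text \<open>The variable \<open>x\<^bsub>q+2\<^esub>\<close> occurs in no pivot, so its powers are free. As a consequence \<open>recover\<close>
  has positive degree.\<close>

lemma free_coords_nonempty: "card free_coords > 0"
proof -
  let ?m = "Poly_Mapping.single (q + 2) (d 0)"
  have "?m \<in> monomials r (d 0)"
    using q_le by (auto simp: monomials_def lookup_single when_def)
  moreover have "\<not> is_pivotal ?m" using d_pos[of 0] by (auto simp: is_pivotal_def)
  ultimately have "(0, ?m) \<in> free_coords" by (auto simp: free_coords_def free_monomials_def)
  then show ?thesis using finite_free_coords by (auto simp: card_gt_0_iff)
qed

lemma rational_forms_eq: "rational_forms r q d = variety.closed_image"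
proof -
  have "rho_image r q d = variety.image"
  proof -
    have "(\<forall>i\<le>q. F i \<in> homogeneous_polys r (d i) \<and> F i \<noteq> 0) \<and> rho r q F \<noteq> 0 \<longleftrightarrow>
        F \<in> params \<and> rho r q F \<noteq> 0" for F
      using rho_zero_entry[of _ q F r] unfolding params_def by blast
    then show ?thesis unfolding rho_image_def variety.image_def by (simp only:)
  qed
  then show ?thesis unfolding rational_forms_def variety.closed_image_def by simp
qed

theorem rational: "rational_variety (twisted_forms r q (\<Sum>i\<le>q. d i)) (rational_forms r q d)"
  unfolding rational_forms_eq
proof (rule variety.rational_variety_if_generically_invertible[where C = recover and N = "card free_coords"
      and \<Psi> = "\<lambda>c. rho r q (slice c)" and D = projection_det and F\<^sub>0 = pivot_tuple and c\<^sub>0 = "\<lambda>k. if k = 0 then 1 else 0"])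
  show "homogeneous_map (Suc q) (\<lambda>c. rho r q (slice c))"
    by (intro form_map_imp_homogeneous_map form_map_rho form_map_slice)
  have "slice (\<lambda>k. if k = 0 then 1 else 0) i = pivot_tuple i" for i
    by (simp add: slice_def position_def scaleC_one)
  then have "rho r q (slice (\<lambda>k. if k = 0 then 1 else 0)) = rho r q pivot_tuple" by (intro rho_cong) 
  then show "recover (rho r q (slice (\<lambda>k. if k = 0 then 1 else 0))) 0 \<noteq> 0" using recover_pivot_tuple by simp
  show "\<exists>F\<in>params. rho r q (slice c) = rho r q F" for c using slice_in_params by blast
qed (use homogeneous_map_recover recover_affine free_coords_nonempty recover_slice slice_recover
    poly_on_lines_projection_det pivot_tuple_in_params projection_det_pivot_tuple in \<open>auto simp: affine_space_def\<close>)

end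

theorem theorem3:
  fixes r q :: nat and d :: "nat \<Rightarrow> nat"
  assumes "r \<ge> 3" and "1 \<le> q" and "q \<le> r - 2"
    and "\<And>i. i \<le> q \<Longrightarrow> d i \<ge> 1"
  shows "rational_variety (twisted_forms r q (\<Sum>i\<le>q. d i)) (rational_forms r q d)"
proof -
  interpret rational_form_data r q d
    using assms by unfold_locales auto
  show ?thesis by (rule rational)
qed

end
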